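(* Let $p>3$ be a prime. Then $$\sum_{k=0}^{p-1}\binom{2k}k\frac{W_k}{8^k}\equiv\begin{cases} 4x^2-2p\pmod p&\text{if } p\equiv 1,3\pmod 8 \text{ and so } p=x^2+2y^2 \text{ with } x,y\in\mathbb Z,\\ 0\pmod p&\text{if } p\equiv 5,7\pmod 8.\end{cases}$$
   Context: For each nonnegative integer $n$, $W_n=\sum_{k=0}^{[n/3]}\binom{2k}k\binom{3k}k\binom n{3k}(-3)^{n-3k}$, where $[x]$ is the greatest integer not exceeding $x$. Congruences modulo $p$ between rational numbers are taken in the ring of rational numbers whose denominator is not divisible by $p$. *)

theory Defs
  imports Complex_Main "HOL-Computational_Algebra.Primes"
begin

definition W :: "nat \<Rightarrow> int" where
  "W n = (\<Sum>k=0..n div 3.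
     int ((2 * k) choose k) * int ((3 * k) choose k) * int (n choose (3 * k)) * (-3) ^ (n - 3 * k))"

(* quotient_of returns the fraction in lowest terms with positive denominator. *)
definition p_integral :: "nat \<Rightarrow> rat set" where
  "p_integral p = {q. \<not> int p dvd snd (quotient_of q)}"

(* Congruence modulo the ideal generated by p in the ring p_integral p; in particular
   both sides are required to lie in that ring. *)
definition rat_cong :: "nat \<Rightarrow> rat \<Rightarrow> rat \<Rightarrow> bool" where
  "rat_cong p a b \<longleftrightarrow>
     a \<in> p_integral p \<and> b \<in> p_integral p \<and> (\<exists>c\<in>p_integral p. a - b = of_nat p * c)"

end

theory Submission
  imports Defs "HOL-Number_Theory.Number_Theory"
begin

text \<open>
Put \<open>n = (p - 1) / 2\<close> and \<open>N = \<lfloor>p / 4\<rfloor>\<close>. Modulo \<open>p\<close> one may replace \<open>n\<close> by \<open>- 1 / 2\<close> and \<open>N\<close> by \<open>- 1 / 4\<close>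
or \<open>- 3 / 4\<close> in binomial coefficients. Two Saalschuetz-type summations turn the sum of the theorem into the
sum of the cubes of the \<open>n choose m\<close>, divided by \<open>2 ^ n\<close>, and then into the mean over the circle
of the Legendre polynomial \<open>P\<^sub>N (cos \<theta>)\<close>. This mean equals \<open>P\<^sub>N(0)\<^sup>2\<close>; in particular it vanishes for odd \<open>N\<close>,
that is for \<open>p \<equiv> 5, 7 (mod 8)\<close>.

For \<open>p \<equiv> 1, 3 (mod 8)\<close> consider, for \<open>t\<close> in the ring of Gaussian integers modulo \<open>p\<close>, the sum \<open>\<Phi>(t)\<close> of
\<open>\<chi>(norm z) \<chi>(Re (t z\<^sup>4))\<close> over all residues \<open>z\<close>, where \<open>\<chi>\<close> is the Legendre symbol. Up to sign, \<open>\<Phi>(t)\<close> depends only on the class of \<open>t\<close>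
modulo scalars times fourth powers. There are four classes; \<open>\<Phi>\<close> vanishes on one of them and has the same
square on two others, so the second moment of \<open>\<Phi>\<close> gives \<open>p = c\<^sup>2 + 2 e\<^sup>2\<close> with \<open>4 (p - 1) c = \<Phi>(1)\<close>. On the other
hand \<open>2 c\<close> is the character sum of \<open>y (y\<^sup>2 - 8 y + 8)\<close>, which is congruent to \<open>\<plusminus> P\<^sub>N(0)\<close>. Since the representation
\<open>p = x\<^sup>2 + 2 y\<^sup>2\<close> is essentially unique, \<open>4 x\<^sup>2 \<equiv> P\<^sub>N(0)\<^sup>2\<close>.
\<close>

subsection \<open>Binomial sum identities\<close>

text \<open>Putting y = -2 u turns the cubic y (y^2 - 8 y + 8) into -8 u (u^2 + 4 u + 2), so v^2 = y
  (y^2 - 8 y + 8) is a quadratic twist of the standard elliptic curve with complex multiplication by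
  the square root of -2. That theory would give its character sum as 2 c with p = c^2 + 2 e^2;
  \<open>Phi\<close> yields the same by counting alone. For t = 1 the argument of the symbols is the
  sextic form (x^2 + y^2) (x^4 - 6 x^2 y^2 + y^4), whose sum over the projective line is twice the
  cubic sum, and varying t produces enough twists for orthogonality to evaluate the sum of all
  squares. The obstacle is that -1 may or may not be a square modulo p, so the Gaussian residues are
  a field or have zero divisors; invertibility is therefore always read off the norm, which treats
  both cases alike. In the case p = 1, 3 (mod 8) that congruence enters only as
  \<open>chi (-2) = 1\<close>, which makes the diagonal directions add to the second moment instead
  of cancelling the axes. The sign of c stays unknown, but only its square matters, and the term - 2
  p is zero modulo p.\<close>

lemma sum_telescope_from_zero:
  fixes f G :: "nat \<Rightarrow> 'a::comm_ring_1"
  assumes "\<And>k. f k = G (Suc k) - G k"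
  shows "(\<Sum>k<n. f k) = G n - G 0"
  by (induction n) (simp_all add: assms)

text \<open>The ratio rules from here on are cross-multiplied, with subtraction taken after the
  cast, so they hold for all arguments, outside the range of the binomial coefficient too, and can
  serve as hypotheses for Groebner bases.\<close>

lemma of_nat_Suc_choose_Suc:
  "(of_nat (Suc k) :: 'a::idom) * of_nat (a choose Suc k) = (of_nat a - of_nat k) * of_nat (a choose k)"
proof (cases "k \<le> a")
  case True
  have "Suc k * (a choose Suc k) = (a - k) * (a choose k)"
    using binomial_absorb_comp[of a k] binomial_absorption[of k a]
    by (metis binomial_absorb_comp binomial_absorption mult.commute)
  then have "(of_nat (Suc k * (a choose Suc k)) :: 'a) = of_nat ((a - k) * (a choose k))"
    by simp
  then show ?thesis using True by (simp only: of_nat_mult of_nat_diff)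
qed (simp add: binomial_eq_0)

lemma of_nat_choose_upper:
  "(of_nat (Suc a) - of_nat k :: 'a::idom) * of_nat (Suc a choose k) = of_nat (Suc a) * of_nat (a choose k)"
proof (cases "k \<le> Suc a")
  case True
  have "(Suc a - k) * (Suc a choose k) = Suc a * (a choose k)"
    using binomial_absorb_comp[of "Suc a" k] by simp
  then have "(of_nat ((Suc a - k) * (Suc a choose k)) :: 'a) = of_nat (Suc a * (a choose k))"
    by simp
  then show ?thesis using True by (simp only: of_nat_mult of_nat_diff)
qed (simp add: binomial_eq_0)

lemma of_nat_choose_add_Suc:
  "(of_nat (Suc k) :: 'a::idom) * of_nat (a + Suc k choose Suc k) = (of_nat a + of_nat k + 1) * of_nat (a + k choose k)"
proof -
  have "(of_nat (Suc k * (a + Suc k choose Suc k)) :: 'a) = of_nat (Suc (a + k) * (a + k choose k))"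
    using Suc_times_binomial_eq[of "a + k" k] by (simp add: mult.commute)
  then show ?thesis by (simp only: of_nat_mult of_nat_Suc of_nat_add ac_simps)
qed

lemma of_nat_choose_add_left:
  "(of_nat (Suc a) :: 'a::idom) * of_nat (Suc a + k choose k) = (of_nat a + of_nat k + 1) * of_nat (a + k choose k)"
proof -
  have "(of_nat (Suc (a + k)) - of_nat k :: 'a) * of_nat (Suc (a + k) choose k)
      = of_nat (Suc (a + k)) * of_nat (a + k choose k)"
    by (rule of_nat_choose_upper)
  then show ?thesis by (simp add: algebra_simps)
qed

lemma of_nat_central_binomial_Suc:
  "(of_nat (Suc k) :: 'a::field_char_0) * of_nat (2 * Suc k choose Suc k)
     = 2 * (2 * of_nat k + 1) * of_nat (2 * k choose k)"
proof -
  have 1: "(of_nat (Suc k) :: 'a) * of_nat (Suc k + Suc k choose Suc k)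
       = (of_nat (Suc k) + of_nat k + 1) * of_nat (Suc k + k choose k)"
    by (rule of_nat_choose_add_Suc)
  have 2: "(of_nat (Suc k) :: 'a) * of_nat (Suc k + k choose k)
       = (of_nat k + of_nat k + 1) * of_nat (k + k choose k)"
    by (rule of_nat_choose_add_left)
  have "of_nat (Suc k) * (of_nat (Suc k) * (of_nat (Suc k + Suc k choose Suc k)::'a)) =
        2 * (of_nat (Suc k) * (of_nat (Suc k) * of_nat (Suc k + k choose k)))"
    unfolding 1 by (simp only: of_nat_Suc) (simp only: mult_2 distrib_right add.commute add.left_commute distrib_left mult_1_left)
  also have "\<dots> = of_nat (Suc k) * (2 * (2 * of_nat k + 1) * of_nat (2 * k choose k))"
    unfolding 2 by (simp only: mult_2 mult.left_commute mult.assoc distrib_right)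
  finally show ?thesis by (metis mult_2 mult_left_cancel of_nat_neq_0)
qed

text \<open>The mean of \<open>P\<^sub>n (cos \<theta>)\<close> over \<open>\<theta>\<close>, and \<open>P\<^sub>n(0)\<close>, for the Legendre polynomial \<open>P\<^sub>n\<close>.\<close>

definition legendre_mean :: "nat \<Rightarrow> rat" where
  "legendre_mean n = (\<Sum>k\<le>n. of_nat (n choose k) * of_nat (n + k choose k) * of_nat (2 * k choose k) * (-1/4) ^ k)"

definition legendre_at_0 :: "nat \<Rightarrow> rat" where
  "legendre_at_0 n = (\<Sum>k\<le>n. of_nat (n choose k) * of_nat (n + k choose k) * (-1/2) ^ k)"

text \<open>Here and below, \<open>G\<close> is the certificate of a proof by creative telescoping.\<close>

lemma choose_square_telescope:
  fixes a b :: nat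
  defines "A \<equiv> of_nat (Suc a) :: rat" and "B \<equiv> of_nat (Suc b) :: rat"
  defines "q \<equiv> \<lambda>k. of_nat (Suc a choose k) * of_nat (Suc b choose k) * of_nat (Suc (a + b) + k choose k) :: rat"
  assumes K: "K > Suc a"
  shows "(\<Sum>k<K. (A ^ 3 * (B - of_nat k) - B ^ 3 * (A - of_nat k)) * q k) = 0"
proof -
  define G where "G = (\<lambda>k. (A - B) * of_nat k ^ 3 * q k)"
  have step: "(A ^ 3 * (B - of_nat k) - B ^ 3 * (A - of_nat k)) * q k = G (Suc k) - G k" for k
  proof -
    have "of_nat (Suc k) ^ 3 * q (Suc k) = (of_nat (Suc k) * of_nat (Suc a choose Suc k)) *
            (of_nat (Suc k) * of_nat (Suc b choose Suc k)) *
            (of_nat (Suc k) * of_nat (Suc (a + b) + Suc k choose Suc k))"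
      by (simp only: q_def power3_eq_cube) (simp add: algebra_simps)
    also have "\<dots> = (A - of_nat k) * (B - of_nat k) * (A + B + of_nat k) * q k"
      unfolding of_nat_Suc_choose_Suc[of _ "Suc a"] of_nat_Suc_choose_Suc[of _ "Suc b"]
        of_nat_choose_add_Suc[of _ "Suc (a + b)"]
      by (simp only: q_def A_def B_def of_nat_Suc of_nat_add) (simp only: ac_simps)
    finally have "G (Suc k) = (A - B) * ((A - of_nat k) * (B - of_nat k) * (A + B + of_nat k) * q k)"
      unfolding G_def by (simp only: mult.assoc)
    then show ?thesis unfolding G_def by (simp add: algebra_simps power3_eq_cube)
  qed
  have "q K = 0" using K by (simp add: q_def)
  then show ?thesis using sum_telescope_from_zero[of _ G K, OF step] by (simp add: G_def)
qed

text \<open>A case of Saalschuetz's summation. The induction fixes \<open>n\<close> and moves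
  \<open>m\<close>: from a to a + 1 the right-hand side changes by the square of (n - a) / (a + 1),
  and the telescoped sum says that the left-hand side does too.\<close>

lemma choose_square_expansion:
  assumes "m \<le> n" "n < K"
  shows "(\<Sum>k<K. of_nat (m choose k) * of_nat (n - m choose k) * of_nat (n + k choose k)) = (of_nat (n choose m) ^ 2 :: rat)"
  using assms(1)
proof (induction m)
  case 0
  have "(\<Sum>k<K. of_nat (0 choose k) * of_nat (n - 0 choose k) * of_nat (n + k choose k)) =
        (\<Sum>k<K. if k = 0 then 1 else 0 :: rat)"
    by (rule sum.cong) auto
  also have "\<dots> = 1" using assms(2) by simp
  finally show ?case by simp
next
  case (Suc a)
  obtain b where n: "n = Suc (a + b)" using Suc.prems less_iff_Suc_add[of a n] by auto
  define S T where "S = (\<Sum>k<K. of_nat (a choose k) * of_nat (Suc b choose k) * of_nat (n + k choose k) :: rat)"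
    and "T = (\<Sum>k<K. of_nat (Suc a choose k) * of_nat (b choose k) * of_nat (n + k choose k) :: rat)"
  let ?A = "of_nat (Suc a) :: rat" and ?B = "of_nat (Suc b) :: rat"
  \<comment> \<open>\<open>q\<close> has both upper entries raised, so that the terms of
    \<open>S\<close> and of \<open>T\<close> are linear multiples of the same
    \<open>q k\<close>.\<close>
  define q where "q = (\<lambda>k. of_nat (Suc a choose k) * of_nat (Suc b choose k) * of_nat (Suc (a + b) + k choose k) :: rat)"
  have S: "?A * S = (\<Sum>k<K. (?A - of_nat k) * q k)"
    unfolding S_def sum_distrib_left
  proof (rule sum.cong)
    fix k
    show "?A * (of_nat (a choose k) * of_nat (Suc b choose k) * of_nat (n + k choose k)) = (?A - of_nat k) * q k"
      using of_nat_choose_upper[of a k, where 'a = rat] unfolding q_def n by (metis (no_types, lifting) mult.assoc)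
  qed simp
  have T: "?B * T = (\<Sum>k<K. (?B - of_nat k) * q k)"
    unfolding T_def sum_distrib_left
  proof (rule sum.cong)
    fix k
    show "?B * (of_nat (Suc a choose k) * of_nat (b choose k) * of_nat (n + k choose k)) = (?B - of_nat k) * q k"
      using of_nat_choose_upper[of b k, where 'a = rat] unfolding q_def n by (metis (no_types, lifting) mult.assoc mult.left_commute)
  qed simp
  have "?A ^ 3 * (?B * T) - ?B ^ 3 * (?A * S) = (\<Sum>k<K. (?A ^ 3 * (?B - of_nat k) - ?B ^ 3 * (?A - of_nat k)) * q k)"
    unfolding S T sum_distrib_left sum_subtractf[symmetric]
    by (rule sum.cong) (simp_all only: left_diff_distrib mult.assoc)
  also have "\<dots> = 0"
    unfolding q_def by (rule choose_square_telescope) (use n assms in simp)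
  finally have "(?A * ?B) * (?A ^ 2 * T) = (?A * ?B) * (?B ^ 2 * S)"
    by (simp add: power2_eq_square power3_eq_cube algebra_simps)
  then have AT: "?A ^ 2 * T = ?B ^ 2 * S"
    by (metis mult_left_cancel mult_eq_0_iff of_nat_neq_0)
  have "S = of_nat (n choose a) ^ 2"
    using Suc n unfolding S_def by simp
  moreover have "?A * of_nat (n choose Suc a) = ?B * of_nat (n choose a)"
    using of_nat_Suc_choose_Suc[of a n, where 'a = rat] by (simp add: n)
  ultimately have "?A ^ 2 * T = ?A ^ 2 * of_nat (n choose Suc a) ^ 2"
    using AT by (metis power_mult_distrib)
  then have "T = of_nat (n choose Suc a) ^ 2"
    by (metis mult_left_cancel of_nat_neq_0 power_not_zero)
  then show ?case unfolding T_def by (simp add: n)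
qed

lemma sum_atMost_eq_lessThan:
  fixes f :: "nat \<Rightarrow> 'a::comm_monoid_add"
  assumes "\<And>k. k > n \<Longrightarrow> f k = 0" "n < K"
  shows "(\<Sum>k\<le>n. f k) = (\<Sum>k<K. f k)"
  by (rule sum.mono_neutral_left) (use assms in auto)

text \<open>The terms of index n and n + 2 are both written over \<open>q\<close>, which mixes the
  two indices; the multipliers are then polynomials, and no denominator can vanish at the ends of
  the summation range.\<close>

lemma legendre_ratio:
  fixes n k :: nat
  defines "q \<equiv> of_nat (n + 2 choose k) * of_nat (n + k choose k) :: rat" and "x \<equiv> of_nat n :: rat" and "y \<equiv> of_nat k :: rat"
  shows "(x + 1) * (x + 2) * (of_nat (n choose k) * of_nat (n + k choose k)) = (x + 2 - y) * (x + 1 - y) * q"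
    and "(x + 1) * (x + 2) * (of_nat (n + 2 choose k) * of_nat (n + 2 + k choose k)) = (x + 1 + y) * (x + 2 + y) * q"
    and "(y + 1) ^ 2 * (of_nat (n + 2 choose Suc k) * of_nat (n + Suc k choose Suc k)) = (x + 2 - y) * (x + 1 + y) * q"
proof -
  have 1: "(x + 1 - y) * of_nat (Suc n choose k) = (x + 1) * of_nat (n choose k)"
    using of_nat_choose_upper[of n k, where 'a = rat] by (simp add: x_def y_def add.commute)
  have 2: "(x + 2 - y) * of_nat (n + 2 choose k) = (x + 2) * of_nat (Suc n choose k)"
    using of_nat_choose_upper[of "Suc n" k, where 'a = rat] by (simp add: x_def y_def add.commute)
  have "(x + 1) * (x + 2) * of_nat (n choose k) = (x + 2 - y) * (x + 1 - y) * of_nat (n + 2 choose k)"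
    using 1 2 by Groebner_Basis.algebra
  then show "(x + 1) * (x + 2) * (of_nat (n choose k) * of_nat (n + k choose k)) = (x + 2 - y) * (x + 1 - y) * q"
    unfolding q_def by Groebner_Basis.algebra
  have 3: "(x + 1) * of_nat (Suc n + k choose k) = (x + y + 1) * of_nat (n + k choose k)"
    using of_nat_choose_add_left[of n k, where 'a = rat] by (simp add: x_def y_def add.commute)
  have 4: "(x + 2) * of_nat (n + 2 + k choose k) = (x + y + 2) * of_nat (Suc n + k choose k)"
    using of_nat_choose_add_left[of "Suc n" k, where 'a = rat] by (simp add: x_def y_def add.commute add.left_commute)
  have "(x + 1) * (x + 2) * of_nat (n + 2 + k choose k) = (x + 1 + y) * (x + 2 + y) * of_nat (n + k choose k)"
    using 3 4 by Groebner_Basis.algebra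
  then show "(x + 1) * (x + 2) * (of_nat (n + 2 choose k) * of_nat (n + 2 + k choose k)) = (x + 1 + y) * (x + 2 + y) * q"
    unfolding q_def by Groebner_Basis.algebra
  have 5: "(y + 1) * of_nat (n + 2 choose Suc k) = (x + 2 - y) * of_nat (n + 2 choose k)"
    using of_nat_Suc_choose_Suc[of k "n + 2", where 'a = rat] by (simp add: x_def y_def add.commute)
  have 6: "(y + 1) * of_nat (n + Suc k choose Suc k) = (x + y + 1) * of_nat (n + k choose k)"
    using of_nat_choose_add_Suc[of k n, where 'a = rat] by (simp add: x_def y_def add.commute)
  show "(y + 1) ^ 2 * (of_nat (n + 2 choose Suc k) * of_nat (n + Suc k choose Suc k)) = (x + 2 - y) * (x + 1 + y) * q"
    unfolding q_def using 5 6 by Groebner_Basis.algebra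
qed

text \<open>Bonnet's recurrence (n + 2) P_(n+2)(x) = (2 n + 3) x P_(n+1)(x) - (n + 1) P_n(x) at x =
  0, where the middle term drops out and leaves steps of two.\<close>

lemma legendre_at_0_rec:
  "(of_nat n + 2) * legendre_at_0 (n + 2) = - (of_nat n + 1) * legendre_at_0 n"
proof -
  let ?x = "of_nat n :: rat"
  define q where "q = (\<lambda>k. of_nat (n + 2 choose k) * of_nat (n + k choose k) :: rat)"
  define t where "t = (\<lambda>n k. of_nat (n choose k) * of_nat (n + k choose k) * (-1/2) ^ k :: rat)"
  define w where "w = (\<lambda>k. (-1/2) ^ k :: rat)"
  define G where "G = (\<lambda>k. - 2 * (2 * ?x + 3) * of_nat k ^ 2 * (w k * q k))"
  have t: "legendre_at_0 m = (\<Sum>k<n+3. t m k)" if "m \<le> n + 2" for m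
    unfolding legendre_at_0_def t_def by (rule sum_atMost_eq_lessThan) (use that in auto)
  have step: "(?x + 1) * (?x + 2) * ((?x + 2) * t (n + 2) k + (?x + 1) * t n k) = G (Suc k) - G k" for k
  proof -
    let ?y = "of_nat k :: rat"
    have r: "(?x + 1) * (?x + 2) * (of_nat (n choose k) * of_nat (n + k choose k)) = (?x + 2 - ?y) * (?x + 1 - ?y) * q k"
      "(?x + 1) * (?x + 2) * (of_nat (n + 2 choose k) * of_nat (n + 2 + k choose k)) = (?x + 1 + ?y) * (?x + 2 + ?y) * q k"
      "(?y + 1) ^ 2 * q (Suc k) = (?x + 2 - ?y) * (?x + 1 + ?y) * q k"
      unfolding q_def by (rule legendre_ratio)+
    have w: "w (Suc k) = - (1/2) * w k" by (simp add: w_def)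
    have "G (Suc k) = (2 * ?x + 3) * w k * ((?y + 1) ^ 2 * q (Suc k))"
      unfolding G_def w of_nat_Suc by (simp add: algebra_simps)
    also have "\<dots> = (2 * ?x + 3) * w k * ((?x + 2 - ?y) * (?x + 1 + ?y) * q k)"
      by (simp only: r(3))
    finally have 1: "G (Suc k) = (2 * ?x + 3) * w k * ((?x + 2 - ?y) * (?x + 1 + ?y) * q k)" .
    have "(?x + 1) * (?x + 2) * ((?x + 2) * t (n + 2) k + (?x + 1) * t n k) =
       w k * ((?x + 2) * ((?x + 1) * (?x + 2) * (of_nat (n + 2 choose k) * of_nat (n + 2 + k choose k)))
         + (?x + 1) * ((?x + 1) * (?x + 2) * (of_nat (n choose k) * of_nat (n + k choose k))))"
      unfolding t_def w_def[symmetric] by Groebner_Basis.algebra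
    also have "\<dots> = w k * ((?x + 2) * ((?x + 1 + ?y) * (?x + 2 + ?y) * q k)
         + (?x + 1) * ((?x + 2 - ?y) * (?x + 1 - ?y) * q k))"
      by (simp only: r(1,2))
    also have "\<dots> = G (Suc k) - G k"
      unfolding 1 unfolding G_def by Groebner_Basis.algebra
    finally show ?thesis .
  qed
  have "(\<Sum>k<n+3. (?x + 1) * (?x + 2) * ((?x + 2) * t (n + 2) k + (?x + 1) * t n k)) = 0"
    by (subst sum_telescope_from_zero[of _ G, OF step]) (simp add: G_def q_def)
  then have "(?x + 1) * (?x + 2) * ((?x + 2) * legendre_at_0 (n + 2) + (?x + 1) * legendre_at_0 n) = 0"
    by (simp only: t le_refl le_add1 sum_distrib_left sum.distrib distrib_left)
  moreover have "(?x + 1) * (?x + 2) \<noteq> 0"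
    by (metis add.commute mult_eq_0_iff of_nat_Suc of_nat_neq_0 of_nat_add of_nat_numeral add_2_eq_Suc)
  ultimately have "(?x + 2) * legendre_at_0 (n + 2) + (?x + 1) * legendre_at_0 n = 0" by simp
  then show ?thesis by Groebner_Basis.algebra
qed

text \<open>P_n(cos theta) is a polynomial in sin(theta/2)^2, whose k-th power has mean (2k choose
  k) / 4^k; this explains the terms of \<open>legendre_mean\<close>. The coefficients here are the
  squares of those in \<open>legendre_at_0_rec\<close>.\<close>

lemma legendre_mean_rec:
  "(of_nat n + 2) ^ 2 * legendre_mean (n + 2) = (of_nat n + 1) ^ 2 * legendre_mean n"
proof -
  let ?x = "of_nat n :: rat"
  define q where "q = (\<lambda>k. of_nat (n + 2 choose k) * of_nat (n + k choose k) :: rat)"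
  define w where "w = (\<lambda>k. of_nat (2 * k choose k) * (-1/4) ^ k :: rat)"
  define t where "t = (\<lambda>n k. of_nat (n choose k) * of_nat (n + k choose k) * of_nat (2 * k choose k) * (-1/4) ^ k :: rat)"
  define G where "G = (\<lambda>k. - 2 * (2 * ?x + 3) * of_nat k ^ 3 * (w k * q k))"
  have t: "legendre_mean m = (\<Sum>k<n+3. t m k)" if "m \<le> n + 2" for m
    unfolding legendre_mean_def t_def by (rule sum_atMost_eq_lessThan) (use that in auto)
  have step: "(?x + 1) * (?x + 2) * ((?x + 2) ^ 2 * t (n + 2) k - (?x + 1) ^ 2 * t n k) = G (Suc k) - G k" for k
  proof -
    let ?y = "of_nat k :: rat"
    have r: "(?x + 1) * (?x + 2) * (of_nat (n choose k) * of_nat (n + k choose k)) = (?x + 2 - ?y) * (?x + 1 - ?y) * q k"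
      "(?x + 1) * (?x + 2) * (of_nat (n + 2 choose k) * of_nat (n + 2 + k choose k)) = (?x + 1 + ?y) * (?x + 2 + ?y) * q k"
      "(?y + 1) ^ 2 * q (Suc k) = (?x + 2 - ?y) * (?x + 1 + ?y) * q k"
      unfolding q_def by (rule legendre_ratio)+
    have "(?y + 1) * of_nat (2 * Suc k choose Suc k) = 2 * (2 * ?y + 1) * of_nat (2 * k choose k)"
      using of_nat_central_binomial_Suc[of k, where 'a = rat] by (simp add: add.commute)
    moreover have "w (Suc k) = - (1/4) * ((-1/4) ^ k * of_nat (2 * Suc k choose Suc k))"
      by (simp add: w_def)
    ultimately have "(?y + 1) * w (Suc k) = - (1/4) * (-1/4) ^ k * (2 * (2 * ?y + 1) * of_nat (2 * k choose k))"
      by (metis (no_types, opaque_lifting) mult.left_commute mult.assoc)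
    then have w: "(?y + 1) * w (Suc k) = - (1/2) * (2 * ?y + 1) * w k"
      by (simp add: w_def)
    have "G (Suc k) = - 2 * (2 * ?x + 3) * ((?y + 1) * w (Suc k)) * ((?y + 1) ^ 2 * q (Suc k))"
      by (simp add: G_def add.commute power2_eq_square power3_eq_cube)
    also have "\<dots> = (2 * ?x + 3) * ((2 * ?y + 1) * w k) * ((?x + 2 - ?y) * (?x + 1 + ?y) * q k)"
      unfolding w r(3) by Groebner_Basis.algebra
    finally have 1: "G (Suc k) = (2 * ?x + 3) * ((2 * ?y + 1) * w k) * ((?x + 2 - ?y) * (?x + 1 + ?y) * q k)" .
    have "(?x + 1) * (?x + 2) * ((?x + 2) ^ 2 * t (n + 2) k - (?x + 1) ^ 2 * t n k) =
       w k * ((?x + 2) ^ 2 * ((?x + 1) * (?x + 2) * (of_nat (n + 2 choose k) * of_nat (n + 2 + k choose k)))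
         - (?x + 1) ^ 2 * ((?x + 1) * (?x + 2) * (of_nat (n choose k) * of_nat (n + k choose k))))"
      unfolding t_def w_def mult.assoc by (simp add: algebra_simps)
    also have "\<dots> = w k * ((?x + 2) ^ 2 * ((?x + 1 + ?y) * (?x + 2 + ?y) * q k)
         - (?x + 1) ^ 2 * ((?x + 2 - ?y) * (?x + 1 - ?y) * q k))"
      by (simp only: r(1,2))
    also have "\<dots> = G (Suc k) - G k"
      unfolding 1 unfolding G_def by Groebner_Basis.algebra
    finally show ?thesis .
  qed
  have "(\<Sum>k<n+3. (?x + 1) * (?x + 2) * ((?x + 2) ^ 2 * t (n + 2) k - (?x + 1) ^ 2 * t n k)) = 0"
    by (subst sum_telescope_from_zero[of _ G, OF step]) (simp add: G_def q_def)
  then have "(?x + 1) * (?x + 2) * ((?x + 2) ^ 2 * legendre_mean (n + 2) - (?x + 1) ^ 2 * legendre_mean n) = 0"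
    by (simp add: t sum_distrib_left sum_subtractf right_diff_distrib)
  moreover have "(?x + 1) * (?x + 2) \<noteq> 0"
    by (metis add.commute mult_eq_0_iff of_nat_Suc of_nat_neq_0 of_nat_add of_nat_numeral add_2_eq_Suc)
  ultimately show ?thesis by simp
qed

text \<open>Squaring \<open>legendre_at_0_rec\<close> removes its sign and gives
  \<open>legendre_mean_rec\<close>, so the mean and the square agree once they agree at 0 and 1.
  Both vanish at 1, which also starts the odd case.\<close>

lemma legendre_mean_eq_square: "legendre_mean n = legendre_at_0 n ^ 2"
  and legendre_at_0_odd: "odd n \<Longrightarrow> legendre_at_0 n = 0"
proof (induction n rule: nat_induct2)
  case 0
  { case 1 show ?case by (simp add: legendre_mean_def legendre_at_0_def) }
  { case 2 then show ?case by simp }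
next
  case 1
  { case 1 show ?case by (simp add: legendre_mean_def legendre_at_0_def numeral_2_eq_2) }
  { case 2 then show ?case by (simp add: legendre_at_0_def numeral_2_eq_2) }
next
  case (step n)
  let ?x = "of_nat n :: rat"
  have x: "?x + 2 \<noteq> 0"
    by (metis of_nat_neq_0 of_nat_add of_nat_numeral add_2_eq_Suc')
  { case 1
    have "(?x + 2) ^ 2 * legendre_mean (n + 2) = (?x + 1) ^ 2 * legendre_at_0 n ^ 2"
      by (simp only: legendre_mean_rec step)
    also have "\<dots> = (- (?x + 1) * legendre_at_0 n) ^ 2"
      by (simp only: power_mult_distrib power2_minus)
    also have "\<dots> = (?x + 2) ^ 2 * legendre_at_0 (n + 2) ^ 2"
      by (simp only: legendre_at_0_rec[symmetric] power_mult_distrib)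
    finally show ?case using x by simp }
  { case 2
    then have "legendre_at_0 n = 0" using step by simp
    then show ?case using x legendre_at_0_rec[of n] by simp }
qed

text \<open>The second Saalschuetz-type summation. Its first binomial coefficient stands for n
  choose (m + j) modulo p; in that guise the sum occurs in
  \<open>sum_cong_choose_cubed\<close>.\<close>

lemma sum_binomial_products_eq_cube:
  "(\<Sum>j\<le>m. of_nat (2 * (m + j) choose (m + j)) * of_nat (m + j choose j) * of_nat (2 * j choose j) * of_nat (m choose (2 * j)) / 16 ^ j)
     = (of_nat (2 * m choose m) ^ 3 / 4 ^ m :: rat)"
proof (induction m)
  case 0
  show ?case by simp
next
  case (Suc m)
  let ?x = "of_nat m :: rat"
  define A B C D where "A = (\<lambda>m j. of_nat (2 * (m + j) choose (m + j)) :: rat)"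
    and "B = (\<lambda>m j. of_nat (m + j choose j) :: rat)" and "C = (\<lambda>j. of_nat (2 * j choose j) :: rat)"
    and "D = (\<lambda>m i. of_nat (m choose i) :: rat)"
  define t where "t = (\<lambda>m j. A m j * B m j * C j * D m (2 * j) / 16 ^ j)"
  define q where "q = (\<lambda>j. A m j * B m j * C j * D (Suc m) (2 * j) / 16 ^ j)"
  define G where "G = (\<lambda>j. - 16 * (3 * ?x + 2) * of_nat j ^ 3 * q j)"
  have c: "(x + 1) * of_nat (2 * Suc k choose Suc k) = 2 * (2 * x + 1) * of_nat (2 * k choose k)"
    if "x = of_nat k" for k and x :: rat
    using of_nat_central_binomial_Suc[of k, where 'a = rat] that by (simp add: add.commute)
  have t0: "(?x + 1) * t m j = (?x + 1 - 2 * of_nat j) * q j" for j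
  proof -
    have "(?x + 1 - 2 * of_nat j) * D (Suc m) (2 * j) = (?x + 1) * D m (2 * j)"
      using of_nat_choose_upper[of m "2 * j", where 'a = rat] by (simp add: D_def add.commute)
    then have "(?x + 1) * (A m j * B m j * C j * D m (2 * j)) = (?x + 1 - 2 * of_nat j) * (A m j * B m j * C j * D (Suc m) (2 * j))"
      by Groebner_Basis.algebra
    then show ?thesis by (simp only: t_def q_def times_divide_eq_right)
  qed
  have t1: "(?x + 1) * t (Suc m) j = 2 * (2 * ?x + 2 * of_nat j + 1) * q j" for j
  proof -
    let ?y = "of_nat j :: rat"
    have 1: "(?x + ?y + 1) * A (Suc m) j = 2 * (2 * (?x + ?y) + 1) * A m j"
      using c[of "?x + ?y" "m + j"] by (simp add: A_def)
    have 2: "(?x + 1) * B (Suc m) j = (?x + ?y + 1) * B m j"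
      using of_nat_choose_add_left[of m j, where 'a = rat] by (simp add: B_def add.commute)
    have "(?x + 1) * (A (Suc m) j * B (Suc m) j * C j * D (Suc m) (2 * j)) = 2 * (2 * ?x + 2 * ?y + 1) * (A m j * B m j * C j * D (Suc m) (2 * j))"
      using 1 2 by Groebner_Basis.algebra
    then show ?thesis by (simp only: t_def q_def times_divide_eq_right)
  qed
  have q: "8 * (of_nat j + 1) ^ 3 * q (Suc j) =
      (2 * ?x + 2 * of_nat j + 1) * (?x + 1 - 2 * of_nat j) * (?x - 2 * of_nat j) * q j" for j
  proof -
    let ?y = "of_nat j :: rat"
    have 1: "(?x + ?y + 1) * A m (Suc j) = 2 * (2 * (?x + ?y) + 1) * A m j"
      using c[of "?x + ?y" "m + j"] by (simp add: A_def)
    have 2: "(?y + 1) * B m (Suc j) = (?x + ?y + 1) * B m j"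
      using of_nat_choose_add_Suc[of j m, where 'a = rat] by (simp add: B_def add.commute)
    have 3: "(?y + 1) * C (Suc j) = 2 * (2 * ?y + 1) * C j"
      using c[of ?y j] by (simp add: C_def)
    have 4: "(2 * ?y + 1) * D (Suc m) (Suc (2 * j)) = (?x + 1 - 2 * ?y) * D (Suc m) (2 * j)"
      using of_nat_Suc_choose_Suc[of "2 * j" "Suc m", where 'a = rat] by (simp add: D_def add.commute)
    have 5: "2 * (?y + 1) * D (Suc m) (2 * Suc j) = (?x - 2 * ?y) * D (Suc m) (Suc (2 * j))"
      using of_nat_Suc_choose_Suc[of "Suc (2 * j)" "Suc m", where 'a = rat]
      by (simp add: D_def algebra_simps del: binomial_Suc_Suc)
    have 6: "(?y + 1) * (A m (Suc j) * B m (Suc j)) = 2 * (2 * (?x + ?y) + 1) * (A m j * B m j)"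
      using 1 2 by Groebner_Basis.algebra
    have 7: "(?y + 1) ^ 2 * (C (Suc j) * D (Suc m) (2 * Suc j)) =
      (?x + 1 - 2 * ?y) * (?x - 2 * ?y) * (C j * D (Suc m) (2 * j))"
      using 3 4 5 by Groebner_Basis.algebra
    have "8 * (?y + 1) ^ 3 * (A m (Suc j) * B m (Suc j) * C (Suc j) * D (Suc m) (2 * Suc j)) =
       16 * ((2 * ?x + 2 * ?y + 1) * (?x + 1 - 2 * ?y) * (?x - 2 * ?y) * (A m j * B m j * C j * D (Suc m) (2 * j)))"
      using 6 7 by Groebner_Basis.algebra
    then show ?thesis
      unfolding q_def power_Suc times_divide_eq_right by (simp add: mult.assoc)
  qed
  \<comment> \<open>2 (2 m + 1)^3 / (m + 1)^3 is the quotient of consecutive right-hand sides; the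
    outer factor m + 1 is the one that clears denominators in \<open>t0\<close> and
    \<open>t1\<close>.\<close>
  have step: "(?x + 1) * ((?x + 1) ^ 3 * t (Suc m) j - 2 * (2 * ?x + 1) ^ 3 * t m j) = G (Suc j) - G j" for j
  proof -
    let ?y = "of_nat j :: rat"
    have "G (Suc j) = - 2 * (3 * ?x + 2) * (8 * (?y + 1) ^ 3 * q (Suc j))"
      by (simp add: G_def add.commute)
    also have "\<dots> = - 2 * (3 * ?x + 2) * ((2 * ?x + 2 * ?y + 1) * (?x + 1 - 2 * ?y) * (?x - 2 * ?y) * q j)"
      by (simp only: q)
    finally have 1: "G (Suc j) = \<dots>" .
    have "(?x + 1) * ((?x + 1) ^ 3 * t (Suc m) j - 2 * (2 * ?x + 1) ^ 3 * t m j) =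
        (?x + 1) ^ 3 * ((?x + 1) * t (Suc m) j) - 2 * (2 * ?x + 1) ^ 3 * ((?x + 1) * t m j)"
      by Groebner_Basis.algebra
    also have "\<dots> = G (Suc j) - G j"
      unfolding t0 t1 1 unfolding G_def by Groebner_Basis.algebra
    finally show ?thesis .
  qed
  have "(\<Sum>j<m+2. (?x + 1) * ((?x + 1) ^ 3 * t (Suc m) j - 2 * (2 * ?x + 1) ^ 3 * t m j)) = 0"
    by (subst sum_telescope_from_zero[of _ G, OF step]) (simp add: G_def q_def D_def binomial_eq_0 del: binomial_Suc_Suc)
  then have "(?x + 1) * ((?x + 1) ^ 3 * (\<Sum>j<m+2. t (Suc m) j) - 2 * (2 * ?x + 1) ^ 3 * (\<Sum>j<m+2. t m j)) = 0"
    by (simp only: sum_distrib_left sum_subtractf right_diff_distrib)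
  moreover have x: "?x + 1 \<noteq> 0"
    by (metis add.commute of_nat_Suc of_nat_neq_0)
  ultimately have "(?x + 1) ^ 3 * (\<Sum>j<m+2. t (Suc m) j) = 2 * (2 * ?x + 1) ^ 3 * (\<Sum>j<m+2. t m j)"
    by simp
  moreover have "(\<Sum>j\<le>Suc m. t (Suc m) j) = (\<Sum>j<m+2. t (Suc m) j)"
    by (rule sum_atMost_eq_lessThan) (auto simp: t_def D_def)
  moreover have "(\<Sum>j\<le>m. t m j) = (\<Sum>j<m+2. t m j)"
    by (rule sum_atMost_eq_lessThan) (auto simp: t_def D_def)
  ultimately have "(?x + 1) ^ 3 * (\<Sum>j\<le>Suc m. t (Suc m) j) = 2 * (2 * ?x + 1) ^ 3 * (of_nat (2 * m choose m) ^ 3 / 4 ^ m)"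
    using Suc.IH by (simp add: t_def A_def B_def C_def D_def)
  also have "\<dots> = (2 * (2 * ?x + 1) * of_nat (2 * m choose m)) ^ 3 / (4 * 4 ^ m)"
    by (simp only: power_mult_distrib) simp
  also have "\<dots> = ((?x + 1) * of_nat (2 * Suc m choose Suc m)) ^ 3 / 4 ^ Suc m"
    by (simp only: c[OF refl] power_Suc)
  also have "\<dots> = (?x + 1) ^ 3 * (of_nat (2 * Suc m choose Suc m) ^ 3 / 4 ^ Suc m)"
    by (simp only: power_mult_distrib times_divide_eq_right)
  finally have "(\<Sum>j\<le>Suc m. t (Suc m) j) = of_nat (2 * Suc m choose Suc m) ^ 3 / 4 ^ Suc m"
    using x mult_left_cancel power_not_zero by blast
  then show ?case unfolding t_def A_def B_def C_def D_def .
qed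

section \<open>Rearranging double sums by the binomial theorem\<close>

lemma choose_shift_mult: "(m + j choose j) * (m choose r) = (m + j choose (r + j)) * (r + j choose j)"
proof (cases "r \<le> m")
  case True
  then show ?thesis using choose_mult[of j "r + j" "m + j"] by (simp add: mult.commute)
qed (simp add: binomial_eq_0)

lemma sum_choose_mult_choose:
  "(\<Sum>k\<le>n. of_nat (n choose k) * of_nat (k choose r) * x ^ (k - r)) = of_nat (n choose r) * (1 + x :: 'a::comm_ring_1) ^ (n - r)"
proof (cases "r \<le> n")
  case True
  have "(\<Sum>k\<le>n. of_nat (n choose k) * of_nat (k choose r) * x ^ (k - r)) =
        (\<Sum>k\<in>{r..n}. of_nat (n choose k) * of_nat (k choose r) * x ^ (k - r))"
    by (rule sum.mono_neutral_right) (auto simp: binomial_eq_0)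
  also have "\<dots> = (\<Sum>i\<le>n - r. of_nat (n choose r) * (of_nat (n - r choose i) * x ^ i))"
  proof (rule sum.reindex_bij_witness[of _ "\<lambda>i. i + r" "\<lambda>k. k - r"])
    fix k assume "k \<in> {r..n}"
    then have "(n choose k) * (k choose r) = (n choose r) * (n - r choose (k - r))"
      by (intro choose_mult) auto
    then show "of_nat (n choose r) * (of_nat (n - r choose (k - r)) * x ^ (k - r))
       = of_nat (n choose k) * of_nat (k choose r) * x ^ (k - r)"
      by (metis mult.assoc of_nat_mult)
  qed (use True in auto)
  also have "\<dots> = of_nat (n choose r) * (1 + x) ^ (n - r)"
    unfolding add.commute[of 1 x] binomial_ring[of x 1] sum_distrib_left by simp
  finally show ?thesis .
qed (simp add: binomial_eq_0)

text \<open>Applied with r = 2 j, x = 1/4 to the sum over \<open>W\<close>, and with r = j, x = 1 to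
  the sum of cubes.\<close>

lemma sum_choose_shift:
  "(\<Sum>m\<le>n. of_nat (n choose (m + j)) * of_nat (m + j choose j) * of_nat (m choose r) * x ^ (m - r))
     = of_nat (n choose (r + j)) * of_nat (r + j choose j) * (1 + x :: 'a::comm_ring_1) ^ (n - (r + j))"
proof -
  let ?f = "\<lambda>k. of_nat (n choose k) * of_nat (k choose (r + j)) * x ^ (k - (r + j))"
  have "(\<Sum>m\<le>n. of_nat (n choose (m + j)) * of_nat (m + j choose j) * of_nat (m choose r) * x ^ (m - r))
      = (\<Sum>m\<le>n. of_nat (r + j choose j) * ?f (m + j))"
  proof (rule sum.cong)
    fix m
    have "(of_nat (m + j choose j) * of_nat (m choose r) :: 'a) = of_nat (m + j choose (r + j)) * of_nat (r + j choose j)"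
      unfolding of_nat_mult[symmetric] choose_shift_mult ..
    then show "of_nat (n choose (m + j)) * of_nat (m + j choose j) * of_nat (m choose r) * x ^ (m - r)
      = of_nat (r + j choose j) * ?f (m + j)"
      by (simp add: mult.assoc mult.left_commute)
  qed simp
  also have "\<dots> = of_nat (r + j choose j) * (\<Sum>m\<le>n. ?f (m + j))"
    by (simp add: sum_distrib_left)
  also have "(\<Sum>m\<le>n. ?f (m + j)) = (\<Sum>k\<in>{j..n + j}. ?f k)"
    by (rule sum.reindex_bij_witness[of _ "\<lambda>k. k - j" "\<lambda>m. m + j"]) auto
  also have "\<dots> = (\<Sum>k\<le>n + j. ?f k)"
    by (rule sum.mono_neutral_left) (auto simp: binomial_eq_0)
  also have "\<dots> = (\<Sum>k\<le>n. ?f k)"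
    by (rule sum.mono_neutral_right) (auto simp: binomial_eq_0)
  finally show ?thesis unfolding sum_choose_mult_choose by (simp add: ac_simps)
qed

text \<open>Interchanging the sums leaves for each j a binomial sum in k with ratio (-1/2) (-3) =
  3/2; the powers of 5 come from 1 + 3/2 = 5/2.\<close>

lemma sum_choose_W:
  "(\<Sum>k\<le>n. of_nat (n choose k) * (- 1 / 2) ^ k * of_int (W k)) =
   (1 / 2) ^ n * (\<Sum>j\<le>n. (- 1) ^ j * of_nat (2 * j choose j) * of_nat (3 * j choose j) * of_nat (n choose (3 * j)) * (5 :: rat) ^ (n - 3 * j))"
proof -
  let ?a = "\<lambda>j. of_nat (2 * j choose j) * of_nat (3 * j choose j) :: rat"
  have W: "of_int (W k) = (\<Sum>j\<le>n. ?a j * of_nat (k choose (3 * j)) * (- 3) ^ (k - 3 * j))" if "k \<le> n" for k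
  proof -
    have "of_int (W k) = (\<Sum>j=0..k div 3. ?a j * of_nat (k choose (3 * j)) * (- 3) ^ (k - 3 * j))"
      by (simp add: W_def)
    also have "\<dots> = (\<Sum>j\<le>n. ?a j * of_nat (k choose (3 * j)) * (- 3) ^ (k - 3 * j))"
      using that by (intro sum.mono_neutral_left) auto
    finally show ?thesis .
  qed
  have "(\<Sum>k\<le>n. of_nat (n choose k) * (- 1 / 2) ^ k * of_int (W k)) =
    (\<Sum>k\<le>n. \<Sum>j\<le>n. ?a j * (of_nat (n choose k) * (- 1 / 2) ^ k * of_nat (k choose (3 * j)) * (- 3) ^ (k - 3 * j)))"
    by (rule sum.cong) (simp_all add: W sum_distrib_left ac_simps)
  also have "\<dots> = (\<Sum>j\<le>n. ?a j * (\<Sum>k\<le>n. of_nat (n choose k) * (- 1 / 2) ^ k * of_nat (k choose (3 * j)) * (- 3) ^ (k - 3 * j)))"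
    by (subst sum.swap) (simp add: sum_distrib_left)
  also have "\<dots> = (\<Sum>j\<le>n. ?a j * ((1 / 2) ^ n * (- 1) ^ j * of_nat (n choose (3 * j)) * 5 ^ (n - 3 * j)))"
  proof (rule sum.cong)
    fix j
    have "(\<Sum>k\<le>n. of_nat (n choose k) * (- 1 / 2) ^ k * of_nat (k choose (3 * j)) * (- 3) ^ (k - 3 * j)) =
      (\<Sum>k\<le>n. (- 1 / 2) ^ (3 * j) * (of_nat (n choose k) * of_nat (k choose (3 * j)) * (3 / 2 :: rat) ^ (k - 3 * j)))"
    proof (rule sum.cong)
      fix k
      show "of_nat (n choose k) * (- 1 / 2) ^ k * of_nat (k choose (3 * j)) * (- 3) ^ (k - 3 * j) =
        (- 1 / 2) ^ (3 * j) * (of_nat (n choose k) * of_nat (k choose (3 * j)) * (3 / 2 :: rat) ^ (k - 3 * j))"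
      proof (cases "3 * j \<le> k")
        case True
        have "(- 1 / 2 :: rat) ^ k = (- 1 / 2) ^ (3 * j) * (- 1 / 2) ^ (k - 3 * j)"
          using True by (simp add: power_add[symmetric])
        moreover have "(3 / 2 :: rat) ^ (k - 3 * j) = (- 1 / 2) ^ (k - 3 * j) * (- 3) ^ (k - 3 * j)"
          by (simp add: power_mult_distrib[symmetric])
        ultimately show ?thesis by simp
      qed (simp add: binomial_eq_0)
    qed simp
    also have "\<dots> = (- 1 / 2) ^ (3 * j) * of_nat (n choose (3 * j)) * (5 / 2) ^ (n - 3 * j)"
      unfolding sum_distrib_left[symmetric] sum_choose_mult_choose by simp
    also have "\<dots> = (1 / 2) ^ n * (- 1) ^ j * of_nat (n choose (3 * j)) * 5 ^ (n - 3 * j)"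
    proof (cases "3 * j \<le> n")
      case True
      have "(- 1 / 2 :: rat) ^ (3 * j) = (- 1) ^ j * (1 / 2) ^ (3 * j)"
        by (simp add: power_mult power3_eq_cube flip: power_mult_distrib)
      moreover have "(5 / 2 :: rat) ^ (n - 3 * j) = 5 ^ (n - 3 * j) * (1 / 2) ^ (n - 3 * j)"
        by (simp flip: power_mult_distrib)
      moreover have "(1 / 2 :: rat) ^ n = (1 / 2) ^ (3 * j) * (1 / 2) ^ (n - 3 * j)"
        using True by (simp flip: power_add)
      ultimately show ?thesis by simp
    qed (simp add: binomial_eq_0)
    finally show "?a j * (\<Sum>k\<le>n. of_nat (n choose k) * (- 1 / 2) ^ k * of_nat (k choose (3 * j)) * (- 3) ^ (k - 3 * j)) =
       ?a j * ((1 / 2) ^ n * (- 1) ^ j * of_nat (n choose (3 * j)) * 5 ^ (n - 3 * j))" by simp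
  qed simp
  finally show ?thesis by (simp add: sum_distrib_left ac_simps)
qed

text \<open>The proof runs from right to left: summing over m with weight (1/4)^(m - 2 j) restores
  (5/4)^(n - 3 j). The index m is introduced because for fixed m the sum over j is, modulo p, the
  one of \<open>sum_binomial_products_eq_cube\<close>.\<close>

lemma sum_choose_W_expanded:
  "(\<Sum>j\<le>n. (- 1) ^ j * of_nat (2 * j choose j) * of_nat (3 * j choose j) * of_nat (n choose (3 * j)) * (5 :: rat) ^ (n - 3 * j))
   = (\<Sum>m\<le>n. \<Sum>j\<le>m div 2. (- 1) ^ j * of_nat (n choose (m + j)) * of_nat (m + j choose j) * of_nat (2 * j choose j) *
        of_nat (m choose (2 * j)) * (4 ^ n / 4 ^ (m + j)))"
proof -
  have "(\<Sum>m\<le>n. \<Sum>j\<le>m div 2. (- 1) ^ j * of_nat (n choose (m + j)) * of_nat (m + j choose j) * of_nat (2 * j choose j) *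
        of_nat (m choose (2 * j)) * (4 ^ n / 4 ^ (m + j))) =
     (\<Sum>m\<le>n. \<Sum>j\<le>n. (- 1) ^ j * of_nat (n choose (m + j)) * of_nat (m + j choose j) * of_nat (2 * j choose j) *
        of_nat (m choose (2 * j)) * (4 ^ n / 4 ^ (m + j) :: rat))"
    by (intro sum.cong sum.mono_neutral_left) (auto simp: binomial_eq_0)
  also have "\<dots> = (\<Sum>j\<le>n. \<Sum>m\<le>n. (- 1) ^ j * of_nat (n choose (m + j)) * of_nat (m + j choose j) * of_nat (2 * j choose j) *
        of_nat (m choose (2 * j)) * (4 ^ n / 4 ^ (m + j) :: rat))"
    by (rule sum.swap)
  also have "\<dots> = (\<Sum>j\<le>n. (- 1) ^ j * of_nat (2 * j choose j) * of_nat (3 * j choose j) * of_nat (n choose (3 * j)) * (5 :: rat) ^ (n - 3 * j))"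
  proof (rule sum.cong)
    fix j
    have "(\<Sum>m\<le>n. (- 1) ^ j * of_nat (n choose (m + j)) * of_nat (m + j choose j) * of_nat (2 * j choose j) *
        of_nat (m choose (2 * j)) * (4 ^ n / 4 ^ (m + j) :: rat)) =
      (\<Sum>m\<le>n. (- 1) ^ j * of_nat (2 * j choose j) * (4 ^ n / 4 ^ (3 * j)) * (of_nat (n choose (m + j)) * of_nat (m + j choose j) *
        of_nat (m choose (2 * j)) * (1 / 4) ^ (m - 2 * j)))"
    proof (rule sum.cong)
      fix m
      show "(- 1) ^ j * of_nat (n choose (m + j)) * of_nat (m + j choose j) * of_nat (2 * j choose j) *
        of_nat (m choose (2 * j)) * (4 ^ n / 4 ^ (m + j) :: rat) =
        (- 1) ^ j * of_nat (2 * j choose j) * (4 ^ n / 4 ^ (3 * j)) * (of_nat (n choose (m + j)) * of_nat (m + j choose j) *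
        of_nat (m choose (2 * j)) * (1 / 4) ^ (m - 2 * j))"
      proof (cases "2 * j \<le> m")
        case True
        then have "m + j = 3 * j + (m - 2 * j)" by simp
        then have "(4 :: rat) ^ (m + j) = 4 ^ (3 * j) * 4 ^ (m - 2 * j)" by (metis power_add)
        then show ?thesis by (simp add: power_one_over)
      qed (simp add: binomial_eq_0)
    qed simp
    also have "\<dots> = (- 1) ^ j * of_nat (2 * j choose j) * (4 ^ n / 4 ^ (3 * j)) * (of_nat (n choose (3 * j)) * of_nat (3 * j choose j) * (5 / 4) ^ (n - 3 * j))"
      unfolding sum_distrib_left[symmetric] sum_choose_shift by simp
    also have "\<dots> = (- 1) ^ j * of_nat (2 * j choose j) * of_nat (3 * j choose j) * of_nat (n choose (3 * j)) * (5 :: rat) ^ (n - 3 * j)"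
    proof (cases "3 * j \<le> n")
      case True
      then have "(4 :: rat) ^ n = 4 ^ (3 * j) * 4 ^ (n - 3 * j)" by (simp flip: power_add)
      then show ?thesis by (simp add: power_divide)
    qed (simp add: binomial_eq_0)
    finally show "(\<Sum>m\<le>n. (- 1) ^ j * of_nat (n choose (m + j)) * of_nat (m + j choose j) * of_nat (2 * j choose j) *
        of_nat (m choose (2 * j)) * (4 ^ n / 4 ^ (m + j) :: rat)) =
      (- 1) ^ j * of_nat (2 * j choose j) * of_nat (3 * j choose j) * of_nat (n choose (3 * j)) * (5 :: rat) ^ (n - 3 * j)" .
  qed simp
  finally show ?thesis ..
qed

text \<open>MacMahon's formula for the Franel numbers. Two of the three factors are expanded by
  \<open>choose_square_expansion\<close>; after that the sum over m is an instance of the binomial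
  theorem.\<close>

lemma sum_choose_cubed:
  "(\<Sum>m\<le>n. of_nat (n choose m) ^ 3) =
   (2 :: rat) ^ n * (\<Sum>k\<le>n div 2. of_nat (n + k choose k) * of_nat (n choose (2 * k)) * of_nat (2 * k choose k) / 4 ^ k)"
proof -
  have "(\<Sum>m\<le>n. of_nat (n choose m) ^ 3 :: rat) =
    (\<Sum>m\<le>n. \<Sum>k<Suc n. of_nat (n + k choose k) * (of_nat (n choose m) * of_nat (n - m choose k) * of_nat (m choose k)))"
  proof (rule sum.cong)
    fix m assume "m \<in> {..n}"
    then have "(of_nat (n choose m) ^ 2 :: rat) = (\<Sum>k<Suc n. of_nat (m choose k) * of_nat (n - m choose k) * of_nat (n + k choose k))"
      by (intro choose_square_expansion[symmetric]) auto
    then have "of_nat (n choose m) * (of_nat (n choose m) ^ 2 :: rat) =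
       of_nat (n choose m) * (\<Sum>k<Suc n. of_nat (m choose k) * of_nat (n - m choose k) * of_nat (n + k choose k))"
      by (simp only:)
    then show "of_nat (n choose m) ^ 3 =
      (\<Sum>k<Suc n. of_nat (n + k choose k) * (of_nat (n choose m) * of_nat (n - m choose k) * of_nat (m choose k)) :: rat)"
      unfolding sum_distrib_left by (simp add: power3_eq_cube power2_eq_square ac_simps)
  qed simp
  also have "\<dots> = (\<Sum>k<Suc n. of_nat (n + k choose k) * (\<Sum>m\<le>n. of_nat (n choose (m + k)) * of_nat (m + k choose k) * of_nat (m choose k) * 1 ^ (m - k)))"
  proof (subst sum.swap, unfold sum_distrib_left, intro sum.cong)
    fix k m assume "m \<in> {..n}"
    have "(n choose m) * (n - m choose k) = (n choose (m + k)) * (m + k choose k)"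
    proof (cases "m + k \<le> n")
      case True
      then have "(n choose (m + k)) * (m + k choose m) = (n choose m) * (n - m choose k)"
        using choose_mult[of m "m + k" n] by simp
      moreover have "(m + k choose m) = (m + k choose k)"
        using binomial_symmetric[of m "m + k"] by simp
      ultimately show ?thesis by simp
    qed (use \<open>m \<in> {..n}\<close> in \<open>auto simp: binomial_eq_0\<close>)
    then have "(of_nat (n choose m) * of_nat (n - m choose k) :: rat) = of_nat (n choose (m + k)) * of_nat (m + k choose k)"
      by (simp flip: of_nat_mult)
    then show "of_nat (n + k choose k) * (of_nat (n choose m) * of_nat (n - m choose k) * of_nat (m choose k)) =
       of_nat (n + k choose k) * (of_nat (n choose (m + k)) * of_nat (m + k choose k) * of_nat (m choose k) * 1 ^ (m - k) :: rat)"
      by simp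
  qed simp_all
  also have "\<dots> = (\<Sum>k<Suc n. of_nat (n + k choose k) * (of_nat (n choose (2 * k)) * of_nat (2 * k choose k) * 2 ^ (n - 2 * k)))"
    unfolding sum_choose_shift by (simp add: mult_2)
  also have "\<dots> = (\<Sum>k\<le>n div 2. of_nat (n + k choose k) * (of_nat (n choose (2 * k)) * of_nat (2 * k choose k) * 2 ^ (n - 2 * k)))"
    by (rule sum.mono_neutral_right) (auto simp: binomial_eq_0)
  also have "\<dots> = (\<Sum>k\<le>n div 2. 2 ^ n * (of_nat (n + k choose k) * of_nat (n choose (2 * k)) * of_nat (2 * k choose k) / 4 ^ k))"
  proof (rule sum.cong)
    fix k assume "k \<in> {..n div 2}"
    then have "(2 :: rat) ^ n = 2 ^ (n - 2 * k) * 2 ^ (2 * k)" by (simp flip: power_add)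
    also have "(2 :: rat) ^ (2 * k) = 4 ^ k" by (simp add: power_mult)
    finally show "of_nat (n + k choose k) * (of_nat (n choose (2 * k)) * of_nat (2 * k choose k) * 2 ^ (n - 2 * k)) =
      (2 :: rat) ^ n * (of_nat (n + k choose k) * of_nat (n choose (2 * k)) * of_nat (2 * k choose k) / 4 ^ k)"
      by simp
  qed simp
  finally show ?thesis by (simp add: sum_distrib_left)
qed

subsection \<open>Congruences between rational numbers\<close>

text \<open>Any fraction with denominator prime to p will do, so that sums and products can be
  formed without reducing to lowest terms.\<close>

lemma p_integral_iff:
  assumes "prime p"
  shows "q \<in> p_integral p \<longleftrightarrow> (\<exists>a b. \<not> int p dvd b \<and> q = of_int a / of_int b)"
proof
  assume "q \<in> p_integral p"
  then have "\<not> int p dvd snd (quotient_of q)" by (simp add: p_integral_def)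
  moreover have "q = of_int (fst (quotient_of q)) / of_int (snd (quotient_of q))"
    by (metis prod.collapse quotient_of_div)
  ultimately show "\<exists>a b. \<not> int p dvd b \<and> q = of_int a / of_int b" by blast
next
  assume "\<exists>a b. \<not> int p dvd b \<and> q = of_int a / of_int b"
  then obtain a b where ab: "\<not> int p dvd b" "q = of_int a / of_int b" by blast
  obtain c d where cd: "quotient_of q = (c, d)" by fastforce
  have d: "d > 0" "coprime c d" "q = of_int c / of_int d"
    using quotient_of_denom_pos[OF cd] quotient_of_coprime[OF cd] quotient_of_div[OF cd] by auto
  have "b \<noteq> 0" using ab(1) by auto
  then have "of_int (c * b) = (of_int (a * d) :: rat)"
    using ab(2) d by (simp add: field_simps)
  then have "c * b = a * d" by (simp only: of_int_eq_iff)
  then have "d dvd c * b" by simp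
  then have "d dvd b" using d(2) by (simp add: coprime_commute coprime_dvd_mult_right_iff)
  then show "q \<in> p_integral p" using ab(1) cd by (auto simp: p_integral_def dest: dvd_trans)
qed

locale prime_modulus =
  fixes p :: nat
  assumes prime_p: "prime p"
begin

abbreviation cong_rat (infix "\<approx>" 50) where "cong_rat \<equiv> rat_cong p"

lemma p_integral_of_int [simp, intro]: "of_int a \<in> p_integral p"
  unfolding p_integral_iff[OF prime_p]
  using prime_gt_1_nat[OF prime_p] by (intro exI[of _ a] exI[of _ 1]) auto

lemma p_integral_of_nat [simp, intro]: "of_nat a \<in> p_integral p"
  using p_integral_of_int[of "int a"] by simp

lemma p_integral_numeral [simp, intro]: "numeral a \<in> p_integral p" "0 \<in> p_integral p" "1 \<in> p_integral p"
  using p_integral_of_nat[of "numeral a"] p_integral_of_nat[of 0] p_integral_of_nat[of 1] by simp_all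

lemma prime_int_p: "prime (int p)"
  using prime_p by simp

lemma p_integral_add [intro]: "a \<in> p_integral p \<Longrightarrow> b \<in> p_integral p \<Longrightarrow> a + b \<in> p_integral p"
  and p_integral_mult [intro]: "a \<in> p_integral p \<Longrightarrow> b \<in> p_integral p \<Longrightarrow> a * b \<in> p_integral p"
proof -
  assume "a \<in> p_integral p" "b \<in> p_integral p"
  then obtain x y z w where *: "\<not> int p dvd y" "a = of_int x / of_int y" "\<not> int p dvd w" "b = of_int z / of_int w"
    unfolding p_integral_iff[OF prime_p] by blast
  have 1: "\<not> int p dvd y * w" using * prime_dvd_mult_iff[OF prime_int_p] by blast
  have "y \<noteq> 0" "w \<noteq> 0" using * by auto
  then have "a + b = of_int (x * w + z * y) / of_int (y * w)" "a * b = of_int (x * z) / of_int (y * w)"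
    using * by (simp_all add: add_frac_eq)
  then show "a + b \<in> p_integral p" "a * b \<in> p_integral p"
    unfolding p_integral_iff[OF prime_p] using 1 by blast+
qed

lemma p_integral_uminus [intro]: "a \<in> p_integral p \<Longrightarrow> - a \<in> p_integral p"
  using p_integral_mult[OF p_integral_of_int[of "-1"]] by fastforce

lemma p_integral_power [intro]: "a \<in> p_integral p \<Longrightarrow> a ^ k \<in> p_integral p"
  by (induction k) auto

lemma p_integral_sum [intro]: "(\<And>x. x \<in> A \<Longrightarrow> f x \<in> p_integral p) \<Longrightarrow> sum f A \<in> p_integral p"
  by (induction A rule: infinite_finite_induct) auto

lemma p_integral_divide [intro]:
  assumes "a \<in> p_integral p" "\<not> p dvd b"
  shows "a / of_nat b \<in> p_integral p"
proof -
  have "1 / of_nat b \<in> p_integral p"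
    unfolding p_integral_iff[OF prime_p] using assms by (intro exI[of _ 1] exI[of _ "int b"]) auto
  then show ?thesis using p_integral_mult[OF assms(1)] by fastforce
qed

lemma cong_rat_refl [intro]: "a \<in> p_integral p \<Longrightarrow> a \<approx> a"
  unfolding rat_cong_def by (auto intro!: bexI[of _ 0])

lemma cong_rat_sym: "a \<approx> b \<Longrightarrow> b \<approx> a"
  unfolding rat_cong_def by (metis minus_diff_eq mult_minus_right p_integral_uminus)

lemma cong_rat_trans [trans]: "a \<approx> b \<Longrightarrow> b \<approx> c \<Longrightarrow> a \<approx> c"
  unfolding rat_cong_def by (metis diff_add_cancel add_diff_eq distrib_left p_integral_add)

lemma cong_rat_add: "a \<approx> b \<Longrightarrow> c \<approx> d \<Longrightarrow> a + c \<approx> b + d"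
  unfolding rat_cong_def by (metis add_diff_add distrib_left p_integral_add)

lemma cong_rat_mult:
  assumes "a \<approx> b" "c \<approx> d"
  shows "a * c \<approx> b * d"
proof -
  obtain u v where "u \<in> p_integral p" "v \<in> p_integral p" "a - b = of_nat p * u" "c - d = of_nat p * v"
    using assms unfolding rat_cong_def by blast
  moreover have "a * c - b * d = (a - b) * c + b * (c - d)" by (simp add: algebra_simps)
  ultimately have "a * c - b * d = of_nat p * (u * c + b * v)" by (simp add: algebra_simps)
  then show ?thesis using assms \<open>u \<in> p_integral p\<close> \<open>v \<in> p_integral p\<close> unfolding rat_cong_def by blast
qed

lemma cong_rat_power: "a \<approx> b \<Longrightarrow> a ^ k \<approx> b ^ k"
  by (induction k) (auto intro: cong_rat_mult)

lemma cong_rat_sum: "(\<And>x. x \<in> A \<Longrightarrow> f x \<approx> g x) \<Longrightarrow> sum f A \<approx> sum g A"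
  by (induction A rule: infinite_finite_induct) (auto intro: cong_rat_add)

lemma cong_rat_prod: "(\<And>x. x \<in> A \<Longrightarrow> f x \<approx> g x) \<Longrightarrow> prod f A \<approx> prod g A"
  by (induction A rule: infinite_finite_induct) (auto intro: cong_rat_mult)

lemma cong_rat_cong: "a \<approx> b \<Longrightarrow> a = a' \<Longrightarrow> b = b' \<Longrightarrow> a' \<approx> b'"
  by simp

lemma cong_rat_integral: "a \<approx> b \<Longrightarrow> a \<in> p_integral p" "a \<approx> b \<Longrightarrow> b \<in> p_integral p"
  by (auto simp: rat_cong_def)

lemma cong_rat_of_int:
  assumes "[a = b] (mod int p)"
  shows "of_int a \<approx> of_int b"
proof -
  obtain c where "a - b = int p * c" using assms by (auto simp: cong_iff_dvd_diff)
  then have "of_int a - of_int b = of_nat p * (of_int c :: rat)"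
    by (metis of_int_diff of_int_mult of_int_of_nat_eq)
  then show ?thesis unfolding rat_cong_def by blast
qed

text \<open>For k < p the factorial k! is a unit modulo p, so \<open>a gchoose k\<close> is a
  polynomial in \<open>a\<close> with p-integral coefficients. This is what allows upper entries to
  be changed modulo p.\<close>

lemma cong_rat_gbinomial:
  assumes "a \<approx> b" "k < p"
  shows "a gchoose k \<approx> b gchoose k"
proof -
  have "\<not> p dvd fact k" using assms(2) prime_p by (simp add: prime_dvd_fact_iff)
  then have "1 / of_nat (fact k) \<approx> 1 / of_nat (fact k)"
    by (intro cong_rat_refl p_integral_divide) auto
  moreover have "(\<Prod>i=0..<k. a - of_nat i) \<approx> (\<Prod>i=0..<k. b - of_nat i)"
    using assms(1) cong_rat_add[OF _ cong_rat_refl[OF p_integral_uminus[OF p_integral_of_nat]]]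
    by (intro cong_rat_prod) auto
  ultimately have "(\<Prod>i=0..<k. a - of_nat i) * (1 / of_nat (fact k)) \<approx> (\<Prod>i=0..<k. b - of_nat i) * (1 / of_nat (fact k))"
    by (intro cong_rat_mult)
  then show ?thesis by (simp add: gbinomial_prod_rev)
qed

end

section \<open>Reduction modulo p: binomial coefficients at -1/2, -1/4 and -3/4\<close>

lemma central_binomial_eq_gbinomial:
  "of_nat (2 * k choose k) = (-4) ^ k * ((- 1 / 2 :: rat) gchoose k)"
proof (induction k)
  case (Suc k)
  have "of_nat (Suc k) * (of_nat (2 * Suc k choose Suc k) :: rat) = of_nat (Suc k) * ((-4) ^ Suc k * ((- 1 / 2) gchoose Suc k))"
  proof -
    have "of_nat (Suc k) * ((- 1 / 2) gchoose Suc k) = (- 1 / 2 - of_nat k) * ((- 1 / 2 :: rat) gchoose k)"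
      using gbinomial_mult_1[of "- 1 / 2 :: rat" k] by (simp add: algebra_simps)
    then have "of_nat (Suc k) * ((-4) ^ Suc k * ((- 1 / 2) gchoose Suc k)) = (-4) ^ Suc k * ((- 1 / 2 - of_nat k) * ((- 1 / 2 :: rat) gchoose k))"
      by (metis mult.left_commute)
    also have "\<dots> = 2 * (2 * of_nat k + 1) * ((-4) ^ k * ((- 1 / 2 :: rat) gchoose k))"
      by (simp add: algebra_simps)
    finally show ?thesis unfolding of_nat_central_binomial_Suc Suc ..
  qed
  then show ?case by (metis mult_left_cancel of_nat_neq_0)
qed simp

text \<open>Symmetric in the two upper entries, so both classes of p modulo 4 lead to the same
  right-hand side.\<close>

lemma gbinomial_quarters:
  "(- 1 / 4 gchoose k) * (- 3 / 4 gchoose k) = (of_nat (4 * k choose (2 * k)) * of_nat (2 * k choose k) / 64 ^ k :: rat)"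
proof (induction k)
  case (Suc k)
  let ?y = "of_nat k :: rat"
  define C where "C = (\<lambda>k. of_nat (2 * k choose k) :: rat)"
  have c: "(x + 1) * C (Suc k) = 2 * (2 * x + 1) * C k"
    if "x = of_nat k" for k and x :: rat
    using of_nat_central_binomial_Suc[of k, where 'a = rat] that by (simp add: add.commute C_def)
  have 1: "(?y + 1) * C (Suc k) = 2 * (2 * ?y + 1) * C k" by (rule c) simp
  have 2: "(2 * ?y + 1) * C (Suc (2 * k)) = 2 * (4 * ?y + 1) * C (2 * k)" using c[of "2 * ?y" "2 * k"] by simp
  have 3: "(2 * ?y + 2) * C (Suc (Suc (2 * k))) = 2 * (4 * ?y + 3) * C (Suc (2 * k))" using c[of "2 * ?y + 1" "Suc (2 * k)"] by (simp add: algebra_simps)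
  have CC: "(?y + 1) ^ 2 * (C (2 * Suc k) * C (Suc k)) = 4 * (4 * ?y + 1) * (4 * ?y + 3) * (C (2 * k) * C k)"
  proof -
    have "(?y + 1) ^ 2 * (C (2 * Suc k) * C (Suc k)) = ((?y + 1) * C (Suc (Suc (2 * k)))) * ((?y + 1) * C (Suc k))"
      by (simp add: power2_eq_square)
    also have "(?y + 1) * C (Suc (Suc (2 * k))) = (4 * ?y + 3) * C (Suc (2 * k))" using 3 by (simp add: algebra_simps)
    also have "(4 * ?y + 3) * C (Suc (2 * k)) * ((?y + 1) * C (Suc k)) = 2 * (4 * ?y + 3) * C k * ((2 * ?y + 1) * C (Suc (2 * k)))"
      unfolding 1 by (simp add: algebra_simps)
    also have "\<dots> = 4 * (4 * ?y + 1) * (4 * ?y + 3) * (C (2 * k) * C k)"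
      unfolding 2 by (simp add: algebra_simps)
    finally show ?thesis .
  qed
  have g1: "(?y + 1) * (- 1 / 4 gchoose Suc k) = (- 1 / 4 - ?y) * (- 1 / 4 gchoose k)"
    using gbinomial_mult_1[of "- 1 / 4 :: rat" k] by (simp add: algebra_simps)
  have g3: "(?y + 1) * (- 3 / 4 gchoose Suc k) = (- 3 / 4 - ?y) * (- 3 / 4 gchoose k)"
    using gbinomial_mult_1[of "- 3 / 4 :: rat" k] by (simp add: algebra_simps)
  have "16 * (?y + 1) ^ 2 * ((- 1 / 4 gchoose Suc k) * (- 3 / 4 gchoose Suc k)) =
     16 * ((?y + 1) * (- 1 / 4 gchoose Suc k)) * ((?y + 1) * (- 3 / 4 gchoose Suc k))"
    by (simp add: power2_eq_square)
  also have "\<dots> = (4 * ?y + 1) * (4 * ?y + 3) * ((- 1 / 4 gchoose k) * (- 3 / 4 gchoose k))"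
    unfolding g1 g3 by (simp add: algebra_simps)
  also have "\<dots> = (4 * (4 * ?y + 1) * (4 * ?y + 3) * (C (2 * k) * C k)) / (4 * 64 ^ k)"
  proof -
    have gen: "a * b * (z / w) = 4 * a * b * z / (4 * w)" for a b z w :: rat by simp
    have "4 * k = 2 * (2 * k)" by simp
    then show ?thesis unfolding Suc C_def by (simp only: gen)
  qed
  also have "\<dots> = 16 * (?y + 1) ^ 2 * (C (2 * Suc k) * C (Suc k) / 64 ^ Suc k)"
    unfolding CC[symmetric] by simp
  finally have "16 * (?y + 1) ^ 2 * ((- 1 / 4 gchoose Suc k) * (- 3 / 4 gchoose Suc k)) = \<dots>" .
  moreover have "16 * (?y + 1) ^ 2 \<noteq> 0"
    by (metis add.commute of_nat_Suc of_nat_neq_0 mult_eq_0_iff power_not_zero zero_neq_numeral)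
  ultimately have "(- 1 / 4 gchoose Suc k) * (- 3 / 4 gchoose Suc k) = C (2 * Suc k) * C (Suc k) / 64 ^ Suc k"
    using mult_left_cancel by blast
  moreover have "4 * Suc k = 2 * (2 * Suc k)" by simp
  ultimately show ?case unfolding C_def by (simp only:)
qed simp

locale prime_gt_3 = prime_modulus +
  fixes n :: nat
  assumes p_eq: "p = 2 * n + 1" and p_gt_3: "p > 3"
begin

lemmas pint = p_integral_of_int p_integral_of_nat p_integral_numeral
  p_integral_add p_integral_mult p_integral_uminus p_integral_power
  p_integral_sum

lemma p_integral_inverse_power_of_2: "1 / 2 ^ k \<in> p_integral p"
proof -
  have "\<not> p dvd 2"
    using p_gt_3 by (auto dest: dvd_imp_le)
  then have "1 / of_nat 2 \<in> p_integral p"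
    by (intro p_integral_divide pint)
  then have "(1 / 2) ^ k \<in> p_integral p" by (intro pint) simp
  then show ?thesis by (simp add: power_one_over)
qed

lemma p_integral_inverse_4: "1 / 4 ^ k \<in> p_integral p" "1 / 16 ^ k \<in> p_integral p" "1 / (-4) ^ k \<in> p_integral p"
  "1 / 64 ^ k \<in> p_integral p" "1 / 8 ^ k \<in> p_integral p"
proof -
  have *: "(2::rat) ^ (2 * k) = 4 ^ k" "(2::rat) ^ (4 * k) = 16 ^ k"
     "(2::rat) ^ (3 * k) = 8 ^ k" "(2::rat) ^ (6 * k) = 64 ^ k"
    by (simp_all add: power_mult)
  show "1 / 4 ^ k \<in> p_integral p" "1 / 16 ^ k \<in> p_integral p"  "1 / 64 ^ k \<in> p_integral p" "1 / 8 ^ k \<in> p_integral p"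
    using p_integral_inverse_power_of_2[of "2 * k"] p_integral_inverse_power_of_2[of "4 * k"]
     p_integral_inverse_power_of_2[of "3 * k"] p_integral_inverse_power_of_2[of "6 * k"] by (simp_all add: *)
  have "(-1) ^ k * (1 / 4 ^ k) \<in> p_integral p"
    by (intro pint \<open>1 / 4 ^ k \<in> p_integral p\<close>)
  then show "1 / (-4) ^ k \<in> p_integral p"
    by (cases "even k") simp_all
qed

lemma cong_ratI: "a - b = of_nat p * c \<Longrightarrow> a \<in> p_integral p \<Longrightarrow> b \<in> p_integral p \<Longrightarrow> c \<in> p_integral p \<Longrightarrow> a \<approx> b"
  unfolding rat_cong_def by blast

lemma cong_rat_half: "of_nat n \<approx> - 1 / 2"
proof (rule cong_ratI)
  show "of_nat n - - 1 / 2 = of_nat p * (1 / 2 ^ 1 :: rat)" by (simp add: p_eq field_simps)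
  show "- 1 / 2 \<in> p_integral p" using p_integral_uminus[OF p_integral_inverse_power_of_2[of 1]] by simp
qed (intro pint p_integral_inverse_power_of_2)+

lemma cong_rat_choose:
  assumes "k < p"
  shows "of_nat (n choose k) \<approx> of_nat (2 * k choose k) / (-4) ^ k"
  using cong_rat_gbinomial[OF cong_rat_half assms]
  by (simp add: central_binomial_eq_gbinomial[of k] binomial_gbinomial[of n k])

text \<open>By upper negation n + k choose k is (-1)^k times - n - 1 choose k, and - n - 1 is
  congruent to -1/2 just as n is.\<close>

lemma cong_rat_choose_add:
  assumes "k < p"
  shows "of_nat (n + k choose k) \<approx> of_nat (2 * k choose k) / 4 ^ k"
proof -
  have "- of_nat (n + 1) \<approx> - 1 / 2"
  proof (rule cong_ratI)
    show "- of_nat (n + 1) - - 1 / 2 = of_nat p * (- (1 / 2 ^ 1) :: rat)" by (simp add: p_eq field_simps)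
    show "- 1 / 2 \<in> p_integral p" using p_integral_uminus[OF p_integral_inverse_power_of_2[of 1]] by simp
  qed (intro pint p_integral_inverse_power_of_2)+
  then have "(-1) ^ k * ((- of_nat (n + 1)) gchoose k) \<approx> (-1) ^ k * ((- 1 / 2) gchoose k)"
    by (intro cong_rat_mult cong_rat_gbinomial assms cong_rat_refl pint)
  moreover have "(-1) ^ k * ((- of_nat (n + 1)) gchoose k) = (of_nat (n + k choose k) :: rat)"
    unfolding gbinomial_minus binomial_gbinomial by (simp add: algebra_simps flip: power_mult_distrib)
  moreover have "(-1) ^ k * ((- 1 / 2) gchoose k) = (of_nat (2 * k choose k) / 4 ^ k :: rat)"
    unfolding central_binomial_eq_gbinomial by (simp add: power_minus[of 4])
  ultimately show ?thesis by simp
qed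

lemma cong_rat_4_power: "4 ^ n \<approx> 1"
proof -
  have "\<not> p dvd 2" using p_gt_3 by (auto dest: dvd_imp_le)
  then have "[2 ^ (p - 1) = 1] (mod p)" by (rule fermat_theorem[OF prime_p])
  then have "[int (2 ^ (p - 1)) = int 1] (mod int p)" by (simp only: cong_int_iff)
  then have "of_int (int (2 ^ (p - 1))) \<approx> of_int (int 1)" by (rule cong_rat_of_int)
  moreover have "p - 1 = 2 * n" using p_eq by simp
  ultimately show ?thesis by (simp add: power_mult)
qed

lemma cong_rat_scale: "a \<approx> b \<Longrightarrow> c \<in> p_integral p \<Longrightarrow> a * c \<approx> b * c"
  by (intro cong_rat_mult cong_rat_refl)

text \<open>The weight 1/8^k is (-1/2)^k / (-4)^k. Passing from \<open>2 * k choose k\<close> to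
  \<open>n choose k\<close> also cuts the sum off at n.\<close>

lemma sum_W_cong_choose:
  "(\<Sum>k=0..p - 1. of_nat (2 * k choose k) * (of_int (W k) / 8 ^ k)) \<approx>
   (\<Sum>k\<le>n. of_nat (n choose k) * (- 1 / 2) ^ k * of_int (W k))"
proof -
  have "(\<Sum>k=0..p - 1. of_nat (2 * k choose k) * (of_int (W k) / 8 ^ k)) \<approx>
    (\<Sum>k=0..p - 1. of_nat (n choose k) * (- 1 / 2) ^ k * of_int (W k))"
  proof (rule cong_rat_sum)
    fix k assume "k \<in> {0..p - 1}"
    then have "k < p" using p_gt_3 by auto
    have half: "- 1 / 2 \<in> p_integral p" using p_integral_uminus[OF p_integral_inverse_power_of_2[of 1]] by simp
    have "of_nat (n choose k) * ((- 1 / 2) ^ k * of_int (W k)) \<approx>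
      of_nat (2 * k choose k) / (-4) ^ k * ((- 1 / 2) ^ k * of_int (W k))"
      by (intro cong_rat_scale cong_rat_choose \<open>k < p\<close> pint half)
    moreover have "of_nat (2 * k choose k) / (-4) ^ k * ((- 1 / 2) ^ k * of_int (W k)) = of_nat (2 * k choose k) * (of_int (W k) / (8 ^ k :: rat))"
    proof -
      have "(- 1 / 2 :: rat) ^ k = (-4) ^ k / 8 ^ k" by (simp flip: power_divide)
      then show ?thesis by simp
    qed
    ultimately show "of_nat (2 * k choose k) * (of_int (W k) / 8 ^ k) \<approx> of_nat (n choose k) * (- 1 / 2) ^ k * of_int (W k)"
      using cong_rat_sym by (simp add: mult.assoc)
  qed
  also have "(\<Sum>k=0..p - 1. of_nat (n choose k) * (- 1 / 2) ^ k * of_int (W k)) =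
     (\<Sum>k\<le>n. of_nat (n choose k) * (- 1 / 2 :: rat) ^ k * of_int (W k))"
    using p_eq by (intro sum.mono_neutral_right) (auto simp: binomial_eq_0)
  finally show ?thesis .
qed

text \<open>Fermat removes 4^n, and n choose (m + j) becomes a central binomial coefficient over a
  power of -4. Then \<open>sum_binomial_products_eq_cube\<close> applies, and the cube of the
  central binomial coefficient is turned back into that of n choose m.\<close>

lemma sum_cong_choose_cubed:
  assumes "m \<le> n"
  shows "(\<Sum>j\<le>m div 2. (- 1) ^ j * of_nat (n choose (m + j)) * of_nat (m + j choose j) * of_nat (2 * j choose j) *
        of_nat (m choose (2 * j)) * (4 ^ n / 4 ^ (m + j))) \<approx> of_nat (n choose m) ^ 3"
proof -
  have "(\<Sum>j\<le>m div 2. (- 1) ^ j * of_nat (n choose (m + j)) * of_nat (m + j choose j) * of_nat (2 * j choose j) *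
        of_nat (m choose (2 * j)) * (4 ^ n / 4 ^ (m + j))) \<approx>
    (\<Sum>j\<le>m div 2. (- 1) ^ m / 16 ^ m * (of_nat (2 * (m + j) choose (m + j)) * of_nat (m + j choose j) * of_nat (2 * j choose j) * of_nat (m choose (2 * j)) / 16 ^ j))"
  proof (rule cong_rat_sum)
    fix j assume j: "j \<in> {..m div 2}"
    \<comment> \<open>m + j can exceed n, but it is at most 3 n / 2 and hence below p.\<close>
    then have "m + j < p" using assms p_eq by auto
    have "of_nat (n choose (m + j)) * 4 ^ n \<approx> of_nat (2 * (m + j) choose (m + j)) / (-4) ^ (m + j) * 1"
      by (intro cong_rat_mult cong_rat_choose cong_rat_4_power \<open>m + j < p\<close>)
    then have c1: "of_nat (n choose (m + j)) * 4 ^ n * ((- 1) ^ j * of_nat (m + j choose j) * of_nat (2 * j choose j) * of_nat (m choose (2 * j)) * (1 / 4 ^ (m + j)))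
      \<approx> of_nat (2 * (m + j) choose (m + j)) / (-4) ^ (m + j) * 1 * ((- 1) ^ j * of_nat (m + j choose j) * of_nat (2 * j choose j) * of_nat (m choose (2 * j)) * (1 / 4 ^ (m + j)))"
      by (intro cong_rat_scale pint p_integral_inverse_4)
    have c2: "of_nat (2 * (m + j) choose (m + j)) / (-4) ^ (m + j) * 1 * ((- 1) ^ j * of_nat (m + j choose j) * of_nat (2 * j choose j) * of_nat (m choose (2 * j)) * (1 / 4 ^ (m + j)))
      = (- 1) ^ m / 16 ^ m * (of_nat (2 * (m + j) choose (m + j)) * of_nat (m + j choose j) * of_nat (2 * j choose j) * of_nat (m choose (2 * j)) / 16 ^ j :: rat)"
    proof -
      have "(-4 :: rat) ^ (m + j) * 4 ^ (m + j) = (- 16) ^ (m + j)" by (simp flip: power_mult_distrib)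
      also have "\<dots> = (-1) ^ m * (-1) ^ j * 16 ^ m * 16 ^ j"
      proof -
        have "(- 16 :: rat) = (- 1) * 16" by simp
        then show ?thesis by (simp only: power_mult_distrib power_add ac_simps)
      qed
      finally have e: "1 / ((-4 :: rat) ^ (m + j) * 4 ^ (m + j)) = (-1) ^ m * (-1) ^ j / (16 ^ m * 16 ^ j)"
        by (cases "even m"; cases "even j") (simp_all add: divide_simps)
      have "of_nat (2 * (m + j) choose (m + j)) / (-4) ^ (m + j) * 1 * ((- 1) ^ j * of_nat (m + j choose j) * of_nat (2 * j choose j) * of_nat (m choose (2 * j)) * (1 / 4 ^ (m + j)))
        = of_nat (2 * (m + j) choose (m + j)) * ((- 1) ^ j * of_nat (m + j choose j) * of_nat (2 * j choose j) * of_nat (m choose (2 * j))) * (1 / ((-4 :: rat) ^ (m + j) * 4 ^ (m + j)))"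
        by simp
      then show ?thesis unfolding e
        by (rule trans) (cases "even j"; simp)
    qed
    show "(- 1) ^ j * of_nat (n choose (m + j)) * of_nat (m + j choose j) * of_nat (2 * j choose j) *
        of_nat (m choose (2 * j)) * (4 ^ n / 4 ^ (m + j)) \<approx>
     (- 1) ^ m / 16 ^ m * (of_nat (2 * (m + j) choose (m + j)) * of_nat (m + j choose j) * of_nat (2 * j choose j) * of_nat (m choose (2 * j)) / 16 ^ j)"
      by (rule cong_rat_cong[OF c1 _ c2]) (simp only: ac_simps divide_inverse mult_1_left)
  qed
  also have "(\<Sum>j\<le>m div 2. (- 1) ^ m / 16 ^ m * (of_nat (2 * (m + j) choose (m + j)) * of_nat (m + j choose j) * of_nat (2 * j choose j) * of_nat (m choose (2 * j)) / 16 ^ j))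
    = (- 1) ^ m / 16 ^ m * (\<Sum>j\<le>m. of_nat (2 * (m + j) choose (m + j)) * of_nat (m + j choose j) * of_nat (2 * j choose j) * of_nat (m choose (2 * j)) / (16 ^ j :: rat))"
    unfolding sum_distrib_left[symmetric]
    by (intro arg_cong2[of _ _ _ _ "(*)"] refl sum.mono_neutral_left) (auto simp: binomial_eq_0)
  also have "\<dots> = (of_nat (2 * m choose m) / (-4) ^ m) ^ 3"
  proof -
    have "((-4) ^ m) ^ 3 = ((-1) ^ m * 64 ^ m :: rat)"
    proof -
      have "((-4) ^ m) ^ 3 = ((-4) ^ 3 :: rat) ^ m" by (metis power_mult mult.commute)
      also have "(-4) ^ 3 = (-1) * (64 :: rat)" by simp
      finally show ?thesis by (simp only: power_mult_distrib)
    qed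
    also have "64 ^ m = (16 ^ m * 4 ^ m :: rat)" by (simp flip: power_mult_distrib)
    finally have e: "((-4) ^ m) ^ 3 = ((-1) ^ m * (16 ^ m * 4 ^ m) :: rat)" .
    \<comment> \<open>s is (-1)^m, which may move between numerator and denominator.\<close>
    have gen: "s / u * (c / v) = c / (s * (u * v))" if "s = 1 \<or> s = - 1" for s u v c :: rat
      using that by auto
    show ?thesis
      unfolding sum_binomial_products_eq_cube power_divide e by (rule gen) (cases "even m"; simp)
  qed
  also have "\<dots> \<approx> of_nat (n choose m) ^ 3"
    using assms p_eq by (intro cong_rat_power cong_rat_sym[OF cong_rat_choose]) auto
  finally show ?thesis .
qed

text \<open>With N = \<open>n div 2\<close>, p is 4 N + 1 or 4 N + 3, so N and - N - 1 are congruent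
  to -1/4 and -3/4 in this or the reverse order; the sign comes from upper negation.\<close>

lemma cong_rat_quarters:
  assumes "k < p"
  shows "of_nat (n div 2 choose k) * of_nat (n div 2 + k choose k) \<approx> (-1) ^ k * (of_nat (4 * k choose (2 * k)) * of_nat (2 * k choose k) / 64 ^ k)"
proof -
  let ?N = "n div 2"
  have q: "- 1 / 4 \<in> p_integral p" "- 3 / 4 \<in> p_integral p"
    using p_integral_mult[OF p_integral_of_int[of "-1"] p_integral_inverse_4(1)[of 1]]
      p_integral_mult[OF p_integral_of_int[of "-3"] p_integral_inverse_4(1)[of 1]] by simp_all
  have i: "of_nat ?N \<in> p_integral p" "- of_nat (?N + 1) \<in> p_integral p" "1 / 4 ^ 1 \<in> p_integral p" "- (1 / 4 ^ 1) \<in> p_integral p"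
    by (intro pint p_integral_inverse_4)+
  have "(of_nat ?N gchoose k) * (- of_nat (?N + 1) gchoose k) \<approx> (- 1 / 4 gchoose k) * (- 3 / 4 gchoose k)"
  proof (cases "even n")
    case True
    then have "rat_of_nat p = 4 * of_nat ?N + 1" by (auto simp: p_eq elim!: evenE)
    then have "of_nat ?N - - 1 / 4 = of_nat p * (1 / 4 ^ 1 :: rat)" "- of_nat (?N + 1) - - 3 / 4 = of_nat p * (- (1 / 4 ^ 1) :: rat)"
      by (simp_all add: field_simps)
    then have "of_nat ?N \<approx> - 1 / 4" "- of_nat (?N + 1) \<approx> - 3 / 4"
      using q i by (blast intro: cong_ratI)+
    then show ?thesis by (intro cong_rat_mult cong_rat_gbinomial assms)
  next
    case False
    then have "rat_of_nat p = 4 * of_nat ?N + 3" by (auto simp: p_eq elim!: oddE)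
    then have "of_nat ?N - - 3 / 4 = of_nat p * (1 / 4 ^ 1 :: rat)" "- of_nat (?N + 1) - - 1 / 4 = of_nat p * (- (1 / 4 ^ 1) :: rat)"
      by (simp_all add: field_simps)
    then have "of_nat ?N \<approx> - 3 / 4" "- of_nat (?N + 1) \<approx> - 1 / 4"
      using q i by (blast intro: cong_ratI)+
    then have "(of_nat ?N gchoose k) * (- of_nat (?N + 1) gchoose k) \<approx> (- 3 / 4 gchoose k) * (- 1 / 4 gchoose k)"
      by (intro cong_rat_mult cong_rat_gbinomial assms)
    then show ?thesis by (simp only: mult.commute)
  qed
  then have "(of_nat ?N gchoose k) * (- of_nat (?N + 1) gchoose k) * (-1) ^ k \<approx> (- 1 / 4 gchoose k) * (- 3 / 4 gchoose k) * (-1) ^ k"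
    by (intro cong_rat_scale pint)
  moreover have "(- of_nat (?N + 1) gchoose k) * (-1) ^ k = (of_nat (?N + k choose k) :: rat)"
    unfolding gbinomial_minus binomial_gbinomial by (simp add: algebra_simps flip: power_mult_distrib)
  then have "(of_nat ?N gchoose k) * (- of_nat (?N + 1) gchoose k) * (-1) ^ k = (of_nat (?N choose k) * of_nat (?N + k choose k) :: rat)"
    by (simp only: binomial_gbinomial mult.assoc)
  ultimately show ?thesis by (metis gbinomial_quarters mult.commute)
qed

theorem sum_W_cong_legendre_mean:
  "(\<Sum>k=0..p - 1. of_nat (2 * k choose k) * (of_int (W k) / 8 ^ k)) \<approx> legendre_mean (n div 2)"
proof -
  have half: "(1 / 2) ^ n \<in> p_integral p" using p_integral_inverse_power_of_2[of n] by (simp add: power_one_over)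
  note sum_W_cong_choose
  also have "(\<Sum>k\<le>n. of_nat (n choose k) * (- 1 / 2) ^ k * of_int (W k)) =
    (\<Sum>m\<le>n. \<Sum>j\<le>m div 2. (- 1) ^ j * of_nat (n choose (m + j)) * of_nat (m + j choose j) * of_nat (2 * j choose j) *
        of_nat (m choose (2 * j)) * (4 ^ n / 4 ^ (m + j))) * (1 / 2 :: rat) ^ n"
    unfolding sum_choose_W sum_choose_W_expanded by (rule mult.commute)
  also have "\<dots> \<approx> (\<Sum>m\<le>n. of_nat (n choose m) ^ 3) * (1 / 2) ^ n"
    by (intro cong_rat_scale cong_rat_sum sum_cong_choose_cubed half) auto
  also have "\<dots> = (\<Sum>k\<le>n div 2. of_nat (n + k choose k) * of_nat (n choose (2 * k)) * of_nat (2 * k choose k) / 4 ^ k)"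
    unfolding sum_choose_cubed by (simp add: power_one_over)
  \<comment> \<open>The sums agree term by term modulo p: both sides reduce to
    \<open>4 * k choose (2 * k)\<close> times the square of \<open>2 * k choose k\<close> over
    256^k.\<close>
  also have "\<dots> \<approx> legendre_mean (n div 2)"
    unfolding legendre_mean_def
  proof (rule cong_rat_sum)
    fix k assume "k \<in> {..n div 2}"
    then have k: "k < p" "2 * k < p" using p_eq by auto
    let ?c = "of_nat (2 * k choose k) * (- 1) ^ k * (1 / 4 ^ k) :: rat"
    have c: "?c \<in> p_integral p" "of_nat (2 * k choose k) * (1 / 4 ^ k) \<in> p_integral p" by (intro pint p_integral_inverse_4)+
    have "of_nat (n + k choose k) * of_nat (n choose (2 * k)) * (of_nat (2 * k choose k) * (1 / 4 ^ k)) \<approx>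
      of_nat (2 * k choose k) / 4 ^ k * (of_nat (2 * (2 * k) choose (2 * k)) / (-4) ^ (2 * k)) * (of_nat (2 * k choose k) * (1 / 4 ^ k))"
      using k by (intro cong_rat_mult cong_rat_choose cong_rat_choose_add cong_rat_refl c)
    also have "\<dots> = (-1) ^ k * (of_nat (4 * k choose (2 * k)) * of_nat (2 * k choose k) / 64 ^ k) * ?c"
    proof -
      have e1: "(-4 :: rat) ^ (2 * k) = 16 ^ k" by (simp add: power_mult)
      have e2: "(64 :: rat) ^ k = 4 ^ k * 16 ^ k" by (simp flip: power_mult_distrib)
      have e3: "2 * (2 * k) = 4 * k" by simp
      have gen: "c / a * (d / b) * (c * (1 / a)) = s * (d * c / (a * b)) * (c * s * (1 / a))" if "s * s = 1" for a b c d s :: rat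
      proof -
        have "s * (d * c / (a * b)) * (c * s * (1 / a)) = (s * s) * ((d * c / (a * b)) * (c * (1 / a)))"
          by (simp only: ac_simps)
        then show ?thesis by (simp add: that)
      qed
      show ?thesis unfolding e1 e2 e3 by (rule gen) (simp flip: power_mult_distrib)
    qed
    also have "\<dots> \<approx> of_nat (n div 2 choose k) * of_nat (n div 2 + k choose k) * ?c"
      by (rule cong_rat_scale[OF cong_rat_sym[OF cong_rat_quarters[OF k(1)]] c(1)])
    finally show "of_nat (n + k choose k) * of_nat (n choose (2 * k)) * of_nat (2 * k choose k) / 4 ^ k \<approx>
      of_nat (n div 2 choose k) * of_nat (n div 2 + k choose k) * of_nat (2 * k choose k) * (- 1 / 4) ^ k"
    proof (rule cong_rat_cong)
      have "(- 1 / 4 :: rat) ^ k = (- 1) ^ k * (1 / 4 ^ k)"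
        unfolding power_divide by simp
      then show "of_nat (n div 2 choose k) * of_nat (n div 2 + k choose k) * ?c =
        of_nat (n div 2 choose k) * of_nat (n div 2 + k choose k) * of_nat (2 * k choose k) * (- 1 / 4) ^ k"
        by (simp only: mult.assoc)
    qed (simp add: mult.assoc)
  qed
  finally show ?thesis .
qed

text \<open>Up to the factor (-8)^n the left-hand side is the middle coefficient of (y^2 - 8 y +
  8)^n; here the character sum of y (y^2 - 8 y + 8) meets the Legendre polynomial.\<close>

theorem sum_trinomial_cong_legendre_at_0:
  "(\<Sum>k\<le>n div 2. of_nat (n choose (2 * k)) * of_nat (2 * k choose k) / 8 ^ k) \<approx> legendre_at_0 (n div 2)"
  unfolding legendre_at_0_def
proof (rule cong_rat_sum)
  fix k assume "k \<in> {..n div 2}"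
  then have k: "k < p" "2 * k < p" using p_eq by auto
  let ?c = "(- 1) ^ k * (1 / 2 ^ k) :: rat"
  have c: "?c \<in> p_integral p" "of_nat (2 * k choose k) * (1 / 8 ^ k) \<in> p_integral p" by (intro pint p_integral_inverse_4 p_integral_inverse_power_of_2)+
  have "of_nat (n choose (2 * k)) * (of_nat (2 * k choose k) * (1 / 8 ^ k)) \<approx>
    of_nat (2 * (2 * k) choose (2 * k)) / (-4) ^ (2 * k) * (of_nat (2 * k choose k) * (1 / 8 ^ k))"
    using k by (intro cong_rat_scale cong_rat_choose c)
  also have "\<dots> = (-1) ^ k * (of_nat (4 * k choose (2 * k)) * of_nat (2 * k choose k) / 64 ^ k) * ?c"
  proof -
    have e1: "(-4 :: rat) ^ (2 * k) = 16 ^ k" by (simp add: power_mult)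
    have e2: "2 * (2 * k) = 4 * k" by simp
    have gen: "d / a * (c * (1 / b)) = s * (d * c / a') * (s * (1 / b'))" if "s * s = 1" "a * b = a' * b'" for a b a' b' c d s :: rat
    proof -
      have "s * (d * c / a') * (s * (1 / b')) = (s * s) * (d * c / (a' * b'))"
        by (simp add: ac_simps)
      then show ?thesis by (simp add: that(1) flip: that(2))
    qed
    show ?thesis unfolding e1 e2 by (rule gen) (simp_all flip: power_mult_distrib)
  qed
  also have "\<dots> \<approx> of_nat (n div 2 choose k) * of_nat (n div 2 + k choose k) * ?c"
    by (rule cong_rat_scale[OF cong_rat_sym[OF cong_rat_quarters[OF k(1)]] c(1)])
  finally show "of_nat (n choose (2 * k)) * of_nat (2 * k choose k) / 8 ^ k \<approx>
    of_nat (n div 2 choose k) * of_nat (n div 2 + k choose k) * (- 1 / 2) ^ k"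
  proof (rule cong_rat_cong)
    have "(- 1 / 2 :: rat) ^ k = (- 1) ^ k * (1 / 2 ^ k)"
      unfolding power_divide by simp
    then show "of_nat (n div 2 choose k) * of_nat (n div 2 + k choose k) * ?c =
      of_nat (n div 2 choose k) * of_nat (n div 2 + k choose k) * (- 1 / 2) ^ k"
      by (simp only: mult.assoc)
  qed simp
qed

end

subsection \<open>A character sum over Gaussian residues\<close>

text \<open>The Gaussian integers stay in characteristic zero and are reduced modulo p through
  \<open>gcong\<close>; so one ring serves all p, and norms and real parts are ordinary integers to
  which \<open>chi\<close> applies.\<close>

datatype gauss = Gauss (gre: int) (gim: int)

instantiation gauss :: comm_ring_1
begin

definition "0 = Gauss 0 0"
definition "1 = Gauss 1 0"
definition "a + b = Gauss (gre a + gre b) (gim a + gim b)"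
definition "a - b = Gauss (gre a - gre b) (gim a - gim b)"
definition "- a = Gauss (- gre a) (- gim a)"
definition "a * b = Gauss (gre a * gre b - gim a * gim b) (gre a * gim b + gim a * gre b)"

instance
  by intro_classes
    (auto simp: zero_gauss_def one_gauss_def plus_gauss_def minus_gauss_def uminus_gauss_def times_gauss_def
      algebra_simps intro!: gauss.expand)

end

lemma gre_gim_simps [simp]:
  "gre 0 = 0" "gim 0 = 0" "gre 1 = 1" "gim 1 = 0"
  "gre (a + b) = gre a + gre b" "gim (a + b) = gim a + gim b"
  "gre (a - b) = gre a - gre b" "gim (a - b) = gim a - gim b"
  "gre (- a) = - gre a" "gim (- a) = - gim a"
  "gre (a * b) = gre a * gre b - gim a * gim b" "gim (a * b) = gre a * gim b + gim a * gre b"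
  by (simp_all add: zero_gauss_def one_gauss_def plus_gauss_def minus_gauss_def uminus_gauss_def times_gauss_def)

lemma gauss_eqI: "gre a = gre b \<Longrightarrow> gim a = gim b \<Longrightarrow> a = b"
  by (rule gauss.expand) simp

lemma gre_gim_of_nat [simp]: "gre (of_nat k) = int k" "gim (of_nat k) = 0"
  by (induction k) simp_all

lemma gre_gim_of_int [simp]: "gre (of_int k) = k" "gim (of_int k) = 0"
  by (cases k; simp)+

definition gnorm :: "gauss \<Rightarrow> int" where "gnorm z = gre z ^ 2 + gim z ^ 2"

definition gcnj :: "gauss \<Rightarrow> gauss" where "gcnj z = Gauss (gre z) (- gim z)"

lemma gcnj_simps [simp]: "gre (gcnj z) = gre z" "gim (gcnj z) = - gim z"
  by (simp_all add: gcnj_def)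

lemma gnorm_mult [simp]: "gnorm (a * b) = gnorm a * gnorm b"
  by (simp add: gnorm_def power2_eq_square algebra_simps)

lemma gnorm_of_int [simp]: "gnorm (of_int k) = k ^ 2"
  by (simp add: gnorm_def)

lemma gnorm_1 [simp]: "gnorm 1 = 1"
  by (simp add: gnorm_def)

lemma gnorm_power [simp]: "gnorm (a ^ k) = gnorm a ^ k"
  by (induction k) simp_all

lemma gnorm_gcnj [simp]: "gnorm (gcnj a) = gnorm a"
  by (simp add: gnorm_def)

lemma gcnj_mult: "gcnj (a * b) = gcnj a * gcnj b"
  by (rule gauss_eqI) simp_all

lemma gcnj_gcnj [simp]: "gcnj (gcnj a) = a"
  by (rule gauss_eqI) simp_all

lemma gcnj_power: "gcnj (a ^ k) = gcnj a ^ k"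
  by (induction k) (simp_all add: gcnj_mult, simp add: gcnj_def one_gauss_def)

lemma mult_gcnj: "a * gcnj a = of_int (gnorm a)"
  by (rule gauss_eqI) (simp_all add: gnorm_def power2_eq_square)

lemma of_int_gauss_dvd_iff: "of_int k dvd (z :: gauss) \<longleftrightarrow> k dvd gre z \<and> k dvd gim z"
proof
  assume "k dvd gre z \<and> k dvd gim z"
  then obtain a b where "gre z = k * a" "gim z = k * b" by (elim conjE dvdE)
  then have "z = of_int k * Gauss a b" by (intro gauss_eqI) simp_all
  then show "of_int k dvd z" by simp
qed (auto elim!: dvdE)


section \<open>The Frobenius congruence and the form x^2 + 2 y^2\<close>

lemma prime_dvd_freshman:
  fixes w :: "'a::comm_ring_1"
  assumes "prime p"
  shows "of_nat p dvd (1 + w) ^ p - (1 + w ^ p)"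
proof -
  have p: "p > 1" using assms prime_gt_1_nat by blast
  have "(1 + w) ^ p = (\<Sum>k\<le>p. of_nat (p choose k) * w ^ k)"
    using binomial_ring[of w 1 p] by (simp add: add.commute)
  also have "{..p} = insert 0 (insert p {0<..<p})" using p by auto
  also have "(\<Sum>k\<in>insert 0 (insert p {0<..<p}). of_nat (p choose k) * w ^ k) = 1 + w ^ p + (\<Sum>k\<in>{0<..<p}. of_nat (p choose k) * w ^ k)"
    using p by simp
  finally have "(1 + w) ^ p - (1 + w ^ p) = (\<Sum>k\<in>{0<..<p}. of_nat (p choose k) * w ^ k)" by simp
  also have "of_nat p dvd \<dots>"
  proof (rule dvd_sum)
    fix k assume "k \<in> {0<..<p}"
    then have "p dvd (p choose k)" using dvd_choose_prime[of k p] assms by auto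
    then have "of_nat p dvd (of_nat (p choose k) :: 'a)" by (metis dvdE dvd_triv_left of_nat_mult)
    then show "of_nat p dvd of_nat (p choose k) * w ^ k" by (rule dvd_mult2)
  qed
  finally show ?thesis .
qed

text \<open>P divides (x e - c y) (x e + c y); after a change of the sign of c it divides the first
  factor. In P^2 = (x c + 2 y e)^2 + 2 (x e - c y)^2 there is no room for a nonzero multiple of
  P.\<close>

lemma representation_unique:
  fixes x y c e P :: int
  assumes "prime P" "P = x ^ 2 + 2 * y ^ 2" "P = c ^ 2 + 2 * e ^ 2"
  shows "x ^ 2 = c ^ 2"
proof -
  have P: "P > 0" using assms(1) prime_gt_0_int by blast
  have main: "x ^ 2 = c ^ 2" if d: "P dvd x * e - c * y" and P': "P = c ^ 2 + 2 * e ^ 2" for c e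
  proof -
    have "P ^ 2 = (x * c + 2 * y * e) ^ 2 + 2 * (x * e - c * y) ^ 2"
      unfolding power2_eq_square[of P] by (subst (1) assms(2), subst P') (simp add: power2_eq_square algebra_simps)
    then have le: "2 * (x * e - c * y) ^ 2 \<le> P ^ 2" by simp
    have "x * e - c * y = 0"
    proof (rule ccontr)
      assume "x * e - c * y \<noteq> 0"
      then have "P \<le> \<bar>x * e - c * y\<bar>" using dvd_imp_le_int[of "x * e - c * y" P] d P by linarith
      then have "P ^ 2 \<le> (x * e - c * y) ^ 2" using P by (metis abs_le_square_iff abs_of_pos)
      moreover have "P ^ 2 > 0" using P by simp
      ultimately show False using le by linarith
    qed
    then have "(x * e) ^ 2 = (c * y) ^ 2" by simp
    moreover have "(x * e) ^ 2 - (c * y) ^ 2 = P * (e ^ 2 - y ^ 2)"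
    proof -
      have "(x * e) ^ 2 - (c * y) ^ 2 = (x ^ 2 + 2 * y ^ 2) * e ^ 2 - (c ^ 2 + 2 * e ^ 2) * y ^ 2"
        by (simp add: power2_eq_square algebra_simps)
      then show ?thesis by (simp only: assms(2)[symmetric] P'[symmetric]) (simp add: algebra_simps)
    qed
    ultimately have "e ^ 2 = y ^ 2" using P by simp
    then show ?thesis using assms(2) P' by simp
  qed
  have "(x * e - c * y) * (x * e + c * y) = (x ^ 2 + 2 * y ^ 2) * e ^ 2 - (c ^ 2 + 2 * e ^ 2) * y ^ 2"
    by (simp add: power2_eq_square algebra_simps)
  also have "\<dots> = P * (e ^ 2 - y ^ 2)" by (simp only: assms(2,3)[symmetric]) (simp add: algebra_simps)
  finally have "P dvd (x * e - c * y) * (x * e + c * y)" by simp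
  then consider "P dvd x * e - c * y" | "P dvd x * e + c * y"
    using prime_dvd_mult_iff[OF assms(1)] by blast
  then show ?thesis
  proof cases
    case 1 then show ?thesis using main assms(3) by blast
  next
    case 2 then show ?thesis using main[of e "- c"] assms(3) by simp
  qed
qed

text \<open>Parity alone: \<open>A\<close>, \<open>B\<close>, \<open>A / 2\<close> and
  \<open>B / 2\<close> turn out even one after the other, the equation being divided by 2 each
  time.\<close>

lemma four_descent:
  fixes A B P :: int
  assumes "A ^ 2 + 2 * B ^ 2 = 16 * P"
  shows "\<exists>c e. A = 4 * c \<and> P = c ^ 2 + 2 * e ^ 2"
proof -
  have "A ^ 2 = 2 * (8 * P - B ^ 2)" using assms by simp
  then have "even (A ^ 2)" by (metis dvd_triv_left)
  then obtain a where a: "A = 2 * a" by (auto elim!: evenE)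
  with assms have 1: "2 * a ^ 2 + B ^ 2 = 8 * P" by (simp add: power2_eq_square)
  then have "B ^ 2 = 2 * (4 * P - a ^ 2)" by simp
  then have "even (B ^ 2)" by (metis dvd_triv_left)
  then obtain b where b: "B = 2 * b" by (auto elim!: evenE)
  with 1 have 2: "a ^ 2 + 2 * b ^ 2 = 4 * P" by (simp add: power2_eq_square)
  then have "a ^ 2 = 2 * (2 * P - b ^ 2)" by simp
  then have "even (a ^ 2)" by (metis dvd_triv_left)
  then obtain c where c: "a = 2 * c" by (auto elim!: evenE)
  with 2 have 3: "2 * c ^ 2 + b ^ 2 = 2 * P" by (simp add: power2_eq_square)
  then have "b ^ 2 = 2 * (P - c ^ 2)" by simp
  then have "even (b ^ 2)" by (metis dvd_triv_left)
  then obtain e where e: "b = 2 * e" by (auto elim!: evenE)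
  with 3 have "c ^ 2 + 2 * e ^ 2 = P" by (simp add: power2_eq_square)
  then show ?thesis using a c by auto
qed

section \<open>The Legendre symbol and sums over residues\<close>

locale odd_prime = prime_modulus +
  assumes p_gt_2: "p > 2"
begin

definition chi :: "int \<Rightarrow> int" where "chi a = Legendre a (int p)"

definition R :: "int set" where "R = {0..<int p}"

lemma odd_p: "odd p" using prime_p p_gt_2 prime_odd_nat by blast

lemma chi_cong: "[a = b] (mod int p) \<Longrightarrow> chi a = chi b"
proof -
  assume *: "[a = b] (mod int p)"
  then have "[a = 0] (mod int p) \<longleftrightarrow> [b = 0] (mod int p)" "QuadRes (int p) a \<longleftrightarrow> QuadRes (int p) b"
    unfolding QuadRes_def by (meson cong_sym cong_trans)+
  then show ?thesis by (simp add: chi_def Legendre_def)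
qed

lemma chi_euler: "[chi a = a ^ ((p - 1) div 2)] (mod int p)"
  using euler_criterion[OF prime_p p_gt_2] by (simp add: chi_def)

lemma chi_values: "chi a \<in> {-1, 0, 1}"
  by (simp add: chi_def Legendre_def)

lemma small_cong_eq: "[a = b] (mod int p) \<Longrightarrow> \<bar>a - b\<bar> < int p \<Longrightarrow> a = b"
  by (metis cong_iff_dvd_diff dvd_imp_le_int eq_iff_diff_eq_0 linorder_not_less abs_of_nat)

lemma chi_mult: "chi (a * b) = chi a * chi b"
proof (rule small_cong_eq)
  have "[chi (a * b) = (a * b) ^ ((p - 1) div 2)] (mod int p)" by (rule chi_euler)
  also have "(a * b) ^ ((p - 1) div 2) = a ^ ((p - 1) div 2) * b ^ ((p - 1) div 2)" by (rule power_mult_distrib)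
  also have "[\<dots> = chi a * chi b] (mod int p)" by (intro cong_mult cong_sym[OF chi_euler])
  finally show "[chi (a * b) = chi a * chi b] (mod int p)" .
  show "\<bar>chi (a * b) - chi a * chi b\<bar> < int p"
    using chi_values[of "a * b"] chi_values[of a] chi_values[of b] p_gt_2 by auto
qed

lemma chi_eq_0_iff: "chi a = 0 \<longleftrightarrow> int p dvd a"
  by (auto simp: chi_def Legendre_def cong_0_iff)

lemma chi_square: "\<not> int p dvd a \<Longrightarrow> chi a * chi a = 1"
  using chi_values[of a] chi_eq_0_iff[of a] by auto

lemma chi_1 [simp]: "chi 1 = 1"
  using chi_values[of 1] chi_mult[of 1 1] chi_eq_0_iff[of 1] prime_int_p not_prime_unit by auto

lemma chi_0 [simp]: "chi 0 = 0"
  by (simp add: chi_eq_0_iff)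

lemma chi_power: "chi (a ^ k) = chi a ^ k"
  by (induction k) (simp_all add: chi_mult)

lemma chi_even_power: "\<not> int p dvd a \<Longrightarrow> chi (a ^ (2 * k)) = 1"
  by (simp only: chi_power power_mult) (simp add: power2_eq_square chi_square)

lemma ex_inverse:
  assumes "\<not> int p dvd a"
  obtains b where "[a * b = 1] (mod int p)"
proof -
  have "coprime a (int p)"
    using prime_imp_coprime[OF prime_int_p assms] by (simp add: coprime_commute)
  then show ?thesis using cong_solve_coprime_int that by blast
qed

text \<open>If all nonzero residues were squares, squaring would be onto and hence one-to-one on
  them, but 1 and -1 have the same square.\<close>

lemma nonsquare_exists: "\<exists>g. chi g = -1"
proof (rule ccontr)
  assume "\<nexists>g. chi g = -1"
  then have sq: "QuadRes (int p) a" if "\<not> int p dvd a" for a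
    using that by (auto simp: chi_def Legendre_def cong_0_iff split: if_splits)
  define S where "S = {1..<int p}"
  have "S \<subseteq> (\<lambda>x. x ^ 2 mod int p) ` S"
  proof
    fix a assume a: "a \<in> S"
    then have "\<not> int p dvd a" by (auto simp: S_def zdvd_not_zless)
    then obtain y where y: "[y ^ 2 = a] (mod int p)" using sq unfolding QuadRes_def by blast
    have "(y mod int p) ^ 2 mod int p = a"
      using y a by (simp add: cong_def power_mod S_def)
    moreover have "y mod int p \<in> S"
    proof -
      have "y mod int p \<noteq> 0" using \<open>(y mod int p) ^ 2 mod int p = a\<close> a by (auto simp: S_def)
      moreover have "0 \<le> y mod int p" "y mod int p < int p" using p_gt_2 by simp_all
      ultimately show ?thesis by (simp add: S_def)
    qed
    ultimately show "a \<in> (\<lambda>x. x ^ 2 mod int p) ` S" by force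
  qed
  then have "(\<lambda>x. x ^ 2 mod int p) ` S = S"
    by (metis S_def card_image_le card_seteq finite_atLeastLessThan_int finite_imageI)
  then have "inj_on (\<lambda>x. x ^ 2 mod int p) S"
    by (metis S_def eq_card_imp_inj_on finite_atLeastLessThan_int)
  moreover have "1 \<in> S" "int p - 1 \<in> S" using p_gt_2 by (auto simp: S_def)
  moreover have "(int p - 1) ^ 2 mod int p = 1 ^ 2 mod int p"
    by (simp add: mod_eq_dvd_iff power2_eq_square algebra_simps)
  ultimately have "int p - 1 = 1" unfolding inj_on_def by metis
  then show False using p_gt_2 by simp
qed

text \<open>Functions on the residues modulo p are encoded as periodic functions on
  \<open>int\<close> and summed over the representatives \<open>R\<close>; \<open>gperiodic\<close>
  and \<open>G\<close> play the same part for Gaussian residues.\<close>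

definition periodic :: "(int \<Rightarrow> 'a) \<Rightarrow> bool" where
  "periodic f \<longleftrightarrow> (\<forall>x y. [x = y] (mod int p) \<longrightarrow> f x = f y)"

lemma periodicD: "periodic f \<Longrightarrow> [x = y] (mod int p) \<Longrightarrow> f x = f y"
  by (auto simp: periodic_def)

lemma finite_R [simp]: "finite R" by (simp add: R_def)

lemma card_R [simp]: "card R = p" by (simp add: R_def)

lemma mod_in_R [simp]: "x mod int p \<in> R"
  using p_gt_2 by (simp add: R_def)

lemma mod_R [simp]: "x \<in> R \<Longrightarrow> x mod int p = x"
  by (simp add: R_def)

lemma sum_R_affine:
  assumes "periodic f" "\<not> int p dvd a"
  shows "(\<Sum>x\<in>R. f (a * x + b)) = (\<Sum>x\<in>R. f x)"
proof -
  obtain c where c: "[a * c = 1] (mod int p)" using ex_inverse[OF assms(2)] by blast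
  have *: "[c * (a * x + b - b) = x] (mod int p)" "[a * (c * (x - b)) + b = x] (mod int p)" for x
  proof -
    have "c * (a * x + b - b) - x = (a * c - 1) * x" "a * (c * (x - b)) + b - x = (a * c - 1) * (x - b)"
      by (simp_all add: algebra_simps)
    then show "[c * (a * x + b - b) = x] (mod int p)" "[a * (c * (x - b)) + b = x] (mod int p)"
      using c by (simp_all add: cong_iff_dvd_diff)
  qed
  show ?thesis
  proof (rule sum.reindex_bij_witness[of _ "\<lambda>x. (c * (x - b)) mod int p" "\<lambda>x. (a * x + b) mod int p"])
    fix x assume x: "x \<in> R"
    have "[c * ((a * x + b) mod int p - b) = c * (a * x + b - b)] (mod int p)"
      by (intro cong_mult cong_diff cong_refl) (simp add: cong_def)
    also note *(1)
    finally show "(c * ((a * x + b) mod int p - b)) mod int p = x"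
      using x by (simp add: cong_def)
    have "[a * ((c * (x - b)) mod int p) + b = a * (c * (x - b)) + b] (mod int p)"
      by (intro cong_mult cong_add cong_refl) (simp add: cong_def)
    also note *(2)
    finally show "(a * ((c * (x - b)) mod int p) + b) mod int p = x"
      using x by (simp add: cong_def)
    show "f ((a * x + b) mod int p) = f (a * x + b)"
      by (rule periodicD[OF assms(1)]) (simp add: cong_def)
  qed simp_all
qed

lemma periodic_chi: "periodic chi"
  by (auto simp: periodic_def intro: chi_cong)

lemma sum_chi: "(\<Sum>x\<in>R. chi x) = 0"
proof -
  obtain g where g: "chi g = -1" using nonsquare_exists by blast
  then have "\<not> int p dvd g" using chi_eq_0_iff[of g] by auto
  then have "(\<Sum>x\<in>R. chi (g * x + 0)) = (\<Sum>x\<in>R. chi x)" by (rule sum_R_affine[OF periodic_chi])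
  then show ?thesis by (simp add: chi_mult g sum_negf)
qed

lemma dvd_R_iff: "x \<in> R \<Longrightarrow> int p dvd x \<longleftrightarrow> x = 0"
  by (auto simp: R_def dest: zdvd_imp_le)

lemma R_nonzero: "R - {0} = {1..<int p}" 
  using p_gt_2 by (auto simp: R_def)

lemma sum_R_split: "(\<Sum>x\<in>R. f x) = f 0 + (\<Sum>x\<in>{1..<int p}. f x)"
proof -
  have "0 \<in> R" using p_gt_2 by (simp add: R_def)
  then show ?thesis by (simp add: sum.remove[OF finite_R] R_nonzero)
qed

lemma sum_chi_squared: "(\<Sum>x\<in>R. chi x * chi x) = int p - 1"
proof -
  have "(\<Sum>x\<in>{1..<int p}. chi x * chi x) = (\<Sum>x\<in>{1..<int p}. 1)"
    by (rule sum.cong) (auto intro!: chi_square simp: zdvd_not_zless)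
  then show ?thesis using p_gt_2 by (simp add: sum_R_split of_nat_diff)
qed

lemma prime_dvd_mult_int: "int p dvd a * b \<longleftrightarrow> int p dvd a \<or> int p dvd b"
  using prime_dvd_mult_iff[OF prime_int_p] .

text \<open>The predecessor of the least nonresidue k is a square y^2 modulo p, so k is congruent to
  the norm of 1 + y i. Such an element serves later as the \<open>d\<close> whose powers represent
  the four classes.\<close>

lemma ex_square_plus_square_nonresidue: "\<exists>z. chi (gnorm z) = -1"
proof -
  obtain g where "chi g = -1" using nonsquare_exists by blast
  then have "chi (int (nat (g mod int p))) = -1"
    using chi_cong[of "g mod int p" g] p_gt_2 by (simp add: cong_def)
  then have ex: "\<exists>k. chi (int k) = -1" by blast
  define k where "k = (LEAST k. chi (int k) = -1)"
  have k: "chi (int k) = -1" unfolding k_def using ex by (rule LeastI_ex)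
  obtain m where m: "k = Suc m" using k by (cases k) auto
  have "chi (int m) \<noteq> -1" using not_less_Least[of m "\<lambda>k. chi (int k) = -1"] m by (auto simp: k_def)
  then consider "chi (int m) = 0" | "chi (int m) = 1" using chi_values[of "int m"] by auto
  then show ?thesis
  proof cases
    case 1
    then have "[int k = 1] (mod int p)" by (simp add: m chi_eq_0_iff cong_iff_dvd_diff)
    then show ?thesis using k chi_cong[of "int k" 1] by simp
  next
    case 2
    then obtain y where "[y ^ 2 = int m] (mod int p)"
      by (auto simp: chi_def Legendre_def QuadRes_def split: if_splits)
    then have "[gnorm (Gauss 1 y) = int k] (mod int p)"
      by (simp add: m gnorm_def cong_iff_dvd_diff algebra_simps)
    then show ?thesis using k chi_cong by metis
  qed
qed

section \<open>Gaussian integers modulo p\<close>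

definition gcong :: "gauss \<Rightarrow> gauss \<Rightarrow> bool" where
  "gcong z w \<longleftrightarrow> of_int (int p) dvd z - w"

lemma gcong_iff: "gcong z w \<longleftrightarrow> [gre z = gre w] (mod int p) \<and> [gim z = gim w] (mod int p)"
  unfolding gcong_def of_int_gauss_dvd_iff by (simp add: cong_iff_dvd_diff)

lemma gcong_refl [simp]: "gcong z z" by (simp add: gcong_iff)

lemma gcong_sym: "gcong z w \<Longrightarrow> gcong w z" by (simp add: gcong_iff cong_sym_eq)

lemma gcong_trans [trans]: "gcong z w \<Longrightarrow> gcong w v \<Longrightarrow> gcong z v"
  unfolding gcong_iff by (meson cong_trans)

lemma gcong_mult: "gcong a b \<Longrightarrow> gcong c d \<Longrightarrow> gcong (a * c) (b * d)"
  by (auto simp: gcong_iff intro!: cong_diff cong_add cong_mult)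

lemma gcong_power: "gcong a b \<Longrightarrow> gcong (a ^ k) (b ^ k)"
  by (induction k) (simp_all add: gcong_mult)

lemma gcong_gnorm: "gcong a b \<Longrightarrow> [gnorm a = gnorm b] (mod int p)"
  by (auto simp: gcong_iff gnorm_def intro!: cong_add cong_pow)

lemma gcong_gcnj: "gcong a b \<Longrightarrow> gcong (gcnj a) (gcnj b)"
  by (auto simp: gcong_iff cong_minus_minus_iff)

definition gunit :: "gauss \<Rightarrow> bool" where "gunit z \<longleftrightarrow> \<not> int p dvd gnorm z"

lemma gunit_mult: "gunit (a * b) \<longleftrightarrow> gunit a \<and> gunit b"
  by (simp add: gunit_def prime_dvd_mult_int)

lemma gunit_gcong: "gcong a b \<Longrightarrow> gunit a \<longleftrightarrow> gunit b"
  unfolding gunit_def using gcong_gnorm cong_dvd_iff by blast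

lemma gunit_1 [simp]: "gunit 1"
  using prime_int_p not_prime_unit by (auto simp: gunit_def)

lemma gunit_power: "gunit a \<Longrightarrow> gunit (a ^ k)"
  by (induction k) (auto simp: gunit_mult)

lemma gunit_of_int: "gunit (of_int c) \<longleftrightarrow> \<not> int p dvd c"
  by (simp add: gunit_def power2_eq_square prime_dvd_mult_int)

lemma gunit_inverse:
  assumes "gunit z"
  obtains w where "gcong (z * w) 1" "gunit w"
proof -
  obtain k where k: "[gnorm z * k = 1] (mod int p)" using ex_inverse assms unfolding gunit_def by blast
  have "z * (of_int k * gcnj z) = of_int (gnorm z * k)"
    unfolding of_int_mult mult_gcnj[symmetric] by (simp only: ac_simps)
  then have 1: "gcong (z * (of_int k * gcnj z)) 1"
    using k by (simp add: gcong_iff)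
  then have "gunit (z * (of_int k * gcnj z))" using gunit_gcong[OF 1] by simp
  then have "gunit (of_int k * gcnj z)" using gunit_mult by blast
  with 1 show ?thesis using that by blast
qed

lemma chi_gnorm_gcong: "gcong a b \<Longrightarrow> chi (gnorm a) = chi (gnorm b)"
  by (intro chi_cong gcong_gnorm)

definition red :: "gauss \<Rightarrow> gauss" where "red z = Gauss (gre z mod int p) (gim z mod int p)"

definition G :: "gauss set" where "G = {z. gre z \<in> R \<and> gim z \<in> R}"

lemma gcong_red: "gcong (red z) z"
  by (simp add: red_def gcong_iff cong_def)

lemma red_in_G [simp]: "red z \<in> G"
  by (simp add: red_def G_def)

lemma red_eq_iff: "red z = red w \<longleftrightarrow> gcong z w"
  by (auto simp: red_def gcong_iff cong_def)

lemma red_G: "z \<in> G \<Longrightarrow> red z = z"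
  by (auto simp: red_def G_def)

lemma sum_G: "(\<Sum>z\<in>G. f z) = (\<Sum>x\<in>R. \<Sum>y\<in>R. f (Gauss x y))"
  unfolding sum.cartesian_product
  by (rule sum.reindex_bij_witness[of _ "\<lambda>(x, y). Gauss x y" "\<lambda>z. (gre z, gim z)"]) (auto simp: G_def)

lemma finite_G [simp]: "finite G"
proof -
  have "G \<subseteq> (\<lambda>(x, y). Gauss x y) ` (R \<times> R)"
  proof
    fix z assume "z \<in> G"
    then show "z \<in> (\<lambda>(x, y). Gauss x y) ` (R \<times> R)" by (cases z) (auto simp: G_def)
  qed
  then show ?thesis using finite_surj[of "R \<times> R"] by simp
qed

definition gperiodic :: "(gauss \<Rightarrow> 'a) \<Rightarrow> bool" where
  "gperiodic f \<longleftrightarrow> (\<forall>z w. gcong z w \<longrightarrow> f z = f w)"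

lemma gperiodicD: "gperiodic f \<Longrightarrow> gcong z w \<Longrightarrow> f z = f w"
  by (auto simp: gperiodic_def)

lemma sum_G_reindex:
  assumes f: "gperiodic f"
    and h: "\<And>z w. gcong z w \<Longrightarrow> gcong (h z) (h w)" and k: "\<And>z w. gcong z w \<Longrightarrow> gcong (k z) (k w)"
    and kh: "\<And>z. gcong (k (h z)) z" and hk: "\<And>z. gcong (h (k z)) z"
  shows "(\<Sum>z\<in>G. f (h z)) = (\<Sum>z\<in>G. f z)"
proof (rule sum.reindex_bij_witness[of _ "\<lambda>z. red (k z)" "\<lambda>z. red (h z)"])
  fix z assume z: "z \<in> G"
  have "gcong (k (red (h z))) (k (h z))" by (rule k[OF gcong_red])
  also note kh
  finally show "red (k (red (h z))) = z" using z by (metis red_G red_eq_iff)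
  have "gcong (h (red (k z))) (h (k z))" by (rule h[OF gcong_red])
  also note hk
  finally show "red (h (red (k z))) = z" using z by (metis red_G red_eq_iff)
  show "f (red (h z)) = f (h z)" by (rule gperiodicD[OF f gcong_red])
qed simp_all

lemma sum_G_mult:
  assumes f: "gperiodic f" and w: "gunit w"
  shows "(\<Sum>z\<in>G. f (w * z)) = (\<Sum>z\<in>G. f z)"
proof -
  obtain v where v: "gcong (w * v) 1" using gunit_inverse[OF w] by blast
  have 1: "gcong (v * (w * z)) z" for z
    using gcong_mult[OF v gcong_refl, of z] by (simp add: ac_simps)
  have 2: "gcong (w * (v * z)) z" for z
    using gcong_mult[OF v gcong_refl, of z] by (simp add: ac_simps)
  show ?thesis
    by (rule sum_G_reindex[where k = "\<lambda>z. v * z", OF f]) (simp_all add: gcong_mult 1 2)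
qed

lemma sum_G_gcnj:
  assumes f: "gperiodic f"
  shows "(\<Sum>z\<in>G. f (gcnj z)) = (\<Sum>z\<in>G. f z)"
  by (rule sum_G_reindex[where k = gcnj, OF f]) (simp_all add: gcong_gcnj)

section \<open>The character sum \<open>Phi\<close> and its symmetries\<close>

definition Phi :: "gauss \<Rightarrow> int" where
  "Phi t = (\<Sum>z\<in>G. chi (gnorm z) * chi (gre (t * z ^ 4)))"

lemma gcong_gre: "gcong z w \<Longrightarrow> [gre z = gre w] (mod int p)"
  by (simp add: gcong_iff)

lemma Phi_gperiodic: "gperiodic Phi"
  unfolding gperiodic_def Phi_def
  by (intro allI impI sum.cong refl arg_cong2[of _ _ _ _ "(*)"] chi_cong gcong_gre gcong_mult gcong_refl)

lemma Phi_term_gperiodic: "gperiodic (\<lambda>z. chi (gnorm z) * chi (gre (t * z ^ 4)))"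
  unfolding gperiodic_def
  by (intro allI impI arg_cong2[of _ _ _ _ "(*)"] chi_cong gcong_gre gcong_gnorm gcong_mult gcong_refl gcong_power)

text \<open>Substitute w z for z, a permutation of the residues because w is a unit; the symbol of
  the norm of w changes sides since its square is 1.\<close>

lemma Phi_mult_fourth_power:
  assumes w: "gunit w"
  shows "Phi (t * (of_int c * w ^ 4)) = chi c * chi (gnorm w) * Phi t"
proof -
  let ?f = "\<lambda>z. chi (gnorm z) * chi (gre (t * z ^ 4))"
  have "Phi (t * (of_int c * w ^ 4)) = (\<Sum>z\<in>G. chi c * chi (gnorm w) * ?f (w * z))"
    unfolding Phi_def
  proof (rule sum.cong)
    fix z
    have "t * (of_int c * w ^ 4) * z ^ 4 = of_int c * (t * (w * z) ^ 4)"
      by (simp add: power_mult_distrib ac_simps)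
    then have "gre (t * (of_int c * w ^ 4) * z ^ 4) = c * gre (t * (w * z) ^ 4)" by simp
    moreover have "a * (b * d) = b * chi (gnorm w) * (chi (gnorm w) * a * d)" for a b d
    proof -
      have "b * chi (gnorm w) * (chi (gnorm w) * a * d) = (chi (gnorm w) * chi (gnorm w)) * (a * (b * d))"
        by (simp only: ac_simps)
      then show ?thesis using chi_square[of "gnorm w"] w by (simp add: gunit_def)
    qed
    ultimately show "chi (gnorm z) * chi (gre (t * (of_int c * w ^ 4) * z ^ 4)) = chi c * chi (gnorm w) * ?f (w * z)"
      by (simp only: chi_mult gnorm_mult)
  qed simp
  also have "\<dots> = chi c * chi (gnorm w) * (\<Sum>z\<in>G. ?f (w * z))"
    by (simp only: sum_distrib_left)
  also have "(\<Sum>z\<in>G. ?f (w * z)) = Phi t"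
    unfolding Phi_def by (rule sum_G_mult[OF Phi_term_gperiodic w])
  finally show ?thesis .
qed

text \<open>Conjugating z keeps its norm, and conjugating t z^4 keeps its real part.\<close>

lemma Phi_gcnj: "Phi (gcnj t) = Phi t"
proof -
  let ?f = "\<lambda>z. chi (gnorm z) * chi (gre (t * z ^ 4))"
  have "gre (gcnj t * z ^ 4) = gre (t * gcnj z ^ 4)" for z
  proof -
    have "gcnj t * z ^ 4 = gcnj (t * gcnj z ^ 4)" by (simp add: gcnj_mult gcnj_power)
    then show ?thesis by simp
  qed
  then have "Phi (gcnj t) = (\<Sum>z\<in>G. ?f (gcnj z))"
    unfolding Phi_def by simp
  also have "\<dots> = Phi t" unfolding Phi_def by (rule sum_G_gcnj[OF Phi_term_gperiodic])
  finally show ?thesis .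
qed

text \<open>In the split case a zero divisor \<open>t\<close> is fixed by \<open>1 + s * gcnj t\<close>, whose norm can be made a nonresidue.\<close>

lemma Phi_non_unit:
  assumes "\<not> gunit t"
  shows "Phi t = 0"
proof -
  have N: "int p dvd gnorm t" using assms by (simp add: gunit_def)
  show ?thesis
  proof (cases "int p dvd gre t")
    case True
    then have "int p dvd gim t ^ 2" using N by (simp add: gnorm_def power2_eq_square dvd_add_right_iff)
    then have "int p dvd gim t" using prime_dvd_power[OF prime_int_p] by blast
    then have "gcong t 0" using True by (simp add: gcong_iff cong_0_iff)
    then have "Phi t = Phi 0" by (rule gperiodicD[OF Phi_gperiodic])
    then show ?thesis by (simp add: Phi_def)
  next
    case False
    obtain g where g: "chi g = -1" using nonsquare_exists by blast
    have "\<not> int p dvd 2 * gre t"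
      using False p_gt_2 by (auto simp: prime_dvd_mult_int dest: zdvd_imp_le)
    then obtain a where a: "[2 * gre t * a = 1] (mod int p)" using ex_inverse by blast
    \<comment> \<open>As the norm of t vanishes modulo p, the norm of w is 1 + 2 s Re t there; this
      s makes it the nonresidue g.\<close>
    define s where "s = a * (g - 1)"
    define w where "w = 1 + of_int s * gcnj t"
    have "gnorm w = 1 + s * (2 * gre t) + s ^ 2 * gnorm t"
      by (simp add: w_def gnorm_def power2_eq_square algebra_simps)
    also have "[\<dots> = 1 + (g - 1) * 1 + s ^ 2 * 0] (mod int p)"
    proof -
      have "[(2 * gre t * a) * (g - 1) = 1 * (g - 1)] (mod int p)" by (intro cong_mult a cong_refl)
      then have A: "[s * (2 * gre t) = (g - 1) * 1] (mod int p)" by (simp add: s_def ac_simps)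
      have B: "[gnorm t = 0] (mod int p)" using N by (simp add: cong_0_iff)
      show ?thesis by (rule cong_add[OF cong_add[OF cong_refl A] cong_mult[OF cong_refl B]])
    qed
    finally have w: "[gnorm w = g] (mod int p)" by simp
    then have chiw: "chi (gnorm w) = -1" using g chi_cong by simp
    then have "gunit w" using chi_eq_0_iff[of "gnorm w"] by (auto simp: gunit_def)
    have tw: "gcong (t * w) t"
    proof -
      have "t * w - t = of_int (s * gnorm t)"
        by (simp add: w_def algebra_simps mult_gcnj[symmetric])
      then show ?thesis using N by (simp only: gcong_def of_int_gauss_dvd_iff gre_gim_of_int) simp
    qed
    have "gcong (t * w ^ k) t" for k
    proof (induction k)
      case (Suc k)
      have "gcong (t * w ^ k * w) (t * w)" by (rule gcong_mult[OF Suc gcong_refl])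
      with tw show ?case by (simp add: mult.assoc mult.commute[of w]) (metis gcong_trans mult.assoc)
    qed simp
    then have "Phi (t * w ^ 4) = Phi t" by (rule gperiodicD[OF Phi_gperiodic])
    moreover have "Phi (t * w ^ 4) = - Phi t"
      using Phi_mult_fourth_power[OF \<open>gunit w\<close>, of t 1] chiw by simp
    ultimately show ?thesis by simp
  qed
qed

section \<open>The second moment of \<open>Phi\<close>\<close>

definition U :: "gauss set" where "U = {z \<in> G. gunit z}"

lemma finite_U [simp]: "finite U" by (simp add: U_def)

lemma one_in_U: "1 \<in> U"
  using p_gt_2 by (simp add: U_def G_def R_def)

text \<open>The units whose fourth power is a scalar modulo p. In the second moment exactly the
  pairs of units z, w with w / z in \<open>E\<close> contribute.\<close>

definition E :: "gauss set" where "E = {u \<in> U. int p dvd gim (u ^ 4)}"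

text \<open>For t = x + i y the real part of t v is x Re v - y Im v. If p does not divide Im v, then
  for fixed x the sum over y runs through all residues and vanishes; otherwise y drops out.\<close>

lemma twisted_correlation:
  "(\<Sum>t\<in>G. chi (gre t) * chi (gre (t * v))) = (if int p dvd gim v then int p * (int p - 1) * chi (gre v) else 0)"
proof -
  have "(\<Sum>t\<in>G. chi (gre t) * chi (gre (t * v))) = (\<Sum>x\<in>R. \<Sum>y\<in>R. chi x * chi ((- gim v) * y + x * gre v))"
    unfolding sum_G by (simp add: algebra_simps)
  also have "\<dots> = (\<Sum>x\<in>R. chi x * (\<Sum>y\<in>R. chi ((- gim v) * y + x * gre v)))"
    by (simp only: sum_distrib_left)
  finally have eq: "(\<Sum>t\<in>G. chi (gre t) * chi (gre (t * v))) = \<dots>" .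
  show ?thesis
  proof (cases "int p dvd gim v")
    case False
    then have "(\<Sum>y\<in>R. chi ((- gim v) * y + x * gre v)) = 0" for x
      using sum_R_affine[OF periodic_chi, of "- gim v"] sum_chi by simp
    with eq False show ?thesis by simp
  next
    case True
    have "(\<Sum>y\<in>R. chi ((- gim v) * y + x * gre v)) = int p * (chi x * chi (gre v))" for x
    proof -
      have "chi ((- gim v) * y + x * gre v) = chi x * chi (gre v)" for y
        unfolding chi_mult[symmetric] using True by (intro chi_cong) (simp add: cong_iff_dvd_diff)
      then show ?thesis by simp
    qed
    then have "(\<Sum>t\<in>G. chi (gre t) * chi (gre (t * v))) = (\<Sum>x\<in>R. int p * chi (gre v) * (chi x * chi x))"
      using eq by (simp add: ac_simps)
    also have "\<dots> = int p * chi (gre v) * (int p - 1)"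
      by (simp only: sum_distrib_left[symmetric] sum_chi_squared)
    finally show ?thesis using True by simp
  qed
qed

text \<open>After squaring, the substitutions w = z u and then t for z^4 t remove z. The sum over t
  becomes \<open>twisted_correlation\<close> at u^4, so only u in \<open>E\<close> survive, and by
  the assumption each of them contributes p (p - 1).\<close>

lemma Phi_second_moment:
  assumes E1: "\<And>u. u \<in> E \<Longrightarrow> chi (gnorm u) * chi (gre (u ^ 4)) = 1"
  shows "(\<Sum>t\<in>G. Phi t ^ 2) = int (card U) * (int p * (int p - 1) * int (card E))"
proof -
  let ?h = "\<lambda>t z. chi (gre (t * z ^ 4))"
  have "(\<Sum>t\<in>G. Phi t ^ 2) = (\<Sum>t\<in>G. \<Sum>z\<in>G. \<Sum>w\<in>G. chi (gnorm z) * ?h t z * (chi (gnorm w) * ?h t w))"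
    unfolding Phi_def power2_eq_square sum_product ..
  also have "\<dots> = (\<Sum>z\<in>G. \<Sum>t\<in>G. \<Sum>w\<in>G. chi (gnorm z) * ?h t z * (chi (gnorm w) * ?h t w))"
    by (rule sum.swap)
  also have "\<dots> = (\<Sum>z\<in>G. \<Sum>w\<in>G. \<Sum>t\<in>G. chi (gnorm z) * ?h t z * (chi (gnorm w) * ?h t w))"
    by (intro sum.cong refl sum.swap)
  also have "\<dots> = (\<Sum>z\<in>G. if gunit z then int p * (int p - 1) * int (card E) else 0)"
  proof (rule sum.cong)
    fix z
    show "(\<Sum>w\<in>G. \<Sum>t\<in>G. chi (gnorm z) * ?h t z * (chi (gnorm w) * ?h t w)) =
      (if gunit z then int p * (int p - 1) * int (card E) else 0)"
    proof (cases "gunit z")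
      case False
      then have "chi (gnorm z) = 0" by (simp add: chi_eq_0_iff gunit_def)
      with False show ?thesis by simp
    next
      case True
      let ?F = "\<lambda>w. \<Sum>t\<in>G. chi (gnorm z) * ?h t z * (chi (gnorm w) * ?h t w)"
      have "gperiodic ?F"
        unfolding gperiodic_def
        by (intro allI impI sum.cong refl arg_cong2[of _ _ _ _ "(*)"] chi_cong gcong_gre gcong_gnorm gcong_mult gcong_refl gcong_power)
      then have "(\<Sum>w\<in>G. ?F w) = (\<Sum>u\<in>G. ?F (z * u))" by (rule sum_G_mult[OF _ True, symmetric])
      also have "\<dots> = (\<Sum>u\<in>G. chi (gnorm u) * (\<Sum>t\<in>G. chi (gre t) * chi (gre (t * u ^ 4))))"
      proof (rule sum.cong)
        fix u
        let ?g = "\<lambda>t. chi (gre t) * chi (gre (t * u ^ 4))"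
        have "?F (z * u) = (\<Sum>t\<in>G. chi (gnorm u) * ?g (z ^ 4 * t))"
        proof (rule sum.cong)
          fix t
          have "t * (z * u) ^ 4 = z ^ 4 * t * u ^ 4" "t * z ^ 4 = z ^ 4 * t"
            by (simp_all add: power_mult_distrib ac_simps)
          moreover have "chi (gnorm z) * chi (gnorm z) = 1" using True chi_square by (simp add: gunit_def)
          then have "chi (gnorm z) * a * (chi (gnorm z) * chi (gnorm u) * b) = chi (gnorm u) * (a * b)" for a b
            by (metis (no_types, lifting) mult.assoc mult.left_commute mult_1)
          ultimately show "chi (gnorm z) * ?h t z * (chi (gnorm (z * u)) * ?h t (z * u)) = chi (gnorm u) * ?g (z ^ 4 * t)"
            by (simp only: gnorm_mult chi_mult)
        qed simp
        also have "\<dots> = chi (gnorm u) * (\<Sum>t\<in>G. ?g (z ^ 4 * t))" by (simp only: sum_distrib_left)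
        also have "(\<Sum>t\<in>G. ?g (z ^ 4 * t)) = (\<Sum>t\<in>G. ?g t)"
        proof (rule sum_G_mult[OF _ gunit_power[OF True]])
          show "gperiodic ?g" unfolding gperiodic_def
            by (intro allI impI arg_cong2[of _ _ _ _ "(*)"] chi_cong gcong_gre gcong_mult gcong_refl)
        qed
        finally show "?F (z * u) = chi (gnorm u) * (\<Sum>t\<in>G. ?g t)" .
      qed simp
      also have "\<dots> = (\<Sum>u\<in>G. if u \<in> E then int p * (int p - 1) else 0)"
      proof (rule sum.cong)
        fix u assume "u \<in> G"
        show "chi (gnorm u) * (\<Sum>t\<in>G. chi (gre t) * chi (gre (t * u ^ 4))) = (if u \<in> E then int p * (int p - 1) else 0)"
        proof (cases "u \<in> E")
          case True
          then have "chi (gnorm u) * (int p * (int p - 1) * chi (gre (u ^ 4))) = int p * (int p - 1)"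
            using E1[OF True] by (metis mult.left_commute mult.right_neutral)
          then show ?thesis unfolding twisted_correlation using True by (simp add: E_def)
        next
          case False
          then have "chi (gnorm u) = 0 \<or> \<not> int p dvd gim (u ^ 4)"
            using \<open>u \<in> G\<close> by (auto simp: E_def U_def gunit_def chi_eq_0_iff)
          then show ?thesis unfolding twisted_correlation using False by auto
        qed
      qed simp
      also have "\<dots> = (\<Sum>u\<in>E. int p * (int p - 1))"
        by (rule sum.mono_neutral_cong_right) (auto simp: E_def U_def)
      finally show ?thesis using True by simp
    qed
  qed simp
  also have "\<dots> = (\<Sum>z\<in>U. int p * (int p - 1) * int (card E))"
    by (rule sum.mono_neutral_cong_right) (auto simp: U_def)
  finally show ?thesis by simp
qed

lemma not_dvd_R: "x \<in> {1..<int p} \<Longrightarrow> \<not> int p dvd x"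
  by (auto simp: zdvd_not_zless)

lemma not_dvd_2: "\<not> int p dvd 2"
  using p_gt_2 by (auto dest: zdvd_imp_le)

lemma gim_fourth_power: "gim (z ^ 4) = 4 * gre z * gim z * (gre z - gim z) * (gre z + gim z)"
  by (simp add: eval_nat_numeral algebra_simps)

lemma gre_fourth_power: "gre (z ^ 4) = gre z ^ 4 - 6 * gre z ^ 2 * gim z ^ 2 + gim z ^ 4"
  by (simp add: eval_nat_numeral algebra_simps)

text \<open>The imaginary part of (x + i y)^4 is 4 x y (x - y) (x + y), which leaves the two axes
  and the two diagonals without the origin. On the diagonals the norm is 2 x^2 modulo p, nonzero
  because p is odd.\<close>

lemma E_eq:
  "E = (Gauss 0 ` {1..<int p} \<union> (\<lambda>x. Gauss x 0) ` {1..<int p}) \<union>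
       ((\<lambda>x. Gauss x x) ` {1..<int p} \<union> (\<lambda>x. Gauss x (int p - x)) ` {1..<int p})"
proof (intro equalityI subsetI)
  fix u assume "u \<in> E"
  then obtain x y where u: "u = Gauss x y" and xy: "x \<in> R" "y \<in> R" "\<not> int p dvd x ^ 2 + y ^ 2"
    and d: "int p dvd 4 * x * y * (x - y) * (x + y)"
    by (cases u) (auto simp: E_def U_def G_def gunit_def gnorm_def gim_fourth_power)
  have 4: "\<not> int p dvd 4"
    using not_dvd_2 prime_dvd_mult_int[of 2 2] by simp
  consider "int p dvd x" | "int p dvd y" | "int p dvd x - y" | "int p dvd x + y"
    using d 4 by (auto simp: prime_dvd_mult_int)
  then show "u \<in> (Gauss 0 ` {1..<int p} \<union> (\<lambda>x. Gauss x 0) ` {1..<int p}) \<union>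
       ((\<lambda>x. Gauss x x) ` {1..<int p} \<union> (\<lambda>x. Gauss x (int p - x)) ` {1..<int p})"
  proof cases
    case 1
    then have "x = 0" using xy dvd_R_iff by simp
    moreover from this have "y \<noteq> 0" using xy by auto
    ultimately show ?thesis using xy by (auto simp: u R_def)
  next
    case 2
    then have "y = 0" using xy dvd_R_iff by simp
    moreover from this have "x \<noteq> 0" using xy by auto
    ultimately show ?thesis using xy by (auto simp: u R_def)
  next
    case 3
    then have "x = y" using xy small_cong_eq[of x y] by (auto simp: cong_iff_dvd_diff R_def)
    moreover from this have "x \<noteq> 0" using xy by auto
    ultimately show ?thesis using xy by (auto simp: u R_def)
  next
    case 4
    have "x \<noteq> 0"
    proof
      assume "x = 0"
      with 4 have "y = 0" using xy dvd_R_iff by simp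
      with \<open>x = 0\<close> xy show False by simp
    qed
    have "y - (int p - x) = (x + y) - int p" by simp
    then have "[y = int p - x] (mod int p)" using 4 by (simp only: cong_iff_dvd_diff dvd_diff dvd_refl)
    then have "y = int p - x"
      using xy \<open>x \<noteq> 0\<close> by (intro small_cong_eq) (auto simp: R_def)
    then show ?thesis using xy \<open>x \<noteq> 0\<close> by (auto simp: u R_def)
  qed
next
  fix u assume *: "u \<in> (Gauss 0 ` {1..<int p} \<union> (\<lambda>x. Gauss x 0) ` {1..<int p}) \<union>
       ((\<lambda>x. Gauss x x) ` {1..<int p} \<union> (\<lambda>x. Gauss x (int p - x)) ` {1..<int p})"
  have sq: "\<not> int p dvd x ^ 2" "\<not> int p dvd 2 * x ^ 2" "\<not> int p dvd x ^ 2 + x ^ 2" "\<not> int p dvd x ^ 2 + (int p - x) ^ 2"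
    if "x \<in> {1..<int p}" for x
  proof -
    show 1: "\<not> int p dvd x ^ 2" "\<not> int p dvd 2 * x ^ 2"
      using not_dvd_R[OF that] not_dvd_2 by (auto simp: prime_dvd_mult_int power2_eq_square)
    have "x ^ 2 + x ^ 2 = 2 * x ^ 2" "x ^ 2 + (int p - x) ^ 2 = 2 * x ^ 2 + int p * (int p - 2 * x)"
      by (simp_all add: power2_eq_square algebra_simps)
    then show "\<not> int p dvd x ^ 2 + x ^ 2" "\<not> int p dvd x ^ 2 + (int p - x) ^ 2"
      using 1 by (metis, metis dvd_add_left_iff dvd_triv_left)
  qed
  show "u \<in> E"
    using * sq p_gt_2 unfolding E_def U_def G_def R_def gunit_def gnorm_def gim_fourth_power by auto
qed

lemma card_E: "int (card E) = 4 * (int p - 1)"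
proof -
  have inj: "inj_on (Gauss 0) {1..<int p}" "inj_on (\<lambda>x. Gauss x 0) {1..<int p}"
    "inj_on (\<lambda>x. Gauss x x) {1..<int p}" "inj_on (\<lambda>x. Gauss x (int p - x)) {1..<int p}"
    by (auto simp: inj_on_def)
  \<comment> \<open>The two diagonals meet only in the origin because p is odd.\<close>
  have "x \<noteq> int p - x" for x
  proof
    assume "x = int p - x"
    then have "int p = 2 * x" by simp
    then have "even (int p)" by simp
    then show False using odd_p by simp
  qed
  then have "card E = (card (Gauss 0 ` {1..<int p}) + card ((\<lambda>x. Gauss x 0) ` {1..<int p})) +
       (card ((\<lambda>x. Gauss x x) ` {1..<int p}) + card ((\<lambda>x. Gauss x (int p - x)) ` {1..<int p}))"
    unfolding E_eq by (subst card_Un_disjoint; auto)+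
  then show ?thesis using inj p_gt_2 by (simp add: card_image)
qed

text \<open>On an axis the norm is x^2 and the fourth power has real part x^4. On a diagonal they
  are 2 x^2 and -4 x^4, with product -2 (2 x^3)^2, which is where the quadratic character of -2
  enters.\<close>

lemma chi_E:
  assumes "chi (-2) = 1" "u \<in> E"
  shows "chi (gnorm u) * chi (gre (u ^ 4)) = 1"
proof -
  obtain x where x: "x \<in> {1..<int p}" and u: "u = Gauss 0 x \<or> u = Gauss x 0 \<or> u = Gauss x x \<or> u = Gauss x (int p - x)"
    using assms(2) unfolding E_eq by blast
  have chi_x: "chi (x ^ (2 * k)) = 1" for k by (rule chi_even_power[OF not_dvd_R[OF x]])
  from u consider "gcong u (Gauss 0 x)" | "gcong u (Gauss x 0)" | "gcong u (Gauss x x)" | "gcong u (Gauss x (- x))"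
    by (auto simp: gcong_iff cong_iff_dvd_diff)
  then show ?thesis
  proof cases
    case 1
    then have "chi (gnorm u) = chi (gnorm (Gauss 0 x))" "chi (gre (u ^ 4)) = chi (gre (Gauss 0 x ^ 4))"
      by (intro chi_gnorm_gcong chi_cong gcong_gre gcong_power; simp)+
    then show ?thesis using chi_x[of 1] chi_x[of 2] by (simp add: gnorm_def gre_fourth_power)
  next
    case 2
    then have "chi (gnorm u) = chi (gnorm (Gauss x 0))" "chi (gre (u ^ 4)) = chi (gre (Gauss x 0 ^ 4))"
      by (intro chi_gnorm_gcong chi_cong gcong_gre gcong_power; simp)+
    then show ?thesis using chi_x[of 1] chi_x[of 2] by (simp add: gnorm_def gre_fourth_power)
  next
    case 3
    then have "chi (gnorm u) * chi (gre (u ^ 4)) = chi (gnorm (Gauss x x) * gre (Gauss x x ^ 4))"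
      unfolding chi_mult by (intro arg_cong2[of _ _ _ _ "(*)"] chi_gnorm_gcong chi_cong gcong_gre gcong_power)
    also have "gnorm (Gauss x x) * gre (Gauss x x ^ 4) = (-2) * (2 ^ (2 * 1) * x ^ (2 * 3))"
      by (simp add: gnorm_def gre_fourth_power eval_nat_numeral algebra_simps)
    also have "chi \<dots> = 1"
      unfolding chi_mult chi_x chi_even_power[OF not_dvd_2] assms by simp
    finally show ?thesis .
  next
    case 4
    then have "chi (gnorm u) * chi (gre (u ^ 4)) = chi (gnorm (Gauss x (- x)) * gre (Gauss x (- x) ^ 4))"
      unfolding chi_mult by (intro arg_cong2[of _ _ _ _ "(*)"] chi_gnorm_gcong chi_cong gcong_gre gcong_power)
    also have "gnorm (Gauss x (- x)) * gre (Gauss x (- x) ^ 4) = (-2) * (2 ^ (2 * 1) * x ^ (2 * 3))"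
      by (simp add: gnorm_def gre_fourth_power eval_nat_numeral algebra_simps)
    also have "chi \<dots> = 1"
      unfolding chi_mult chi_x chi_even_power[OF not_dvd_2] assms by simp
    finally show ?thesis .
  qed
qed

section \<open>Classes modulo scalars times fourth powers\<close>

lemma gcong_cancel: "gunit a \<Longrightarrow> gcong (a * z) (a * w) \<Longrightarrow> gcong z w"
proof -
  assume "gunit a" and *: "gcong (a * z) (a * w)"
  then obtain b where b: "gcong (a * b) 1" using gunit_inverse by blast
  have inv: "gcong (b * (a * z)) z" for z
    using gcong_mult[OF b gcong_refl[of z]] by (simp add: ac_simps)
  have "gcong z (b * (a * z))" by (rule gcong_sym[OF inv])
  also have "gcong (b * (a * z)) (b * (a * w))" by (rule gcong_mult[OF gcong_refl *])
  also have "gcong (b * (a * w)) w" by (rule inv)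
  finally show "gcong z w" .
qed

text \<open>The classes of \<open>d ^ i\<close>, \<open>i < 4\<close>, modulo scalars times fourth powers are distinct: odd powers are
  excluded by the norm, and \<open>d\<^sup>2\<close> because an element with scalar square has a square norm up to scalars.\<close>

lemma square_scalar_norm:
  assumes "gcong (v ^ 2) (of_int c)" "gunit v"
  shows "chi (gnorm v) = 1"
proof -
  have "int p dvd 2 * (gre v * gim v)"
    using assms(1) by (simp add: gcong_iff cong_iff_dvd_diff power2_eq_square algebra_simps)
  then have "int p dvd gre v \<or> int p dvd gim v" using not_dvd_2 by (auto simp: prime_dvd_mult_int)
  then have "[gnorm v = gim v ^ (2 * 1)] (mod int p) \<and> \<not> int p dvd gim v \<or> [gnorm v = gre v ^ (2 * 1)] (mod int p) \<and> \<not> int p dvd gre v"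
    using assms(2) by (auto simp: gunit_def gnorm_def cong_iff_dvd_diff power2_eq_square)
  then show ?thesis using chi_cong chi_even_power by metis
qed

lemma power_eq_scalar_fourth_power:
  assumes d: "chi (gnorm d) = -1" and c: "\<not> int p dvd c" "\<not> int p dvd c'" and w: "gunit w" "gunit w'"
    and ij: "i \<le> j" "j < 4" and eq: "gcong (d ^ i * (of_int c * w ^ 4)) (d ^ j * (of_int c' * w' ^ 4))"
  shows "i = j"
proof -
  have du: "gunit d" using d chi_eq_0_iff[of "gnorm d"] by (auto simp: gunit_def)
  define k where "k = j - i"
  have j: "j = i + k" using ij by (simp add: k_def)
  have "gcong (d ^ i * (of_int c * w ^ 4)) (d ^ i * (d ^ k * (of_int c' * w' ^ 4)))"
    using eq by (simp add: j power_add ac_simps)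
  then have eq': "gcong (of_int c * w ^ 4) (d ^ k * (of_int c' * w' ^ 4))"
    by (rule gcong_cancel[OF gunit_power[OF du]])
  then have "chi (gnorm (of_int c * w ^ 4)) = chi (gnorm (d ^ k * (of_int c' * w' ^ 4)))"
    by (rule chi_gnorm_gcong)
  moreover have "chi (gnorm w ^ 4) = 1" "chi (gnorm w' ^ 4) = 1" "chi (c ^ 2) = 1" "chi (c' ^ 2) = 1"
    using chi_even_power[of "gnorm w" 2] chi_even_power[of "gnorm w'" 2] chi_even_power[of c 1] chi_even_power[of c' 1] w c
    by (simp_all add: gunit_def)
  ultimately have "(-1) ^ k = (1 :: int)" by (simp add: chi_mult chi_power d)
  then have "even k" by (cases "even k") auto
  moreover have "k < 4" using ij by (simp add: k_def)
  ultimately have "k = 0 \<or> k = 2" by (auto elim!: evenE)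
  moreover have "k \<noteq> 2"
  proof
    assume k: "k = 2"
    obtain v where v: "gcong (w * v) 1" "gunit v" using gunit_inverse[OF w(1)] by blast
    obtain b where b: "[c' * b = 1] (mod int p)" using ex_inverse[OF c(2)] by blast
    have v4: "gcong (w ^ 4 * v ^ 4) 1" using gcong_power[OF v(1), of 4] by (simp add: power_mult_distrib)
    have bc: "gcong (of_int (c' * b)) 1" using b by (simp add: gcong_iff)
    \<comment> \<open>With v inverse to w, the element d w'^2 v^2 has a square congruent to the
      scalar c / c', yet its norm has the same symbol as the norm of d.\<close>
    have "gcong ((d * w' ^ 2 * v ^ 2) ^ 2) ((d * w' ^ 2 * v ^ 2) ^ 2 * of_int (c' * b))"
      using gcong_mult[OF gcong_refl gcong_sym[OF bc]] by simp
    also have "(d * w' ^ 2 * v ^ 2) ^ 2 * of_int (c' * b) = d ^ k * (of_int c' * w' ^ 4) * (v ^ 4 * of_int b)"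
      by (simp add: k power_mult_distrib ac_simps flip: power_mult)
    also have "gcong \<dots> (of_int c * w ^ 4 * (v ^ 4 * of_int b))"
      by (rule gcong_mult[OF gcong_sym[OF eq'] gcong_refl])
    also have "of_int c * w ^ 4 * (v ^ 4 * of_int b) = w ^ 4 * v ^ 4 * of_int (c * b)"
      by (simp add: ac_simps)
    also have "gcong \<dots> (1 * of_int (c * b))"
      by (rule gcong_mult[OF v4 gcong_refl])
    finally have "gcong ((d * w' ^ 2 * v ^ 2) ^ 2) (of_int (c * b))" by simp
    moreover have "gunit (d * w' ^ 2 * v ^ 2)" using du w v by (simp add: gunit_mult gunit_power)
    ultimately have "chi (gnorm (d * w' ^ 2 * v ^ 2)) = 1" by (rule square_scalar_norm)
    moreover have "chi (gnorm w' ^ 2) = 1" "chi (gnorm v ^ 2) = 1"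
      using chi_even_power[of "gnorm w'" 1] chi_even_power[of "gnorm v" 1] w v by (simp_all add: gunit_def)
    ultimately show False by (simp add: chi_mult d)
  qed
  ultimately show ?thesis by (simp add: j)
qed

text \<open>There are 4 (p - 1) \<open>card U\<close> of these triples, that is,
  \<open>card E\<close> for each unit on average.\<close>

definition params :: "(nat \<times> int \<times> gauss) set" where
  "params = {..<4} \<times> {1..<int p} \<times> U"

definition param_value :: "gauss \<Rightarrow> nat \<times> int \<times> gauss \<Rightarrow> gauss" where
  "param_value d = (\<lambda>(i, c, w). d ^ i * (of_int c * w ^ 4))"

text \<open>Two parameters with the same value share i, and the quotient of their w has a scalar
  fourth power, hence lies in \<open>E\<close>. Relative to one fixed (i, c, w) this quotient
  determines w' and then c', so the fibre injects into \<open>E\<close>.\<close>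

lemma fibre_card_le:
  assumes d: "chi (gnorm d) = -1"
  shows "card {q \<in> params. red (param_value d q) = t} \<le> card E"
proof (cases "{q \<in> params. red (param_value d q) = t} = {}")
  case False
  then obtain i c w where icw: "(i, c, w) \<in> params" "red (d ^ i * (of_int c * w ^ 4)) = t"
    by (auto simp: param_value_def)
  have du: "gunit d" using d chi_eq_0_iff[of "gnorm d"] by (auto simp: gunit_def)
  have w: "gunit w" and c: "\<not> int p dvd c" and i: "i < 4" using icw by (auto simp: params_def U_def not_dvd_R)
  obtain b where b: "[c * b = 1] (mod int p)" using ex_inverse[OF c] by blast
  obtain v where v: "gcong (w * v) 1" "gunit v" using gunit_inverse[OF w] by blast
  define h where "h = (\<lambda>(i' :: nat, c' :: int, w'). red (w' * v))"
  have fib: "i' = i \<and> gcong ((w' * v) ^ 4 * of_int c') (of_int c)"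
    if q: "(i', c', w') \<in> params" "red (param_value d (i', c', w')) = t" for i' c' w'
  proof -
    have w': "gunit w'" and c': "\<not> int p dvd c'" and i': "i' < 4" using q by (auto simp: params_def U_def not_dvd_R)
    have eq: "gcong (d ^ i * (of_int c * w ^ 4)) (d ^ i' * (of_int c' * w' ^ 4))"
      using icw(2) q(2) by (simp add: param_value_def flip: red_eq_iff)
    have ii: "i = i'"
      using power_eq_scalar_fourth_power[OF d c c' w w' _ i' eq] power_eq_scalar_fourth_power[OF d c' c w' w _ i gcong_sym[OF eq]]
      by (cases "i \<le> i'") auto
    then have eq': "gcong (of_int c * w ^ 4) (of_int c' * w' ^ 4)"
      using eq gcong_cancel[OF gunit_power[OF du]] by blast
    have v4: "gcong (w ^ 4 * v ^ 4) 1" using gcong_power[OF v(1), of 4] by (simp add: power_mult_distrib)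
    have "(w' * v) ^ 4 * of_int c' = of_int c' * w' ^ 4 * v ^ 4" by (simp add: power_mult_distrib ac_simps)
    also have "gcong \<dots> (of_int c * w ^ 4 * v ^ 4)" by (rule gcong_mult[OF gcong_sym[OF eq'] gcong_refl])
    also have "of_int c * w ^ 4 * v ^ 4 = w ^ 4 * v ^ 4 * of_int c" by (simp add: ac_simps)
    also have "gcong \<dots> (1 * of_int c)" by (rule gcong_mult[OF v4 gcong_refl])
    finally show ?thesis using ii by simp
  qed
  have "inj_on h {q \<in> params. red (param_value d q) = t}"
  proof (rule inj_onI)
    fix r1 r2
    assume r: "r1 \<in> {q \<in> params. red (param_value d q) = t}" "r2 \<in> {q \<in> params. red (param_value d q) = t}" "h r1 = h r2"
    obtain i1 c1 w1 i2 c2 w2 where r12: "r1 = (i1, c1, w1)" "r2 = (i2, c2, w2)" by (cases r1; cases r2)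
    have q1: "(i1, c1, w1) \<in> params" "red (param_value d (i1, c1, w1)) = t"
      and q2: "(i2, c2, w2) \<in> params" "red (param_value d (i2, c2, w2)) = t"
      and h: "h (i1, c1, w1) = h (i2, c2, w2)" using r r12 by auto
    note f1 = fib[OF q1] and f2 = fib[OF q2]
    have h': "gcong (w1 * v) (w2 * v)" using h by (simp add: h_def red_eq_iff)
    then have "gcong w1 w2" using gcong_cancel[OF v(2), of w1 w2] by (simp add: mult.commute)
    then have w12: "w1 = w2" using q1(1) q2(1) by (metis (no_types, lifting) params_def U_def mem_Sigma_iff mem_Collect_eq red_G red_eq_iff)
    have "gunit ((w2 * v) ^ 4)" using q2(1) v(2) by (auto simp: params_def U_def gunit_mult intro!: gunit_power)
    moreover have "gcong ((w2 * v) ^ 4 * of_int c1) ((w2 * v) ^ 4 * of_int c2)"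
      using f1 f2 w12 gcong_trans gcong_sym by blast
    ultimately have "gcong (of_int c1) (of_int c2)" by (rule gcong_cancel)
    then have "c1 = c2" using q1(1) q2(1) small_cong_eq[of c1 c2] by (auto simp: gcong_iff params_def)
    then show "r1 = r2" using f1 f2 w12 r12 by simp
  qed
  moreover have "h ` {q \<in> params. red (param_value d q) = t} \<subseteq> E"
  proof (rule image_subsetI, clarify)
    fix i' c' w'
    assume q: "(i', c', w') \<in> params" "t = red (param_value d (i', c', w'))"
    have f: "gcong ((w' * v) ^ 4 * of_int c') (of_int c)" using fib[OF q(1) q(2)[symmetric]] by simp
    have c': "\<not> int p dvd c'" using q by (auto simp: params_def not_dvd_R)
    have "int p dvd gim ((w' * v) ^ 4 * of_int c')"
      using f unfolding gcong_iff by (simp add: cong_0_iff del: gre_gim_simps(11,12)) 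
    then have "int p dvd gim ((w' * v) ^ 4) * c'" by simp
    then have "int p dvd gim ((w' * v) ^ 4)" using c' prime_dvd_mult_int by blast
    moreover have "gcong (red (w' * v) ^ 4) ((w' * v) ^ 4)" by (rule gcong_power[OF gcong_red])
    ultimately have "int p dvd gim (red (w' * v) ^ 4)" unfolding gcong_iff using cong_dvd_iff by blast
    moreover have "gunit (red (w' * v))"
      using gunit_gcong[OF gcong_red, of "w' * v"] q(1) v(2) by (auto simp: params_def U_def gunit_mult)
    ultimately show "h (i', c', w') \<in> E" by (simp add: h_def E_def U_def)
  qed
  moreover have "finite E" by (simp add: E_def)
  ultimately show ?thesis using card_inj_on_le by blast
qed (simp only: card.empty)

text \<open>Surjectivity comes from counting: each fibre has at most \<open>card E\<close> elements,
  and the number of parameters is exactly \<open>card E\<close> times \<open>card U\<close>, so no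
  fibre can be smaller.\<close>

lemma sum_over_params:
  fixes f :: "gauss \<Rightarrow> int"
  assumes d: "chi (gnorm d) = -1"
  shows "(\<Sum>q\<in>params. f (red (param_value d q))) = int (card E) * (\<Sum>t\<in>U. f t)"
proof -
  let ?F = "\<lambda>t. {q \<in> params. red (param_value d q) = t}"
  have du: "gunit d" using d chi_eq_0_iff[of "gnorm d"] by (auto simp: gunit_def)
  have fin: "finite params" by (simp add: params_def)
  have img: "(\<lambda>q. red (param_value d q)) ` params \<subseteq> U"
  proof (rule image_subsetI, clarify)
    fix i c w assume q: "(i, c, w) \<in> params"
    then have "gunit (d ^ i * (of_int c * w ^ 4))"
      using du by (auto simp: params_def U_def gunit_mult gunit_of_int not_dvd_R intro!: gunit_power)
    then show "red (param_value d (i, c, w)) \<in> U"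
      using gunit_gcong[OF gcong_red] by (simp add: U_def param_value_def)
  qed
  have grp: "(\<Sum>q\<in>params. g (red (param_value d q))) = (\<Sum>t\<in>U. int (card (?F t)) * g t)" for g :: "gauss \<Rightarrow> int"
  proof -
    have "(\<Sum>q\<in>params. g (red (param_value d q))) = (\<Sum>t\<in>U. \<Sum>q\<in>?F t. g (red (param_value d q)))"
      by (rule sum.group[OF fin finite_U img, symmetric])
    also have "\<dots> = (\<Sum>t\<in>U. \<Sum>q\<in>?F t. g t)" by (intro sum.cong) auto
    finally show ?thesis by simp
  qed
  have "card params = 4 * (card {1..<int p} * card U)" by (simp add: params_def)
  then have "int (card params) = int (card E) * int (card U)"
    using card_E p_gt_2 by (simp add: of_nat_diff)
  moreover have "int (card params) = (\<Sum>t\<in>U. int (card (?F t)))"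
    using grp[of "\<lambda>_. 1"] by simp
  ultimately have "(\<Sum>t\<in>U. int (card E) - int (card (?F t))) = 0"
    by (simp add: sum_subtractf)
  moreover have "int (card E) - int (card (?F t)) \<ge> 0" for t using fibre_card_le[OF d, of t] by simp
  ultimately have "\<forall>t\<in>U. int (card E) - int (card (?F t)) = 0"
    using sum_nonneg_eq_0_iff[of U "\<lambda>t. int (card E) - int (card (?F t))"] by auto
  then have "(\<Sum>t\<in>U. int (card (?F t)) * f t) = (\<Sum>t\<in>U. int (card E) * f t)"
    by (intro sum.cong) auto
  then show ?thesis by (simp add: grp sum_distrib_left)
qed

lemma Phi_square_mult_fourth_power:
  assumes "\<not> int p dvd c" "gunit w"
  shows "Phi (t * (of_int c * w ^ 4)) ^ 2 = Phi t ^ 2"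
proof -
  have "chi c ^ 2 = 1" "chi (gnorm w) ^ 2 = 1"
    using assms chi_square by (simp_all add: gunit_def power2_eq_square)
  then show ?thesis by (simp only: Phi_mult_fourth_power[OF assms(2)] power_mult_distrib mult_1)
qed

text \<open>Over all parameters the square of \<open>Phi\<close> takes its values at 1, d, d^2, d^3
  equally often. Let e be the inverse of d. Modulo p the conjugate of d is d^3 N(d) e^4, so by
  \<open>Phi_gcnj\<close> the values at d and d^3 have the same square. The conjugate of d^2 is d^2
  N(d)^2 e^4, whose factor e^4 flips the sign, so the value at d^2 is 0.\<close>

lemma Phi_square_sum:
  assumes m2: "chi (-2) = 1" and d: "chi (gnorm d) = -1"
  shows "Phi 1 ^ 2 + 2 * Phi d ^ 2 = 16 * int p * (int p - 1) ^ 2"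
proof -
  have du: "gunit d" using d chi_eq_0_iff[of "gnorm d"] by (auto simp: gunit_def)
  have N: "\<not> int p dvd gnorm d" using du by (simp add: gunit_def)
  obtain e where e: "gcong (d * e) 1" "gunit e" using gunit_inverse[OF du] by blast
  have chi_e: "chi (gnorm e) = -1"
    using chi_gnorm_gcong[OF e(1)] d by (simp add: chi_mult)
  have e4: "gcong (d ^ 4 * e ^ 4) 1" using gcong_power[OF e(1), of 4] by (simp add: power_mult_distrib)
  have "Phi (d ^ 2) = - Phi (d ^ 2)"
  proof -
    have "gcong (gcnj (d ^ 2) * (d ^ 4 * e ^ 4)) (gcnj (d ^ 2) * 1)" by (rule gcong_mult[OF gcong_refl e4])
    moreover have "gcnj (d ^ 2) * (d ^ 4 * e ^ 4) = d ^ 2 * (of_int (gnorm d ^ 2) * e ^ 4)"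
    proof -
      have "d ^ 4 = d ^ 2 * d ^ 2" by (simp flip: power_add)
      moreover have "gcnj (d ^ 2) * d ^ 2 = of_int (gnorm d ^ 2)"
        using mult_gcnj[of "d ^ 2"] by (simp add: mult.commute)
      ultimately show ?thesis by (metis mult.assoc mult.commute)
    qed
    ultimately have "Phi (d ^ 2 * (of_int (gnorm d ^ 2) * e ^ 4)) = Phi (gcnj (d ^ 2))"
      using gperiodicD[OF Phi_gperiodic] by simp
    moreover have "chi (gnorm d ^ 2) = 1" using chi_even_power[OF N, of 1] by simp
    ultimately show ?thesis using Phi_mult_fourth_power[OF e(2), of "d ^ 2" "gnorm d ^ 2"] chi_e by (simp add: Phi_gcnj)
  qed
  then have Phi2: "Phi (d ^ 2) = 0" by simp
  have Phi3: "Phi (d ^ 3) ^ 2 = Phi d ^ 2"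
  proof -
    have "gcong (gcnj d * (d ^ 4 * e ^ 4)) (gcnj d * 1)" by (rule gcong_mult[OF gcong_refl e4])
    moreover have "gcnj d * (d ^ 4 * e ^ 4) = d ^ 3 * (of_int (gnorm d) * e ^ 4)"
    proof -
      have "d ^ 4 = d * d ^ 3" by (simp add: eval_nat_numeral)
      then show ?thesis unfolding mult_gcnj[symmetric] by (simp only: ac_simps)
    qed
    ultimately have "Phi (d ^ 3 * (of_int (gnorm d) * e ^ 4)) = Phi (gcnj d)"
      using gperiodicD[OF Phi_gperiodic] by simp
    then show ?thesis using Phi_square_mult_fourth_power[OF N e(2), of "d ^ 3"] by (simp add: Phi_gcnj)
  qed
  have "(\<Sum>q\<in>params. Phi (red (param_value d q)) ^ 2) = (\<Sum>i<4. \<Sum>c\<in>{1..<int p}. \<Sum>w\<in>U. Phi (d ^ i) ^ 2)"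
    unfolding params_def sum.cartesian_product
  proof (rule sum.cong[OF refl], clarify)
    fix i c w assume c: "c \<in> {1..<int p}" and w: "w \<in> U"
    have "Phi (red (param_value d (i, c, w))) = Phi (d ^ i * (of_int c * w ^ 4))"
      unfolding param_value_def prod.case by (rule gperiodicD[OF Phi_gperiodic gcong_red])
    then show "Phi (red (param_value d (i, c, w))) ^ 2 = Phi (d ^ i) ^ 2"
      using Phi_square_mult_fourth_power[OF not_dvd_R[OF c]] w by (simp add: U_def)
  qed
  also have "\<dots> = (int p - 1) * int (card U) * (Phi 1 ^ 2 + 2 * Phi d ^ 2)"
  proof -
    have "{..<4::nat} = {0, 1, 2, 3}" by auto
    then have "(\<Sum>i<4. Phi (d ^ i) ^ 2) = Phi 1 ^ 2 + 2 * Phi d ^ 2" by (simp add: Phi2 Phi3)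
    moreover have "(\<Sum>i<4. \<Sum>c\<in>{1..<int p}. \<Sum>w\<in>U. Phi (d ^ i) ^ 2) = (int p - 1) * int (card U) * (\<Sum>i<4. Phi (d ^ i) ^ 2)"
      using p_gt_2 by (simp add: sum_distrib_left of_nat_diff mult.assoc)
    ultimately show ?thesis by simp
  qed
  finally have "(int p - 1) * int (card U) * (Phi 1 ^ 2 + 2 * Phi d ^ 2) = int (card E) * (\<Sum>t\<in>U. Phi t ^ 2)"
    using sum_over_params[OF d, of "\<lambda>t. Phi t ^ 2"] by simp
  also have "(\<Sum>t\<in>U. Phi t ^ 2) = (\<Sum>t\<in>G. Phi t ^ 2)"
    by (rule sum.mono_neutral_left) (auto simp: U_def Phi_non_unit)
  also have "\<dots> = int (card U) * (int p * (int p - 1) * int (card E))"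
    by (rule Phi_second_moment[OF chi_E[OF m2]])
  \<comment> \<open>\<open>card E\<close> = 4 (p - 1) occurs twice, once from the multiplicity and
    once from the moment, whence the 16.\<close>
  also have "int (card E) * \<dots> = (int p - 1) * int (card U) * (16 * int p * (int p - 1) ^ 2)"
  proof -
    have "4 * q * (u * (P * q * (4 * q))) = q * u * (16 * P * q ^ 2)" for q u P :: int
      by (simp add: power2_eq_square)
    then show ?thesis unfolding card_E .
  qed
  finally have "((int p - 1) * int (card U)) * (Phi 1 ^ 2 + 2 * Phi d ^ 2) =
      ((int p - 1) * int (card U)) * (16 * int p * (int p - 1) ^ 2)" .
  moreover have "(int p - 1) * int (card U) \<noteq> 0" using one_in_U p_gt_2 by auto
  ultimately show ?thesis by (metis mult_left_cancel)
qed

text \<open>(1 + i)^2 = 2 i gives (1 + i)^p = (1 + i) 2^n i^n, while (1 + i)^p is congruent to 1 +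
  i^p. Comparing real parts yields 2^n modulo p, and Euler's criterion does the rest.\<close>

lemma chi_minus_2:
  assumes "p mod 8 \<in> {1, 3}"
  shows "chi (-2) = 1"
proof -
  define n where "n = (p - 1) div 2"
  have pn: "p = 2 * n + 1" using odd_p by (auto simp: n_def elim!: oddE)
  define i where "i = Gauss 0 1"
  have i2: "i ^ 2 = -1" by (rule gauss_eqI) (simp_all add: i_def power2_eq_square)
  have "i ^ 4 = (i ^ 2) ^ 2" by (simp flip: power_mult)
  then have i4: "i ^ (4 * k) = 1" for k using i2 by (simp add: power_mult)
  have "(1 + i) ^ 2 = 2 * i" using i2 by (simp add: power2_eq_square algebra_simps)
  then have "(1 + i) ^ p = (1 + i) * (2 ^ n * i ^ n)"
    by (simp only: pn power_add power_mult power_mult_distrib power_one_right) (simp only: mult.commute)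
  moreover have "of_int (int p) dvd (1 + i) ^ p - (1 + i ^ p)"
    using prime_dvd_freshman[OF prime_p] by simp
  ultimately have "int p dvd gre ((1 + i) * (2 ^ n * i ^ n) - (1 + i ^ p))"
    unfolding of_int_gauss_dvd_iff by simp
  moreover define m where "m = (2 :: int) ^ n"
  moreover have "2 ^ n = (of_int m :: gauss)" by (simp add: m_def)
  ultimately have d: "int p dvd gre ((1 + i) * (of_int m * i ^ n) - (1 + i ^ p))" by metis
  have "[(-2) ^ n = 1] (mod int p)"
  proof -
    consider "p mod 8 = 1" | "p mod 8 = 3" using assms by blast
    then show ?thesis
    proof cases
      case 1
      then obtain k where "p = 8 * k + 1" by (metis mult.commute div_mult_mod_eq)
      then have "n = 4 * k" "p = 4 * (2 * k) + 1" using pn by auto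
      then have e: "i ^ n = 1" "i ^ p = i" "even n" using i4[of k] i4[of "2 * k"] by simp_all
      have "int p dvd m - 1" using d unfolding e by (simp add: i_def)
      then show ?thesis using e(3) by (simp add: cong_iff_dvd_diff m_def)
    next
      case 2
      then obtain k where "p = 8 * k + 3" by (metis mult.commute div_mult_mod_eq)
      then have "n = 4 * k + 1" "p = 4 * (2 * k) + 3" using pn by auto
      moreover have "i ^ 3 = - i" using i2 by (simp add: eval_nat_numeral)
      ultimately have e: "i ^ n = i" "i ^ p = - i" "odd n" using i4[of k] i4[of "2 * k"] by (simp_all add: power_add)
      have "int p dvd - m - 1" using d unfolding e by (simp add: i_def)
      then show ?thesis using e(3) by (simp add: cong_iff_dvd_diff m_def)
    qed
  qed
  then have "[chi (-2) = 1] (mod int p)" using chi_euler[of "-2"] by (auto simp: n_def intro: cong_trans)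
  then show ?thesis using chi_values[of "-2"] p_gt_2 by (intro small_cong_eq) auto
qed

section \<open>The character sum at t = 1\<close>

lemma sum_power_R:
  assumes "0 < e" "e < 2 * (p - 1)"
  shows "[(\<Sum>y\<in>R. y ^ e) = (if e = p - 1 then -1 else 0)] (mod int p)"
proof (cases "e = p - 1")
  case True
  have "[(\<Sum>y\<in>{1..<int p}. y ^ e) = (\<Sum>y\<in>{1..<int p}. 1)] (mod int p)"
  proof (rule cong_sum)
    fix y assume "y \<in> {1..<int p}"
    then have y: "\<not> int p dvd y" by (auto simp: zdvd_not_zless)
    have "[y ^ ((p - 1) div 2) * y ^ ((p - 1) div 2) = chi y * chi y] (mod int p)"
      by (intro cong_mult cong_sym[OF chi_euler])
    moreover have "y ^ ((p - 1) div 2) * y ^ ((p - 1) div 2) = y ^ e"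
    proof -
      have "(p - 1) div 2 + (p - 1) div 2 = e" using odd_p True by (auto elim!: oddE)
      then show ?thesis by (simp flip: power_add)
    qed
    ultimately show "[y ^ e = 1] (mod int p)" using chi_square[OF y] by simp
  qed
  also have "(\<Sum>y\<in>{1..<int p}. 1) = int p - 1" using p_gt_2 by simp
  also have "[int p - 1 = -1] (mod int p)" by (simp add: cong_iff_dvd_diff)
  finally show ?thesis using assms True by (simp add: sum_R_split power_0_left)
next
  case False
  obtain g where g: "residue_primroot p g"
    using prime_primitive_root_exists[OF _ prime_p] p_gt_2 by auto
  have cop: "coprime p g" and ord: "ord p g = p - 1"
    using g prime_p by (auto simp: residue_primroot_def totient_prime)
  \<comment> \<open>The only multiple of p - 1 strictly between 0 and 2 (p - 1) is p - 1 itself. For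
    any other e, scaling y by the primitive root g multiplies the sum by g^e, which is not 1 modulo
    p.\<close>
  have "\<not> (p - 1) dvd e"
  proof
    assume "(p - 1) dvd e"
    then obtain k where "e = (p - 1) * k" by blast
    moreover have "(p - 1) * 2 \<le> (p - 1) * k" if "2 \<le> k" using that by (rule mult_le_mono2)
    moreover consider "k = 0" | "k = 1" | "2 \<le> k" by linarith
    ultimately show False using assms False by cases simp_all
  qed
  then have "\<not> [g ^ e = 1] (mod p)" by (simp only: ord_divides ord not_False_eq_True)
  then have ge: "\<not> int p dvd int g ^ e - 1"
    by (metis cong_iff_dvd_diff cong_int_iff of_nat_1 of_nat_power)
  have pg: "\<not> int p dvd int g" using cop prime_p p_gt_2
    by (metis coprime_absorb_left int_dvd_int_iff not_prime_unit)
  have "(\<Sum>y\<in>R. (int g * y + 0) ^ e mod int p) = (\<Sum>y\<in>R. y ^ e mod int p)"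
    by (rule sum_R_affine[OF _ pg]) (auto simp: periodic_def cong_def intro: cong_pow[unfolded cong_def])
  then have "[(\<Sum>y\<in>R. (int g * y) ^ e) = (\<Sum>y\<in>R. y ^ e)] (mod int p)"
    by (metis (no_types, lifting) add_0_right cong_def mod_sum_eq sum.cong)
  then have "int p dvd (int g ^ e - 1) * (\<Sum>y\<in>R. y ^ e)"
    by (simp add: cong_iff_dvd_diff power_mult_distrib left_diff_distrib flip: sum_distrib_left)
  then show ?thesis using ge False by (simp add: prime_dvd_mult_int cong_0_iff)
qed

lemma card_square_roots:
  assumes "a \<in> R"
  shows "int (card {y \<in> R. y ^ 2 mod int p = a}) = 1 + chi a"
proof -
  have root_iff: "(y \<in> R \<and> y ^ 2 mod int p = a) \<longleftrightarrow> y \<in> R \<and> [y ^ 2 = a] (mod int p)" for y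
    using assms by (auto simp: cong_def)
  consider "chi a = -1" | "chi a = 0" | "chi a = 1" using chi_values[of a] by auto
  then show ?thesis
  proof cases
    case 1
    then have "{y \<in> R. y ^ 2 mod int p = a} = {}"
      unfolding root_iff by (auto simp: chi_def Legendre_def QuadRes_def split: if_splits)
    then have "card {y \<in> R. y ^ 2 mod int p = a} = 0" by (simp only: card.empty)
    then show ?thesis using 1 by simp
  next
    case 2
    then have "a = 0" using assms dvd_R_iff by (simp add: chi_eq_0_iff)
    then have "{y \<in> R. y ^ 2 mod int p = a} = {0}"
      using p_gt_2 prime_dvd_mult_int dvd_R_iff by (auto simp: power2_eq_square mod_0_imp_dvd R_def dest!: mod_0_imp_dvd)
    then have "card {y \<in> R. y ^ 2 mod int p = a} = 1" by (metis is_singletonI is_singleton_altdef)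
    then show ?thesis using 2 by simp
  next
    case 3
    then obtain b where b: "[b ^ 2 = a] (mod int p)"
      by (auto simp: chi_def Legendre_def QuadRes_def split: if_splits)
    have nb: "\<not> int p dvd b"
    proof
      assume "int p dvd b"
      then have "int p dvd b ^ 2" by (simp add: power2_eq_square)
      then have "int p dvd a" using b cong_dvd_iff by blast
      then show False using 3 chi_eq_0_iff[of a] by simp
    qed
    have "{y \<in> R. y ^ 2 mod int p = a} = {b mod int p, (- b) mod int p}"
    proof (intro equalityI subsetI)
      fix y assume "y \<in> {y \<in> R. y ^ 2 mod int p = a}"
      then have y: "y \<in> R" "[y ^ 2 = a] (mod int p)" using root_iff by auto
      have "[y ^ 2 = b ^ 2] (mod int p)" using y b cong_trans cong_sym by blast
      then have "int p dvd (y - b) * (y + b)" by (simp add: cong_iff_dvd_diff power2_eq_square algebra_simps)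
      then have "[y = b] (mod int p) \<or> [y = - b] (mod int p)" by (simp add: prime_dvd_mult_int cong_iff_dvd_diff)
      then show "y \<in> {b mod int p, (- b) mod int p}" using y(1) by (auto simp: cong_def)
    next
      fix y assume "y \<in> {b mod int p, (- b) mod int p}"
      then show "y \<in> {y \<in> R. y ^ 2 mod int p = a}"
        using b assms by (auto simp: power_mod cong_def)
    qed
    moreover have "b mod int p \<noteq> (- b) mod int p"
    proof
      assume "b mod int p = (- b) mod int p"
      then have "int p dvd b - - b" by (simp only: mod_eq_dvd_iff)
      then have "int p dvd 2 * b" by simp
      then have "int p dvd 2" using nb by (simp add: prime_dvd_mult_int)
      then show False using p_gt_2 by (auto dest: zdvd_imp_le)
    qed
    ultimately show ?thesis using 3 by simp
  qed
qed

lemma sum_R_square: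
  fixes g :: "int \<Rightarrow> int"
  assumes "periodic g"
  shows "(\<Sum>y\<in>R. g (y ^ 2)) = (\<Sum>a\<in>R. (1 + chi a) * g a)"
proof -
  have "(\<Sum>y\<in>R. g (y ^ 2)) = (\<Sum>a\<in>R. \<Sum>y\<in>{y \<in> R. y ^ 2 mod int p = a}. g (y ^ 2))"
    by (rule sum.group[symmetric]) auto
  also have "\<dots> = (\<Sum>a\<in>R. \<Sum>y\<in>{y \<in> R. y ^ 2 mod int p = a}. g a)"
    by (intro sum.cong refl periodicD[OF assms]) (auto simp: cong_def)
  also have "\<dots> = (\<Sum>a\<in>R. (1 + chi a) * g a)"
    by (rule sum.cong) (simp_all add: card_square_roots)
  finally show ?thesis .
qed

text \<open>Substitute the inverse b of a: F(b) is F(a) b^3 modulo p, and b^3 has the same symbol as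
  a. The hypothesis holds for cubics whose coefficients read the same in both directions.\<close>

lemma sum_chi_palindromic:
  fixes F :: "int \<Rightarrow> int"
  assumes F: "\<And>a b. [a * b = 1] (mod int p) \<Longrightarrow> [F a * b ^ 3 = F b] (mod int p)"
  shows "(\<Sum>a\<in>{1..<int p}. chi a * chi (F a)) = (\<Sum>a\<in>{1..<int p}. chi (F a))"
proof -
  have "\<exists>b. b \<in> {1..<int p} \<and> [a * b = 1] (mod int p)" if "a \<in> {1..<int p}" for a
  proof -
    have "\<not> int p dvd a" using that by (auto simp: zdvd_not_zless)
    then obtain b where b: "[a * b = 1] (mod int p)" using ex_inverse by blast
    have "[a * (b mod int p) = a * b] (mod int p)" by (intro cong_mult cong_refl) (simp add: cong_def)
    then have *: "[a * (b mod int p) = 1] (mod int p)" using b cong_trans by blast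
    have "b mod int p \<noteq> 0"
    proof
      assume "b mod int p = 0"
      with * have "[0 = 1] (mod int p)" by simp
      then show False using p_gt_2 by (simp add: cong_def)
    qed
    moreover have "0 \<le> b mod int p" "b mod int p < int p" using p_gt_2 by simp_all
    ultimately show ?thesis using * by (intro exI[of _ "b mod int p"]) simp
  qed
  then obtain v where v: "v a \<in> {1..<int p}" "[a * v a = 1] (mod int p)" if "a \<in> {1..<int p}" for a
    by metis
  have vv: "v (v a) = a" if "a \<in> {1..<int p}" for a
  proof -
    have "[a * (v a * v (v a)) = a * 1] (mod int p)" by (intro cong_mult cong_refl v that)
    moreover have "[v (v a) * (a * v a) = v (v a) * 1] (mod int p)" by (intro cong_mult cong_refl v that)
    ultimately have "[v (v a) = a] (mod int p)" by (simp add: ac_simps) (metis cong_sym cong_trans)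
    then show ?thesis using v(1)[OF that] v(1)[OF v(1)[OF that]] that by (intro small_cong_eq) auto
  qed
  show ?thesis
  proof (rule sum.reindex_bij_witness[of _ v v])
    fix a assume a: "a \<in> {1..<int p}"
    have "chi a * chi (v a) = 1" using chi_cong[OF v(2)[OF a]] by (simp add: chi_mult)
    then have va: "chi (v a) = chi a" using chi_values[of a] chi_values[of "v a"] by auto
    have "chi (F a * v a ^ 3) = chi (F (v a))" by (rule chi_cong[OF F[OF v(2)[OF a]]])
    moreover have "chi (v a ^ 3) = chi a" using va chi_values[of a] by (auto simp: chi_power)
    ultimately show "chi (F (v a)) = chi a * chi (F a)" by (simp add: chi_mult mult.commute)
  qed (use v vv in auto)
qed

text \<open>Euler's criterion makes the summand a polynomial in y, and \<open>sum_power_R\<close>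
  keeps minus its coefficient of y^(p - 1). As y^n is a factor, this is the middle coefficient of
  (y^2 - 8 y + 8)^n.\<close>

lemma sum_R_trinomial:
  defines "n \<equiv> (p - 1) div 2"
  shows "[(\<Sum>y\<in>R. chi (y * (y ^ 2 - 8 * y + 8))) =
     - (\<Sum>j\<le>n div 2. int (n choose (2 * j)) * int (2 * j choose j) * 8 ^ j * (- 8) ^ (n - 2 * j))] (mod int p)"
proof -
  have pn: "p - 1 = 2 * n" "n > 0" using odd_p p_gt_2 by (auto simp: n_def elim!: oddE)
  define c where "c = (\<lambda>k j. int (n choose k) * int (k choose j) * 8 ^ (k - j) * (- 8) ^ (n - k))"
  have expand: "(y * (y ^ 2 - 8 * y + 8)) ^ n = (\<Sum>k\<le>n. \<Sum>j\<le>k. c k j * y ^ (2 * n + 2 * j - k))" for y :: int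
  proof -
    have "y * (y ^ 2 - 8 * y + 8) = y * ((y ^ 2 + 8) + (- 8 * y))" by simp
    then have "(y * (y ^ 2 - 8 * y + 8)) ^ n = y ^ n * ((y ^ 2 + 8) + (- 8 * y)) ^ n"
      by (simp only: power_mult_distrib)
    also have "\<dots> = (\<Sum>k\<le>n. \<Sum>j\<le>k. y ^ n * (int (n choose k) * (int (k choose j) * (y ^ 2) ^ j * 8 ^ (k - j)) * (- 8 * y) ^ (n - k)))"
      unfolding binomial_ring sum_distrib_left sum_distrib_right ..
    also have "\<dots> = (\<Sum>k\<le>n. \<Sum>j\<le>k. c k j * y ^ (2 * n + 2 * j - k))"
    proof (intro sum.cong refl)
      fix k j assume "k \<in> {..n}" "j \<in> {..k}"
      then have "2 * n + 2 * j - k = n + 2 * j + (n - k)" by auto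
      then have "y ^ (2 * n + 2 * j - k) = y ^ n * (y ^ 2) ^ j * y ^ (n - k)"
        by (simp only: power_add power_mult)
      then show "y ^ n * (int (n choose k) * (int (k choose j) * (y ^ 2) ^ j * 8 ^ (k - j)) * (- 8 * y) ^ (n - k)) = c k j * y ^ (2 * n + 2 * j - k)"
        unfolding c_def power_mult_distrib by (simp only: ac_simps)
    qed
    finally show ?thesis .
  qed
  have "[(\<Sum>y\<in>R. chi (y * (y ^ 2 - 8 * y + 8))) = (\<Sum>y\<in>R. (y * (y ^ 2 - 8 * y + 8)) ^ n)] (mod int p)"
    by (rule cong_sum) (simp only: n_def chi_euler)
  also have "(\<Sum>y\<in>R. (y * (y ^ 2 - 8 * y + 8)) ^ n) = (\<Sum>k\<le>n. \<Sum>j\<le>k. \<Sum>y\<in>R. c k j * y ^ (2 * n + 2 * j - k))"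
  proof -
    have "(\<Sum>y\<in>R. (y * (y ^ 2 - 8 * y + 8)) ^ n) = (\<Sum>y\<in>R. \<Sum>k\<le>n. \<Sum>j\<le>k. c k j * y ^ (2 * n + 2 * j - k))"
      by (simp only: expand)
    also have "\<dots> = (\<Sum>k\<le>n. \<Sum>y\<in>R. \<Sum>j\<le>k. c k j * y ^ (2 * n + 2 * j - k))" by (rule sum.swap)
    also have "\<dots> = (\<Sum>k\<le>n. \<Sum>j\<le>k. \<Sum>y\<in>R. c k j * y ^ (2 * n + 2 * j - k))" by (intro sum.cong refl sum.swap)
    finally show ?thesis .
  qed
  also have "[\<dots> = (\<Sum>k\<le>n. \<Sum>j\<le>k. if k = 2 * j then - c k j else 0)] (mod int p)"
  proof (intro cong_sum)
    fix k j assume kj: "k \<in> {..n}" "j \<in> {..k}"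
    \<comment> \<open>All exponents lie between n and 3 n, while 2 (p - 1) = 4 n.\<close>
    have "0 < 2 * n + 2 * j - k" "2 * n + 2 * j - k < 2 * (p - 1)" using kj pn by auto
    from sum_power_R[OF this]
    have "[c k j * (\<Sum>y\<in>R. y ^ (2 * n + 2 * j - k)) = c k j * (if 2 * n + 2 * j - k = p - 1 then - 1 else 0)] (mod int p)"
      by (rule cong_mult[OF cong_refl])
    moreover have "2 * n + 2 * j - k = p - 1 \<longleftrightarrow> k = 2 * j" using kj pn by auto
    ultimately show "[(\<Sum>y\<in>R. c k j * y ^ (2 * n + 2 * j - k)) = (if k = 2 * j then - c k j else 0)] (mod int p)"
      by (simp add: sum_distrib_left split: if_splits)
  qed
  also have "(\<Sum>k\<le>n. \<Sum>j\<le>k. if k = 2 * j then - c k j else 0) = (\<Sum>k\<le>n. \<Sum>j\<le>n. if k = 2 * j then - c k j else 0)"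
    by (intro sum.cong sum.mono_neutral_left) auto
  also have "\<dots> = (\<Sum>j\<le>n. \<Sum>k\<le>n. if k = 2 * j then - c k j else 0)" by (rule sum.swap)
  also have "\<dots> = (\<Sum>j\<le>n. if 2 * j \<le> n then - c (2 * j) j else 0)" by (simp add: sum.delta)
  also have "\<dots> = (\<Sum>j\<le>n div 2. - c (2 * j) j)"
    by (rule sum.mono_neutral_cong_right) auto
  also have "\<dots> = - (\<Sum>j\<le>n div 2. int (n choose (2 * j)) * int (2 * j choose j) * 8 ^ j * (- 8) ^ (n - 2 * j))"
    by (simp add: c_def sum_negf)
  finally show ?thesis .
qed

text \<open>The separate term is the point z = i, where both the norm and z^4 are 1; the other
  points are 1 + y i.\<close>

definition phi :: "gauss \<Rightarrow> int" where
  "phi t = chi (gre t) + (\<Sum>y\<in>R. chi (gnorm (Gauss 1 y)) * chi (gre (t * Gauss 1 y ^ 4)))"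

text \<open>Up to scaling by nonzero residues the sum runs over the projective line.\<close>

lemma Phi_eq_phi: "Phi t = (int p - 1) * phi t"
proof -
  let ?h = "\<lambda>z. chi (gnorm z) * chi (gre (t * z ^ 4))"
  have scale: "?h (of_int x * z) = ?h z" if "\<not> int p dvd x" for x z
  proof -
    have "t * (of_int x * z) ^ 4 = of_int (x ^ 4) * (t * z ^ 4)" by (simp add: power_mult_distrib ac_simps)
    moreover have "gre (of_int a * v) = a * gre v" for a v by simp
    ultimately have "gre (t * (of_int x * z) ^ 4) = x ^ 4 * gre (t * z ^ 4)" by (simp only:)
    moreover have "chi (x ^ 4) = 1" "chi (x ^ 2) = 1"
      using chi_even_power[OF that, of 2] chi_even_power[OF that, of 1] by simp_all
    ultimately show ?thesis by (simp only: gnorm_mult gnorm_of_int chi_mult mult_1)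
  qed
  have zero: "(\<Sum>y\<in>R. ?h (Gauss 0 y)) = (int p - 1) * chi (gre t)"
  proof -
    have "?h (Gauss 0 y) = chi (gre t)" if "y \<in> {1..<int p}" for y
    proof -
      have "Gauss 0 y = of_int y * Gauss 0 1" by (rule gauss_eqI) simp_all
      then have "?h (Gauss 0 y) = ?h (Gauss 0 1)" by (simp only: scale[OF not_dvd_R[OF that]])
      also have "Gauss 0 1 ^ 4 = 1" by (simp add: eval_nat_numeral) (rule gauss_eqI; simp)
      finally show ?thesis by (simp add: gnorm_def)
    qed
    then show ?thesis using p_gt_2 by (simp add: sum_R_split gnorm_def of_nat_diff)
  qed
  have nonzero: "(\<Sum>y\<in>R. ?h (Gauss x y)) = (\<Sum>y\<in>R. ?h (Gauss 1 y))" if x: "x \<in> {1..<int p}" for x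
  proof -
    have "periodic (\<lambda>y. ?h (Gauss x y))"
      using Phi_term_gperiodic[of t] unfolding periodic_def gperiodic_def by (auto simp: gcong_iff)
    then have "(\<Sum>y\<in>R. ?h (Gauss x y)) = (\<Sum>y\<in>R. ?h (Gauss x (x * y + 0)))"
      by (rule sum_R_affine[OF _ not_dvd_R[OF x], symmetric])
    also have "\<dots> = (\<Sum>y\<in>R. ?h (Gauss 1 y))"
    proof (rule sum.cong[OF refl])
      fix y
      have "Gauss x (x * y + 0) = of_int x * Gauss 1 y" by (rule gauss_eqI) simp_all
      then show "?h (Gauss x (x * y + 0)) = ?h (Gauss 1 y)" by (simp only: scale[OF not_dvd_R[OF x]])
    qed
    finally show ?thesis .
  qed
  have "Phi t = (\<Sum>y\<in>R. ?h (Gauss 0 y)) + (\<Sum>x\<in>{1..<int p}. \<Sum>y\<in>R. ?h (Gauss x y))"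
    unfolding Phi_def sum_G by (rule sum_R_split)
  also have "\<dots> = (int p - 1) * chi (gre t) + (\<Sum>x\<in>{1..<int p}. \<Sum>y\<in>R. ?h (Gauss 1 y))"
    by (simp only: zero nonzero cong: sum.cong)
  also have "\<dots> = (int p - 1) * phi t"
    using p_gt_2 by (simp add: phi_def algebra_simps of_nat_diff)
  finally show ?thesis .
qed

text \<open>At 1 + y i the sextic is F(a) for a = y^2. Passing from y to a brings in the weight 1 +
  chi(a), and since F is palindromic the two parts agree apart from a = 0, for which the term of the
  point i makes up. The shift of a by -1 gives the cubic.\<close>

lemma phi_1: "phi 1 = 2 * (\<Sum>y\<in>R. chi (y * (y ^ 2 - 8 * y + 8)))"
proof -
  define F where "F = (\<lambda>a :: int. (1 + a) * (1 - 6 * a + a ^ 2))"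
  have perF: "periodic (\<lambda>a. chi (F a))"
    unfolding periodic_def F_def
    by (intro allI impI chi_cong cong_mult cong_add cong_diff cong_pow cong_refl)
  have "phi 1 = 1 + (\<Sum>y\<in>R. chi (F (y ^ 2)))"
  proof -
    have "gnorm (Gauss 1 y) * gre (Gauss 1 y ^ 4) = F (y ^ 2)" for y
      by (simp add: gnorm_def gre_fourth_power F_def power_mult[symmetric] del: power_mult)
    then show ?thesis unfolding phi_def by (simp flip: chi_mult)
  qed
  also have "(\<Sum>y\<in>R. chi (F (y ^ 2))) = (\<Sum>a\<in>R. (1 + chi a) * chi (F a))"
    by (rule sum_R_square[OF perF])
  also have "\<dots> = (\<Sum>a\<in>R. chi (F a)) + (\<Sum>a\<in>R. chi a * chi (F a))"
    by (simp add: distrib_right sum.distrib)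
  also have "(\<Sum>a\<in>R. chi a * chi (F a)) = (\<Sum>a\<in>{1..<int p}. chi a * chi (F a))"
    by (simp add: sum_R_split)
  also have "\<dots> = (\<Sum>a\<in>{1..<int p}. chi (F a))"
  proof (rule sum_chi_palindromic)
    fix a b assume ab: "[a * b = 1] (mod int p)"
    have "F a * b ^ 3 = (b + a * b) * (b ^ 2 - 6 * b * (a * b) + (a * b) ^ 2)"
      by (simp add: F_def power2_eq_square power3_eq_cube algebra_simps)
    also have "[\<dots> = (b + 1) * (b ^ 2 - 6 * b * 1 + 1 ^ 2)] (mod int p)"
      by (intro cong_mult cong_add cong_diff cong_pow cong_refl ab)
    also have "(b + 1) * (b ^ 2 - 6 * b * 1 + 1 ^ 2) = F b" by (simp add: F_def algebra_simps)
    finally show "[F a * b ^ 3 = F b] (mod int p)" .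
  qed
  also have "\<dots> = (\<Sum>a\<in>R. chi (F a)) - 1"
    by (simp add: sum_R_split) (simp add: F_def)
  finally have "phi 1 = 2 * (\<Sum>a\<in>R. chi (F a))" by simp
  also have "(\<Sum>a\<in>R. chi (F a)) = (\<Sum>a\<in>R. chi (F (1 * a + (- 1))))"
    using prime_int_p not_prime_unit by (intro sum_R_affine[OF perF, symmetric]) auto
  also have "\<dots> = (\<Sum>y\<in>R. chi (y * (y ^ 2 - 8 * y + 8)))"
    by (intro sum.cong refl arg_cong[of _ _ chi]) (simp add: F_def power2_eq_square algebra_simps)
  finally show ?thesis .
qed

text \<open>Dividing \<open>Phi_square_sum\<close> by (p - 1)^2 leaves phi(1)^2 + 2 phi(d)^2 = 16 p,
  and the parity descent gives phi(1) = 4 c. Half of phi(1) is the cubic character sum, which is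
  known modulo p.\<close>

theorem square_plus_two_squares_cong:
  assumes "p mod 8 \<in> {1, 3}"
  defines "n \<equiv> (p - 1) div 2"
  obtains c e where "int p = c ^ 2 + 2 * e ^ 2"
    and "[2 * c = - (\<Sum>j\<le>n div 2. int (n choose (2 * j)) * int (2 * j choose j) * 8 ^ j * (- 8) ^ (n - 2 * j))] (mod int p)"
proof -
  obtain d where d: "chi (gnorm d) = -1" using ex_square_plus_square_nonresidue by blast
  have "(int p - 1) ^ 2 * (phi 1 ^ 2 + 2 * phi d ^ 2) = (int p - 1) ^ 2 * (16 * int p)"
  proof -
    have "q * (a + 2 * b) = q * (16 * m)" if "q * a + 2 * (q * b) = 16 * m * q" for q a b m :: int
      using that by (simp add: algebra_simps)
    then show ?thesis
      using Phi_square_sum[OF chi_minus_2[OF assms(1)] d] unfolding Phi_eq_phi power_mult_distrib .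
  qed
  moreover have "(int p - 1) ^ 2 \<noteq> 0" using p_gt_2 by simp
  ultimately have "phi 1 ^ 2 + 2 * phi d ^ 2 = 16 * int p" by (metis mult_left_cancel)
  then obtain c e where ce: "phi 1 = 4 * c" "int p = c ^ 2 + 2 * e ^ 2" using four_descent by blast
  then have "2 * c = (\<Sum>y\<in>R. chi (y * (y ^ 2 - 8 * y + 8)))" using phi_1 by simp
  then show ?thesis using that[OF ce(2)] sum_R_trinomial by (simp add: n_def)
qed

end

section \<open>The two cases of the theorem\<close>

lemma sum_W_cong_four_square:
  fixes p :: nat
  assumes p: "prime p" "p > 3" "p mod 8 \<in> {1, 3}" and xy: "int p = x ^ 2 + 2 * y ^ 2"
  shows "rat_cong p (\<Sum>k=0..p - 1. of_nat (2 * k choose k) * (of_int (W k) / 8 ^ k)) (of_int (4 * x ^ 2 - 2 * int p))"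
proof -
  interpret odd_prime p using p by unfold_locales auto
  define n where "n = (p - 1) div 2"
  have pn: "p = 2 * n + 1" using odd_p by (auto simp: n_def elim!: oddE)
  interpret prime_gt_3 p n using pn p by unfold_locales
  obtain c e where ce: "int p = c ^ 2 + 2 * e ^ 2"
    and c: "[2 * c = - (\<Sum>j\<le>n div 2. int (n choose (2 * j)) * int (2 * j choose j) * 8 ^ j * (- 8) ^ (n - 2 * j))] (mod int p)"
    using square_plus_two_squares_cong[OF p(3)] unfolding n_def by blast
  define H where "H = (\<Sum>j\<le>n div 2. of_nat (n choose (2 * j)) * of_nat (2 * j choose j) / 8 ^ j :: rat)"
  have "of_int (- (\<Sum>j\<le>n div 2. int (n choose (2 * j)) * int (2 * j choose j) * 8 ^ j * (- 8) ^ (n - 2 * j))) = - ((- 8) ^ n * H)"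
  proof -
    have "of_nat (n choose (2 * j)) * of_nat (2 * j choose j) * 8 ^ j * (- 8) ^ (n - 2 * j) =
      (- 8) ^ n * (of_nat (n choose (2 * j)) * of_nat (2 * j choose j) / 8 ^ j :: rat)" if "j \<le> n div 2" for j
    proof -
      have "n = (n - 2 * j) + 2 * j" using that by simp
      then have "(- 8 :: rat) ^ n = (- 8) ^ (n - 2 * j) * (- 8) ^ (2 * j)" by (metis power_add)
      also have "(- 8 :: rat) ^ (2 * j) = 8 ^ j * 8 ^ j" by (simp add: power_mult flip: power_mult_distrib)
      finally show ?thesis by simp
    qed
    then show ?thesis by (simp add: H_def sum_distrib_left)
  qed
  then have c': "rat_cong p (of_int (2 * c)) (- ((- 8) ^ n * H))"
    using cong_rat_of_int[OF c] by simp
  have eight: "rat_cong p (64 ^ n) 1"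
  proof -
    have "\<not> p dvd 8"
    proof
      assume "p dvd 8"
      then have "p dvd 2 ^ 3" by simp
      then have "p dvd 2" using p(1) prime_dvd_power by blast
      then show False using p(2) by (auto dest: dvd_imp_le)
    qed
    then have "[8 ^ (p - 1) = 1] (mod p)" by (rule fermat_theorem[OF p(1)])
    then have "[int (8 ^ (p - 1)) = int 1] (mod int p)" by (simp only: cong_int_iff)
    then have "rat_cong p (of_int (int (8 ^ (p - 1)))) (of_int (int 1))" by (rule cong_rat_of_int)
    moreover have "p - 1 = 2 * n" using pn by simp
    ultimately show ?thesis by (simp add: power_mult)
  qed
  \<comment> \<open>x belongs to an arbitrary representation of p, c to the one produced by the
    character sum and so tied to the binomial coefficients.\<close>
  have "x ^ 2 = c ^ 2" by (rule representation_unique[OF prime_int_p xy ce])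
  have "rat_cong p (\<Sum>k=0..p - 1. of_nat (2 * k choose k) * (of_int (W k) / 8 ^ k)) (legendre_at_0 (n div 2) ^ 2)"
    using sum_W_cong_legendre_mean by (simp only: legendre_mean_eq_square)
  also have H: "rat_cong p H (legendre_at_0 (n div 2))"
    unfolding H_def by (rule sum_trinomial_cong_legendre_at_0)
  have "rat_cong p (legendre_at_0 (n div 2) ^ 2) (H ^ 2)"
    by (rule cong_rat_power[OF cong_rat_sym[OF H]])
  \<comment> \<open>Squaring removes the sign of - (-8)^n, and 64^n = 8^(p - 1) is congruent to
    1.\<close>
  also have "rat_cong p (H ^ 2) (of_int (2 * c) ^ 2)"
  proof -
    have "rat_cong p (64 ^ n * H ^ 2) (1 * H ^ 2)"
      by (intro cong_rat_mult eight cong_rat_power cong_rat_refl cong_rat_integral(1)[OF H])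
    moreover have "(- ((- 8) ^ n * H)) ^ 2 = 64 ^ n * H ^ 2"
    proof -
      have "((- 8 :: rat) ^ n) ^ 2 = ((- 8) ^ 2) ^ n" by (metis power_mult mult.commute)
      then show ?thesis by (simp add: power_mult_distrib)
    qed
    ultimately show ?thesis using cong_rat_power[OF c', of 2] cong_rat_sym cong_rat_trans by (metis mult_1)
  qed
  also have "rat_cong p (of_int (2 * c) ^ 2) (of_int (4 * x ^ 2 - 2 * int p))"
  proof -
    have "(2 * c) ^ 2 - (4 * x ^ 2 - 2 * int p) = int p * 2"
      by (simp only: \<open>x ^ 2 = c ^ 2\<close> power_mult_distrib) simp
    then have "[(2 * c) ^ 2 = 4 * x ^ 2 - 2 * int p] (mod int p)"
      by (simp only: cong_iff_dvd_diff dvd_triv_left)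
    then show ?thesis using cong_rat_of_int by fastforce
  qed
  finally show ?thesis .
qed

lemma sum_W_cong_zero:
  fixes p :: nat
  assumes p: "prime p" "p > 3" "p mod 8 \<in> {5, 7}"
  shows "rat_cong p (\<Sum>k=0..p - 1. of_nat (2 * k choose k) * (of_int (W k) / 8 ^ k)) 0"
proof -
  interpret odd_prime p using p by unfold_locales auto
  define n where "n = (p - 1) div 2"
  have pn: "p = 2 * n + 1" using odd_p by (auto simp: n_def elim!: oddE)
  interpret prime_gt_3 p n using pn p by unfold_locales
  \<comment> \<open>p = 8 k + 5 and p = 8 k + 7 give n = 4 k + 2 and n = 4 k + 3, both with integer
    half 2 k + 1.\<close>
  have "odd (n div 2)" using p(3) pn by auto presburger+
  then show ?thesis
    using sum_W_cong_legendre_mean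
    by (simp add: legendre_mean_eq_square legendre_at_0_odd)
qed

theorem theorem2p4:
  fixes p :: nat
  assumes "prime p" and "p > 3"
  shows "(p mod 8 \<in> {1, 3} \<longrightarrow>
            (\<exists>x y :: int. int p = x ^ 2 + 2 * y ^ 2) \<and>
            (\<forall>x y :: int. int p = x ^ 2 + 2 * y ^ 2 \<longrightarrow>
               rat_cong p (\<Sum>k=0..p - 1. of_nat ((2 * k) choose k) * (of_int (W k) / 8 ^ k))
                          (of_int (4 * x ^ 2 - 2 * int p)))) \<and>
         (p mod 8 \<in> {5, 7} \<longrightarrow>
            rat_cong p (\<Sum>k=0..p - 1. of_nat ((2 * k) choose k) * (of_int (W k) / 8 ^ k)) 0)"
proof -
  have "\<exists>x y :: int. int p = x ^ 2 + 2 * y ^ 2" if "p mod 8 \<in> {1, 3}"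
  proof -
    interpret odd_prime p using assms by unfold_locales auto
    show ?thesis using square_plus_two_squares_cong[OF that] by metis
  qed
  then show ?thesis
    using sum_W_cong_four_square[OF assms] sum_W_cong_zero[OF assms] by blast
qed

end
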